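(* Let $\mathfrak g=\mathfrak{sl}_3$ (type $A_2$) and $\lambda\in P^+$. If $\boldsymbol\lambda=(\lambda_1,\lambda_2),\boldsymbol\mu=(\mu_1,\mu_2)\in P^+(\lambda,2)$ satisfy $\boldsymbol\lambda\preceq\boldsymbol\mu$, then for all $\nu\in P^+$, $$\dim\operatorname{Hom}_{\mathfrak g}(V(\nu),V(\lambda_1)\otimes V(\lambda_2))\le\dim\operatorname{Hom}_{\mathfrak g}(V(\nu),V(\mu_1)\otimes V(\mu_2)).$$
   Context: $\mathfrak g$ is a finite-dimensional complex simple Lie algebra with Cartan subalgebra $\mathfrak h$, simple roots $\alpha_i$, fundamental weights $\omega_i$, positive roots $R^+$; for $\alpha\in R^+$, $h_\alpha\in\mathfrak h$ is the coroot. $P^+$ is the set of dominant integral weights, and $V(\mu)$ is the irreducible finite-dimensional module of highest weight $\mu\in P^+$. For $\lambda\in P^+$, $P^+(\lambda,2)=\{(\lambda_1,\lambda_2)\in(P^+)^2:\lambda_1+\lambda_2=\lambda\}$, and $(\lambda_1,\lambda_2)\preceq(\mu_1,\mu_2)$ means $\min\{\lambda_1(h_\alpha),\lambda_2(h_\alpha)\}\le\min\{\mu_1(h_\alpha),\mu_2(h_\alpha)\}$ for all $\alpha\in R^+$ (for $k=2$ this is the general order: $r_{\alpha,\ell}(\boldsymbol\lambda)$ is the minimum of sums of $\ell$ components evaluated at $h_\alpha$, and $r_{\alpha,2}=\lambda(h_\alpha)$ is constant). *)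

theory Defs
  imports "Jordan_Normal_Form.Matrix"
begin

definition tr3 :: "complex mat \<Rightarrow> complex" where
  "tr3 X = X $$ (0,0) + X $$ (1,1) + X $$ (2,2)"

definition sl3 :: "complex mat set" where
  "sl3 = {X. X \<in> carrier_mat 3 3 \<and> tr3 X = 0}"

definition lie_br :: "complex mat \<Rightarrow> complex mat \<Rightarrow> complex mat" where
  "lie_br X Y = X * Y - Y * X"

definition Emat :: "nat \<Rightarrow> nat \<Rightarrow> complex mat" where
  "Emat i j = mat 3 3 (\<lambda>(k,l). if k = i \<and> l = j then 1 else 0)"

definition diag3 :: "complex \<Rightarrow> complex \<Rightarrow> complex \<Rightarrow> complex mat" where
  "diag3 a b c = mat 3 3 (\<lambda>(k,l). if k = l then (if k = 0 then a else if k = 1 then b else c) else 0)"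

definition cartan :: "complex mat set" where
  "cartan = {H \<in> sl3. \<forall>k<3. \<forall>l<3. k \<noteq> l \<longrightarrow> H $$ (k,l) = 0}"

definition pos_root_vectors :: "complex mat set" where
  "pos_root_vectors = {Emat 0 1, Emat 1 2, Emat 0 2}"

definition pos_coroots :: "complex mat set" where
  "pos_coroots = {diag3 1 (-1) 0, diag3 0 1 (-1), diag3 1 0 (-1)}"

text \<open>Dominant integral weights P^+: a weight (a,b) stands for a*omega_1 + b*omega_2,
  a,b natural numbers.  On H = diag(h1,h2,h3) in the Cartan subalgebra,
  omega_1(H) = h1 and omega_2(H) = h1 + h2.\<close>
type_synonym dweight = "nat \<times> nat"

definition wt :: "dweight \<Rightarrow> complex mat \<Rightarrow> complex" where
  "wt \<nu> H = of_nat (fst \<nu>) * H $$ (0,0) + of_nat (snd \<nu>) * (H $$ (0,0) + H $$ (1,1))"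

definition wadd :: "dweight \<Rightarrow> dweight \<Rightarrow> dweight" where
  "wadd p q = (fst p + fst q, snd p + snd q)"

definition wpreceq :: "dweight \<times> dweight \<Rightarrow> dweight \<times> dweight \<Rightarrow> bool" where
  "wpreceq L M \<longleftrightarrow> (\<forall>h \<in> pos_coroots.
      min (Re (wt (fst L) h)) (Re (wt (snd L) h)) \<le> min (Re (wt (fst M) h)) (Re (wt (snd M) h)))"

definition is_rep :: "nat \<Rightarrow> (complex mat \<Rightarrow> complex mat) \<Rightarrow> bool" where
  "is_rep n \<rho> \<longleftrightarrow>
     (\<forall>X \<in> sl3. \<rho> X \<in> carrier_mat n n) \<and>
     (\<forall>X \<in> sl3. \<forall>Y \<in> sl3. \<rho> (X + Y) = \<rho> X + \<rho> Y) \<and>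
     (\<forall>X \<in> sl3. \<forall>c. \<rho> (c \<cdot>\<^sub>m X) = c \<cdot>\<^sub>m \<rho> X) \<and>
     (\<forall>X \<in> sl3. \<forall>Y \<in> sl3. \<rho> (lie_br X Y) = lie_br (\<rho> X) (\<rho> Y))"

definition is_subspace :: "nat \<Rightarrow> complex vec set \<Rightarrow> bool" where
  "is_subspace n U \<longleftrightarrow> U \<subseteq> carrier_vec n \<and> 0\<^sub>v n \<in> U \<and>
     (\<forall>u \<in> U. \<forall>v \<in> U. u + v \<in> U) \<and> (\<forall>u \<in> U. \<forall>c. c \<cdot>\<^sub>v u \<in> U)"

definition irreducible_rep :: "nat \<Rightarrow> (complex mat \<Rightarrow> complex mat) \<Rightarrow> bool" where
  "irreducible_rep n \<rho> \<longleftrightarrow> is_rep n \<rho> \<and> n > 0 \<and>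
     (\<forall>U. is_subspace n U \<and> (\<forall>X \<in> sl3. \<forall>u \<in> U. \<rho> X *\<^sub>v u \<in> U)
          \<longrightarrow> U = {0\<^sub>v n} \<or> U = carrier_vec n)"

definition has_hw :: "nat \<Rightarrow> (complex mat \<Rightarrow> complex mat) \<Rightarrow> dweight \<Rightarrow> bool" where
  "has_hw n \<rho> \<nu> \<longleftrightarrow> (\<exists>v \<in> carrier_vec n. v \<noteq> 0\<^sub>v n \<and>
     (\<forall>H \<in> cartan. \<rho> H *\<^sub>v v = wt \<nu> H \<cdot>\<^sub>v v) \<and>
     (\<forall>E \<in> pos_root_vectors. \<rho> E *\<^sub>v v = 0\<^sub>v n))"

definition is_V :: "nat \<Rightarrow> (complex mat \<Rightarrow> complex mat) \<Rightarrow> dweight \<Rightarrow> bool" where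
  "is_V n \<rho> \<nu> \<longleftrightarrow> irreducible_rep n \<rho> \<and> has_hw n \<rho> \<nu>"

definition kron :: "complex mat \<Rightarrow> complex mat \<Rightarrow> complex mat" where
  "kron A B = mat (dim_row A * dim_row B) (dim_col A * dim_col B)
     (\<lambda>(i,j). A $$ (i div dim_row B, j div dim_col B) * B $$ (i mod dim_row B, j mod dim_col B))"

definition tensor_rep :: "nat \<Rightarrow> (complex mat \<Rightarrow> complex mat) \<Rightarrow> nat \<Rightarrow> (complex mat \<Rightarrow> complex mat)
    \<Rightarrow> complex mat \<Rightarrow> complex mat" where
  "tensor_rep n \<rho> m \<sigma> X = kron (\<rho> X) (1\<^sub>m m) + kron (1\<^sub>m n) (\<sigma> X)"

definition hom_g :: "nat \<Rightarrow> (complex mat \<Rightarrow> complex mat) \<Rightarrow> nat \<Rightarrow> (complex mat \<Rightarrow> complex mat)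
    \<Rightarrow> complex mat set" where
  "hom_g n \<rho> m \<sigma> = {T \<in> carrier_mat m n. \<forall>X \<in> sl3. T * \<rho> X = \<sigma> X * T}"

definition lin_indep_mats :: "nat \<Rightarrow> nat \<Rightarrow> complex mat set \<Rightarrow> bool" where
  "lin_indep_mats m n B \<longleftrightarrow> (\<forall>c :: complex mat \<Rightarrow> complex.
     (\<forall>i<m. \<forall>j<n. (\<Sum>T\<in>B. c T * T $$ (i,j)) = 0) \<longrightarrow> (\<forall>T \<in> B. c T = 0))"

definition dim_mats :: "nat \<Rightarrow> nat \<Rightarrow> complex mat set \<Rightarrow> nat" where
  "dim_mats m n S = Max {card B | B. finite B \<and> B \<subseteq> S \<and> lin_indep_mats m n B}"

definition dim_hom :: "nat \<Rightarrow> (complex mat \<Rightarrow> complex mat) \<Rightarrow> nat \<Rightarrow> (complex mat \<Rightarrow> complex mat) \<Rightarrow> nat" where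
  "dim_hom n \<rho> m \<sigma> = dim_mats m n (hom_g n \<rho> m \<sigma>)"

end

theory Submission
  imports Defs "HOL-Library.Function_Algebras"
begin

text \<open>Write \<open>\<lambda> + \<mu> - \<nu> = m \<alpha>\<^sub>1 + n \<alpha>\<^sub>2\<close>. Pairing a highest weight vector \<open>u\<close> of \<open>V(\<lambda>) \<otimes> V(\<mu>)\<close> of
  weight \<open>\<nu>\<close> with the highest weight covectors gives the functional \<open>L(p) = (\<phi> p \<otimes> \<psi>) u\<close> on \<open>U(n\<^sup>+)\<close>. It
  lives in degree \<open>(m, n)\<close>, kills \<open>e\<^sub>i\<^bsup>\<lambda>(i)+1\<^esup> U\<close> and \<open>U e\<^sub>i\<^bsup>\<mu>(i)+1\<^esup>\<close>, and determines \<open>u\<close>. The functionals on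
  \<open>U(n\<^sup>+)\<close> are the polynomials \<open>\<complex>[x, y, z, w] / (x y = z + w)\<close> on the unipotent group. For \<open>m \<ge> n\<close> those
  of degree \<open>(m, n)\<close> have the basis \<open>x\<^bsup>m-n\<^esup> z\<^sup>j w\<^bsup>n-j\<^esup>\<close>, and in it all four conditions become inequalities
  on \<open>j\<close>: \<open>m - n + j \<le> \<lambda>\<^sub>1\<close>, \<open>n - j \<le> \<lambda>\<^sub>2\<close>, \<open>m - j \<le> \<mu>\<^sub>1\<close>, \<open>j \<le> \<mu>\<^sub>2\<close>. The multiplicity is the number of such
  \<open>j\<close> with \<open>0 \<le> j \<le> n\<close>, that is \<open>n + 1\<close> minus the maximum of \<open>0\<close> and of expressions that, for fixed
  \<open>\<lambda> + \<mu>\<close> and \<open>\<nu>\<close>, depend only on the minima \<open>min (\<lambda>(h\<^sub>\<alpha>)) (\<mu>(h\<^sub>\<alpha>))\<close> and decrease in them. Every such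
  \<open>L\<close> does come from a highest weight vector, and every highest weight vector from a homomorphism,
  because the Casimir element forces highest weight modules of finite dimension to be simple.\<close>

section \<open>Spaces of complex functions\<close>

text \<open>The count is reached from two sides. From above: words with j letters \<alpha>2, then m
  letters \<alpha>1, then n - j letters \<alpha>2 span degree (m, n), and each of the four
  inequalities that fails for j makes L vanish on the j-th word, because one end of the word already
  kills a highest weight covector. From below: the j-th monomial evaluates these words triangularly,
  with the j-th word as pivot. The obstacle is well-definedness: a functional on words must respect
  all relations that words satisfy on the covector of either factor. No list of relations is
  compared. Instead the dual of V(\<lambda>) is mapped onto a concrete module of functionals on
  monomials, which transports all relations at once. For the second factor z and w are exchanged,
  since moving a word across a tensor product reverses it. U(n+) is present only as lists of simple
  roots acting on modules. Modules occupy whole function types, and finite dimension enters as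
  finiteness of the spectrum of the \<open>h a\<close>.\<close>

definition fs :: "complex \<Rightarrow> ('i \<Rightarrow> complex) \<Rightarrow> 'i \<Rightarrow> complex" where
  "fs c x = (\<lambda>i. c * x i)"

lemma fs_apply: "fs c x i = c * x i"
  by (simp add: fs_def)

lemma uminus_fun_apply': "(- f) x = - f x" for f :: "'i \<Rightarrow> complex"
  by (simp add: fun_Compl_def)

lemma minus_fun_apply': "(f - g) x = f x - g x" for f :: "'i \<Rightarrow> complex"
  by (simp add: fun_diff_def)

lemma sum_fun_apply: "(\<Sum>a\<in>A. f a) x = (\<Sum>a\<in>A. f a x)" for f :: "'a \<Rightarrow> 'i \<Rightarrow> complex"
  by (induction A rule: infinite_finite_induct) auto

declare plus_fun_apply [simp del] zero_fun_apply [simp del] times_fun_apply [simp del] one_fun_apply [simp del]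

lemmas pointwise = fun_eq_iff fs_apply plus_fun_apply zero_fun_apply uminus_fun_apply' minus_fun_apply' sum_fun_apply

global_interpretation fs: vector_space "fs :: complex \<Rightarrow> ('i \<Rightarrow> complex) \<Rightarrow> 'i \<Rightarrow> complex"
  by standard (auto simp: pointwise algebra_simps)

global_interpretation fp: vector_space_pair "fs :: complex \<Rightarrow> ('i \<Rightarrow> complex) \<Rightarrow> 'i \<Rightarrow> complex"
   "fs :: complex \<Rightarrow> ('j \<Rightarrow> complex) \<Rightarrow> 'j \<Rightarrow> complex"
  by standard

abbreviation flin :: "(('i \<Rightarrow> complex) \<Rightarrow> ('j \<Rightarrow> complex)) \<Rightarrow> bool" where
  "flin \<equiv> Vector_Spaces.linear fs fs"

lemma flinI:
  assumes "\<And>x y. f (x + y) = f x + f y" "\<And>c x. f (fs c x) = fs c (f x)"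
  shows "flin f"
  using assms by (simp add: Vector_Spaces.linear_iff fs.vector_space_axioms)

text \<open>The direct sum of two function spaces is again a function space, over the sum type, so
  all module lemmas apply to it unchanged.\<close>

definition djoin :: "('i \<Rightarrow> complex) \<Rightarrow> ('j \<Rightarrow> complex) \<Rightarrow> ('i + 'j) \<Rightarrow> complex" where
  "djoin = case_sum"

lemma djoin_apply [simp]: "djoin x z (Inl i) = x i" "djoin x z (Inr j) = z j"
  by (simp_all add: djoin_def)

lemma djoin_comp [simp]: "djoin x x' \<circ> Inl = x" "djoin x x' \<circ> Inr = x'"
  by (auto simp: fun_eq_iff djoin_def)

lemma djoin_add: "djoin x x' + djoin z z' = djoin (x + z) (x' + z')"
  and djoin_diff: "djoin x x' - djoin z z' = djoin (x - z) (x' - z')"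
  and djoin_fs: "fs c (djoin x x') = djoin (fs c x) (fs c x')"
  for x z :: "'i \<Rightarrow> complex" and x' z' :: "'j \<Rightarrow> complex"
  by (auto simp: pointwise djoin_def split: sum.split)

lemma djoin_zero: "djoin (0 :: 'i \<Rightarrow> complex) (0 :: 'j \<Rightarrow> complex) = 0"
  by (auto simp: pointwise djoin_def split: sum.split)

lemma flin_precomp: "flin (\<lambda>z. z \<circ> g)"
  by (rule flinI) (auto simp: pointwise)

lemma span_image_subset:
  assumes "flin f" "x \<in> fs.span S" "\<And>s. s \<in> S \<Longrightarrow> f s \<in> fs.span T"
  shows "f x \<in> fs.span T"
  using assms(2)
proof (induction rule: fs.span_induct_alt)
  case base
  then show ?case by (simp add: fp.linear_0[OF assms(1)] fs.span_zero)
next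
  case (step c a y)
  then show ?case
    using assms(3)
    by (simp add: fp.linear_add[OF assms(1)] fp.linear_scale[OF assms(1)] fs.span_add fs.span_scale)
qed

lemma span_transfer:
  assumes "flin f" "flin g" "x \<in> fs.span S" "\<And>s. s \<in> S \<Longrightarrow> f s = g s"
  shows "f x = g x"
  using fp.linear_eq_on_span[OF assms(1,2)] assms(3,4) by metis

text \<open>The span of the pairs is a linear relation; the hypothesis says that it relates 0 only
  to 0, so it is the graph of a map. Outside the span of the \<open>y w\<close> the extension is
  arbitrary.\<close>

lemma linear_map_on_family_exists:
  fixes y :: "'w \<Rightarrow> 'i \<Rightarrow> complex" and u :: "'w \<Rightarrow> 'j \<Rightarrow> complex"
  assumes "\<And>z. z \<in> fs.span (range (\<lambda>w. djoin (y w) (u w))) \<Longrightarrow> z \<circ> Inl = 0 \<Longrightarrow> z \<circ> Inr = 0"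
  shows "\<exists>T. flin T \<and> (\<forall>w. T (y w) = u w)"
proof -
  obtain B where B: "B \<subseteq> range y" "fs.independent B" "range y \<subseteq> fs.span B"
    by (rule fs.maximal_independent_subset)
  define om where "om b = (SOME w. y w = b)" for b
  have om: "y (om b) = b" if "b \<in> B" for b
    using B(1) that unfolding om_def by (metis (mono_tags, lifting) imageE someI_ex subsetD)
  obtain T where T: "flin T" "\<And>b. b \<in> B \<Longrightarrow> T b = u (om b)"
    using fp.linear_independent_extend[OF B(2), of "\<lambda>b. u (om b)"] by blast
  let ?Z = "range (\<lambda>w. djoin (y w) (u w))"
  \<comment> \<open>\<open>T\<close> is fixed on a basis only. Both its graph and the given pairs
    lie in \<open>?Z\<close>, so hypothesis and subtraction force agreement on every
    \<open>y w\<close>.\<close>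
  have graph: "djoin x (T x) \<in> fs.span ?Z" if "x \<in> fs.span B" for x
    using that
  proof (induction rule: fs.span_induct_alt)
    case base
    have "djoin (0 :: 'i \<Rightarrow> complex) (T 0) = 0"
      by (simp only: fp.linear_0[OF T(1)] djoin_zero)
    then show ?case using fs.span_zero by (simp only:)
  next
    case (step c b x)
    have "djoin (fs c b + x) (T (fs c b + x)) = fs c (djoin b (T b)) + djoin x (T x)"
      by (simp add: fp.linear_add[OF T(1)] fp.linear_scale[OF T(1)] djoin_add djoin_fs)
    moreover have "djoin b (T b) \<in> ?Z"
      by (rule range_eqI[of _ _ "om b"]) (simp add: step(1) T(2) om)
    ultimately show ?case using step by (simp add: fs.span_add fs.span_scale fs.span_base)
  qed
  have "T (y w) = u w" for w
  proof -
    have "y w \<in> fs.span B" using B(3) by blast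
    from graph[OF this] have "djoin (y w) (T (y w)) - djoin (y w) (u w) \<in> fs.span ?Z" (is "?z \<in> _")
      by (simp add: fs.span_diff fs.span_base)
    from assms[OF this] have "?z \<circ> Inr = 0" by (auto simp: djoin_diff fun_eq_iff zero_fun_apply)
    then show ?thesis by (auto simp: pointwise)
  qed
  then show ?thesis using T(1) by blast
qed

text \<open>Scalars appear as functions on \<open>unit\<close>, because \<open>flin\<close> relates
  function spaces only.\<close>

lemma separating_functional:
  assumes "x \<notin> fs.span N"
  shows "\<exists>g :: ('i \<Rightarrow> complex) \<Rightarrow> unit \<Rightarrow> complex. flin g \<and> (\<forall>y\<in>fs.span N. g y = 0) \<and> g x = 1"
proof -
  obtain B where B: "B \<subseteq> N" "fs.independent B" "N \<subseteq> fs.span B"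
    by (rule fs.maximal_independent_subset)
  have sp: "fs.span B = fs.span N"
    using B by (meson fs.span_eq fs.span_superset subset_trans)
  have ind: "fs.independent (insert x B)"
    using B(2) assms sp by (simp add: fs.independent_insertI)
  obtain g :: "('i \<Rightarrow> complex) \<Rightarrow> unit \<Rightarrow> complex" where
    g: "flin g" "\<And>b. b \<in> insert x B \<Longrightarrow> g b = (if b = x then 1 else 0)"
    using fp.linear_independent_extend[OF ind, of "\<lambda>b. if b = x then 1 else 0"] by blast
  have "x \<notin> B" using assms sp fs.span_base by blast
  then have "g y = 0" if "y \<in> fs.span N" for y
    using fp.linear_eq_0_on_span[OF g(1), of B y] g(2) that sp by force
  then show ?thesis using g by (intro exI[of _ g]) auto
qed

text \<open>Applying \<open>g - c j\<close> removes the component \<open>j\<close> and rescales the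
  others by the nonzero numbers \<open>c i - c j\<close>, which allows induction on
  \<open>I\<close>.\<close>

lemma eigen_components_mem:
  assumes g: "flin g" and K: "fs.subspace K" and stable: "\<And>x. x \<in> K \<Longrightarrow> g x \<in> K"
    and "finite I" and "inj_on c I" and "\<And>i. i \<in> I \<Longrightarrow> g (k i) = fs (c i) (k i)"
    and "(\<Sum>i\<in>I. k i) \<in> K"
  shows "\<forall>i\<in>I. k i \<in> K"
  using assms(4-7)
proof (induction I arbitrary: k rule: finite_induct)
  case empty
  then show ?case by simp
next
  case (insert j I)
  let ?s = "\<Sum>i\<in>insert j I. k i"
  have "g ?s - fs (c j) ?s \<in> K"
    using insert.prems(3) stable K by (intro fs.subspace_diff fs.subspace_scale)
  also have "g ?s - fs (c j) ?s = (\<Sum>i\<in>insert j I. fs (c i) (k i) - fs (c j) (k i))"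
    using insert.prems by (simp only: fp.linear_sum[OF g] fs.scale_sum_right sum_subtractf) simp
  also have "\<dots> = (\<Sum>i\<in>I. fs (c i - c j) (k i))"
    using insert.hyps by (simp add: fs.scale_left_diff_distrib)
  finally have sK: "(\<Sum>i\<in>I. fs (c i - c j) (k i)) \<in> K" .
  have "\<forall>i\<in>I. fs (c i - c j) (k i) \<in> K"
    by (rule insert.IH[OF _ _ sK])
      (use insert.prems in \<open>auto simp: inj_on_def fp.linear_scale[OF g] mult.commute\<close>)
  moreover have "c i - c j \<noteq> 0" if "i \<in> I" for i
    using insert.prems(1) insert.hyps that by (auto simp: inj_on_def)
  ultimately have kI: "k i \<in> K" if "i \<in> I" for i
    using fs.subspace_scale[OF K, of "fs (c i - c j) (k i)" "inverse (c i - c j)"] that by simp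
  then have "(\<Sum>i\<in>I. k i) \<in> K" using K by (simp add: fs.subspace_sum)
  then have "?s - (\<Sum>i\<in>I. k i) \<in> K" using insert.prems K by (simp add: fs.subspace_diff)
  then have "k j \<in> K" using insert.hyps by simp
  then show ?case using kI by blast
qed

lemma finite_eigenvalues:
  fixes g :: "('i \<Rightarrow> complex) \<Rightarrow> 'i \<Rightarrow> complex"
  assumes g: "flin g" and "finite T"
  shows "finite {c. \<exists>x\<in>fs.span T. x \<noteq> 0 \<and> g x = fs c x}" (is "finite ?E")
proof (rule ccontr)
  assume "infinite ?E"
  then obtain E where E: "E \<subseteq> ?E" "finite E" "card E = Suc (card T)"
    using infinite_arbitrarily_large by blast
  then have "\<forall>c\<in>E. \<exists>x\<in>fs.span T. x \<noteq> 0 \<and> g x = fs c x" by blast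
  then obtain x where x: "\<And>c. c \<in> E \<Longrightarrow> x c \<in> fs.span T \<and> x c \<noteq> 0 \<and> g (x c) = fs c (x c)"
    by metis
  have inj: "inj_on x E"
  proof (rule inj_onI)
    fix c d assume cd: "c \<in> E" "d \<in> E" "x c = x d"
    then have "fs c (x c) = fs d (x c)" using x by metis
    then show "c = d" using x cd by simp
  qed
  have "fs.independent (x ` E)"
  proof (rule fs.independent_if_scalars_zero)
    show "finite (x ` E)" using E by simp
    fix f y assume s: "(\<Sum>v\<in>x ` E. fs (f v) v) = 0" and y: "y \<in> x ` E"
    then have "(\<Sum>c\<in>E. fs (f (x c)) (x c)) = 0" using inj by (simp add: sum.reindex)
    \<comment> \<open>Independence of eigenvectors is the case \<open>K = {0}\<close> of
      \<open>eigen_components_mem\<close>.\<close>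
    then have "\<forall>c\<in>E. fs (f (x c)) (x c) \<in> {0}"
      using E(2) x
      by (intro eigen_components_mem[OF g, where c = "\<lambda>c. c"])
        (auto simp: fp.linear_0[OF g] fp.linear_scale[OF g] mult.commute)
    then show "f y = 0" using y x by auto
  qed
  moreover have "x ` E \<subseteq> fs.span T" using x by blast
  ultimately have "card (x ` E) \<le> card T" using fs.independent_span_bound[OF assms(2)] by blast
  then show False using E inj by (simp add: card_image)
qed

section \<open>Highest weight modules\<close>

text \<open>The simple roots are indexed by \<^typ>\<open>bool\<close>, so that \<open>\<not> a\<close> is the other simple root.\<close>

definition cart :: "bool \<Rightarrow> bool \<Rightarrow> complex" where
  "cart a b = (if a = b then 2 else - 1)"

text \<open>The Chevalley-Serre presentation. The relations hold on the whole function type, so they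
  rewrite without side conditions.\<close>

locale sl3_module =
  fixes e f h :: "bool \<Rightarrow> ('i \<Rightarrow> complex) \<Rightarrow> 'i \<Rightarrow> complex"
  assumes lin: "flin (e a)" "flin (f a)" "flin (h a)"
    and ef: "e a (f b x) = f b (e a x) + (if a = b then h a x else 0)"
    and he: "h a (e b x) = e b (h a x) + fs (cart a b) (e b x)"
    and hf: "h a (f b x) = f b (h a x) - fs (cart a b) (f b x)"
    and hh: "h a (h b x) = h b (h a x)"
    and serre_e: "e a (e a (e (\<not> a) x)) = fs 2 (e a (e (\<not> a) (e a x))) - e (\<not> a) (e a (e a x))"
    and serre_f: "f a (f a (f (\<not> a) x)) = fs 2 (f a (f (\<not> a) (f a x))) - f (\<not> a) (f a (f a x))"
begin

lemmas lins =
  lin[THEN fp.linear_add] lin[THEN fp.linear_scale] lin[THEN fp.linear_diff]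
  lin[THEN fp.linear_0] lin[THEN fp.linear_neg] lin[THEN fp.linear_sum]

text \<open>Three times the Casimir element, in normal order.\<close>

definition casimir :: "('i \<Rightarrow> complex) \<Rightarrow> 'i \<Rightarrow> complex" where
  "casimir x = fs 6 (f True (e True x) + f False (e False x))
     + fs 6 (f False (f True (e True (e False x) - e False (e True x)))
           - f True (f False (e True (e False x) - e False (e True x))))
     + fs 2 (h True (h True x) + h True (h False x) + h False (h False x))
     + fs 6 (h True x + h False x)"

lemma lin_casimir: "flin casimir"
  by (rule flinI) (simp_all add: casimir_def lins pointwise algebra_simps)

text \<open>The terms that survive the commutation relations contain the commutator of
  \<open>f a\<close> with the lowering operator of the highest root, and \<open>serre_f\<close> is
  the vanishing of that commutator.\<close>

lemma casimir_f: "casimir (f a x) = f a (casimir x)"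
proof (cases a)
  case True
  show ?thesis
    using serre_f[of True] serre_f[of False]
    by (simp only: True casimir_def lins ef hf he hh[of False True] cart_def if_True if_False
        simp_thms eq_True eq_False HOL.True_implies_equals add_0_right)
      (simp only: pointwise, simp add: algebra_simps)
next
  case False
  show ?thesis
    using serre_f[of True] serre_f[of False]
    by (simp only: False casimir_def lins ef hf he hh[of False True] cart_def if_True if_False
        simp_thms eq_True eq_False HOL.True_implies_equals add_0_right)
      (simp only: pointwise, simp add: algebra_simps)
qed

end

section \<open>Words in the lowering operators and the weight grading\<close>

definition act :: "(bool \<Rightarrow> ('i \<Rightarrow> complex) \<Rightarrow> 'i \<Rightarrow> complex) \<Rightarrow> bool list \<Rightarrow> ('i \<Rightarrow> complex) \<Rightarrow> 'i \<Rightarrow> complex" where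
  "act f w x = foldr f w x"

lemma act_simps [simp]: "act f [] x = x" "act f (a # w) x = f a (act f w x)"
  "act f (v @ w) x = act f v (act f w x)"
  by (simp_all add: act_def)

definition word_span :: "(bool \<Rightarrow> ('i \<Rightarrow> complex) \<Rightarrow> 'i \<Rightarrow> complex) \<Rightarrow> ('i \<Rightarrow> complex) \<Rightarrow> ('i \<Rightarrow> complex) set" where
  "word_span f y = fs.span (range (\<lambda>w. act f w y))"

text \<open>The weight space at depth \<open>d\<close>, where \<open>d b\<close> counts how often
  the simple root \<open>b\<close> has been subtracted from the highest weight.\<close>

definition word_span_deg :: "(bool \<Rightarrow> ('i \<Rightarrow> complex) \<Rightarrow> 'i \<Rightarrow> complex) \<Rightarrow> ('i \<Rightarrow> complex) \<Rightarrow> (bool \<Rightarrow> nat) \<Rightarrow> ('i \<Rightarrow> complex) set" where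
  "word_span_deg f y d = fs.span ((\<lambda>w. act f w y) ` {w. count_list w = d})"

lemma count_list_Cons_fun: "count_list (b # w) = (count_list w)(b := Suc (count_list w b))"
  by (auto simp: fun_eq_iff)

text \<open>The value on the coroot \<open>a\<close> of \<open>nu\<close> minus the combination of
  simple roots with coefficients \<open>d\<close>.\<close>

definition weight_sub :: "(bool \<Rightarrow> nat) \<Rightarrow> (bool \<Rightarrow> nat) \<Rightarrow> bool \<Rightarrow> complex" where
  "weight_sub nu d a = of_nat (nu a) - cart a True * of_nat (d True) - cart a False * of_nat (d False)"

lemma mem_span_sum:
  assumes "x \<in> fs.span (g ` W)"
  obtains I c where "finite I" "I \<subseteq> W" "x = (\<Sum>w\<in>I. fs (c w) (g w))"
proof -
  obtain t r where t: "finite t" "t \<subseteq> g ` W" "x = (\<Sum>v\<in>t. fs (r v) v)"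
    using assms unfolding fs.span_explicit by blast
  define om where "om v = (SOME w. w \<in> W \<and> g w = v)" for v
  have om: "om v \<in> W \<and> g (om v) = v" if "v \<in> t" for v
  proof -
    from t(2) that obtain w where "w \<in> W \<and> g w = v" by blast
    then show ?thesis unfolding om_def by (rule someI)
  qed
  have "inj_on om t" by (metis inj_onI om)
  then have "x = (\<Sum>w\<in>om ` t. fs (r (g w)) (g w))"
    using om by (simp add: sum.reindex t(3))
  then show ?thesis using t(1) om by (intro that[of "om ` t" "\<lambda>w. r (g w)"]) auto
qed

text \<open>\<open>y\<close> may be zero, so that the image of a highest weight vector under any
  homomorphism is covered.\<close>

locale sl3_hw = sl3_module e f h for e f h :: "bool \<Rightarrow> ('i \<Rightarrow> complex) \<Rightarrow> 'i \<Rightarrow> complex" +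
  fixes y :: "'i \<Rightarrow> complex" and nu :: "bool \<Rightarrow> nat"
  assumes e_y: "e a y = 0" and h_y: "h a y = fs (of_nat (nu a)) y"
begin

lemma h_act: "h a (act f w y) = fs (weight_sub nu (count_list w) a) (act f w y)"
proof (induction w)
  case Nil
  then show ?case by (simp add: h_y weight_sub_def)
next
  case (Cons b w)
  have "h a (act f (b # w) y) = fs (weight_sub nu (count_list w) a - cart a b) (act f (b # w) y)"
    by (simp add: hf Cons lins) (simp add: pointwise algebra_simps)
  also have "weight_sub nu (count_list w) a - cart a b = weight_sub nu (count_list (b # w)) a"
    by (cases b) (simp_all add: weight_sub_def algebra_simps)
  finally show ?case .
qed

lemma f_deg: "x \<in> word_span_deg f y d \<Longrightarrow> f b x \<in> word_span_deg f y (d(b := Suc (d b)))"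
  unfolding word_span_deg_def
proof (erule span_image_subset[OF lin(2)], clarify)
  fix w assume "d = count_list w"
  then show "f b (act f w y) \<in> fs.span ((\<lambda>w. act f w y) ` {v. count_list v = (count_list w)(b := Suc (count_list w b))})"
    by (intro fs.span_base image_eqI[of _ _ "b # w"]) (auto simp: count_list_Cons_fun)
qed

lemma h_deg: "x \<in> word_span_deg f y d \<Longrightarrow> h a x = fs (weight_sub nu d a) x"
  unfolding word_span_deg_def
  by (rule span_transfer[OF lin(3)]) (auto intro!: flinI simp: h_act fs.scale_right_distrib mult.commute)

text \<open>Moving \<open>e a\<close> to the right past an equal letter produces an
  \<open>h a\<close>, which is a scalar on words. The case distinction keeps the truncated
  subtraction from claiming a degree when no letter \<open>a\<close> is present.\<close>

lemma e_act: "e a (act f w y) \<in> (if count_list w a = 0 then {0} 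
    else word_span_deg f y ((count_list w)(a := count_list w a - 1)))"
proof (induction w)
  case Nil
  then show ?case by (simp add: e_y)
next
  case (Cons b w)
  let ?z = "act f w y"
  have z: "?z \<in> word_span_deg f y (count_list w)"
    by (auto simp: word_span_deg_def intro: fs.span_base)
  show ?case
  proof (cases "a = b")
    case True
    have "h a ?z \<in> word_span_deg f y (count_list w)"
      using z by (simp add: h_act word_span_deg_def fs.span_scale)
    moreover have "f a (e a ?z) \<in> word_span_deg f y (count_list w)"
    proof (cases "count_list w a = 0")
      case True
      then show ?thesis using Cons by (simp add: lins word_span_deg_def fs.span_zero)
    next
      case False
      then have "e a ?z \<in> word_span_deg f y ((count_list w)(a := count_list w a - 1))"
        using Cons by simp
      from f_deg[OF this, of a] False show ?thesis by simp
    qed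
    ultimately have "e a (f a ?z) \<in> word_span_deg f y (count_list w)"
      by (simp add: ef word_span_deg_def fs.span_add)
    then show ?thesis using True by (simp add: count_list_Cons_fun)
  next
    case False
    then have eq: "e a (f b ?z) = f b (e a ?z)" by (simp add: ef)
    show ?thesis
    proof (cases "count_list w a = 0")
      case True
      then show ?thesis using Cons False eq by (simp add: lins)
    next
      case c: False
      then have "e a ?z \<in> word_span_deg f y ((count_list w)(a := count_list w a - 1))"
        using Cons by simp
      from f_deg[OF this, of b] c False show ?thesis
        unfolding act_simps eq by (simp add: fun_upd_twist count_list_Cons_fun)
    qed
  qed
qed

lemma e_deg:
  assumes "x \<in> word_span_deg f y d"
  shows "e a x \<in> (if d a = 0 then {0} else word_span_deg f y (d(a := d a - 1)))"
proof (cases "d a = 0")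
  case True
  have "e a x = (\<lambda>x. 0) x"
    using assms unfolding word_span_deg_def
  proof (rule span_transfer[OF lin(1), rotated])
    show "e a s = 0" if "s \<in> (\<lambda>w. act f w y) ` {w. count_list w = d}" for s
    proof -
      from that obtain w where "s = act f w y" "d = count_list w" by auto
      then show ?thesis using e_act[of a w] True by simp
    qed
  qed (auto intro: flinI)
  then show ?thesis using True by simp
next
  case False
  have "e a x \<in> fs.span ((\<lambda>w. act f w y) ` {w. count_list w = d(a := d a - 1)})"
    using assms unfolding word_span_deg_def
  proof (rule span_image_subset[OF lin(1)])
    show "e a s \<in> fs.span ((\<lambda>w. act f w y) ` {w. count_list w = d(a := d a - 1)})"
      if "s \<in> (\<lambda>w. act f w y) ` {w. count_list w = d}" for s
    proof -
      from that obtain w where "s = act f w y" "d = count_list w" by auto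
      then show ?thesis using e_act[of a w] False by (simp add: word_span_deg_def)
    qed
  qed
  then show ?thesis using False by (simp add: word_span_deg_def)
qed

lemma deg_subset: "word_span_deg f y d \<subseteq> word_span f y"
  unfolding word_span_deg_def word_span_def by (rule fs.span_mono) auto

lemma e_word_span: "x \<in> word_span f y \<Longrightarrow> e a x \<in> word_span f y"
  unfolding word_span_def
proof (erule span_image_subset[OF lin(1)], clarify)
  fix w show "e a (act f w y) \<in> fs.span (range (\<lambda>w. act f w y))"
    using e_act[of a w] deg_subset fs.span_zero by (auto simp: word_span_def split: if_splits)
qed

lemma f_word_span: "x \<in> word_span f y \<Longrightarrow> f a x \<in> word_span f y"
  unfolding word_span_def
proof (erule span_image_subset[OF lin(2)], clarify)
  fix w show "f a (act f w y) \<in> fs.span (range (\<lambda>w. act f w y))"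
    by (rule fs.span_base) (rule range_eqI[of _ _ "a # w"], simp)
qed

lemma h_word_span: "x \<in> word_span f y \<Longrightarrow> h a x \<in> word_span f y"
  unfolding word_span_def
  by (erule span_image_subset[OF lin(3)]) (auto simp: h_act intro!: fs.span_scale[OF fs.span_base])

text \<open>The scalar is three times (\<nu>, \<nu> + 2\<rho>) in the normalisation where roots have
  square length 2, with \<rho> the half sum of positive roots.\<close>

lemma casimir_word_span:
  assumes "x \<in> word_span f y"
  shows "casimir x = fs (2 * (of_nat (nu True) ^ 2 + of_nat (nu True) * of_nat (nu False) + of_nat (nu False) ^ 2)
     + 6 * (of_nat (nu True) + of_nat (nu False))) x" (is "_ = fs ?c x")
  using assms unfolding word_span_def
proof (rule span_transfer[OF lin_casimir, rotated])
  have y: "casimir y = fs ?c y"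
    by (simp only: casimir_def e_y h_y lins) (simp add: pointwise algebra_simps power2_eq_square)
  have "casimir (act f w y) = fs ?c (act f w y)" for w
    by (induction w) (simp_all add: casimir_f y lins)
  then show "casimir s = fs ?c s" if "s \<in> range (\<lambda>w. act f w y)" for s using that by auto
  show "flin (fs ?c)" by (rule flinI) (auto simp: pointwise algebra_simps)
qed

lemma homogeneous_decomposition:
  assumes "x \<in> fs.span ((\<lambda>w. act f w y) ` W)"
  obtains D k where "finite D" "D \<subseteq> count_list ` W" "\<And>d. d \<in> D \<Longrightarrow> k d \<in> word_span_deg f y d" "x = (\<Sum>d\<in>D. k d)"
proof -
  obtain I c where I: "finite I" "I \<subseteq> W" "x = (\<Sum>w\<in>I. fs (c w) (act f w y))"
    using assms by (rule mem_span_sum)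
  show ?thesis
  proof (rule that[of "count_list ` I" "\<lambda>d. \<Sum>w\<in>{w\<in>I. count_list w = d}. fs (c w) (act f w y)"])
    show "x = (\<Sum>d\<in>count_list ` I. \<Sum>w\<in>{w\<in>I. count_list w = d}. fs (c w) (act f w y))"
      using I by (simp add: sum.group)
    show "(\<Sum>w\<in>{w\<in>I. count_list w = d}. fs (c w) (act f w y)) \<in> word_span_deg f y d" for d
      unfolding word_span_deg_def by (rule fs.span_sum, rule fs.span_scale, rule fs.span_base) auto
  qed (use I in auto)
qed

lemma homogeneous_components_mem:
  assumes K: "fs.subspace K" and hK: "\<And>a x. x \<in> K \<Longrightarrow> h a x \<in> K" and "finite D"
    and k: "\<And>d. d \<in> D \<Longrightarrow> k d \<in> word_span_deg f y d" and sK: "(\<Sum>d\<in>D. k d) \<in> K"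
    and "d \<in> D"
  shows "k d \<in> K"
proof -
  \<comment> \<open>On degree \<open>d\<close> the combinations 2h1 + h2 and h1 + 2h2 equal
    constants minus \<open>3 * d True\<close> and \<open>3 * d False\<close>. Storing them as real
    and imaginary part gives one operator that separates all degrees.\<close>
  define g where "g x = (fs 2 (h True x) + h False x) + fs \<i> (h True x + fs 2 (h False x))" for x
  define c where "c d = (2 * weight_sub nu d True + weight_sub nu d False) 
      + \<i> * (weight_sub nu d True + 2 * weight_sub nu d False)" for d
  have "flin g" by (rule flinI) (simp_all add: g_def lins, simp_all add: pointwise algebra_simps)
  moreover have "g x \<in> K" if "x \<in> K" for x
    unfolding g_def using that K hK by (intro fs.subspace_add fs.subspace_scale)
  moreover have "inj c"
  proof (rule injI)
    fix d d' assume "c d = c d'"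
    then have "d True = d' True \<and> d False = d' False"
      by (auto simp: c_def weight_sub_def cart_def complex_eq_iff)
    then have "d a = d' a" for a by (cases a) auto
    then show "d = d'" by auto
  qed
  moreover have "g (k d) = fs (c d) (k d)" if "d \<in> D" for d
    using h_deg[OF k[OF that]] by (simp add: g_def c_def, simp add: pointwise algebra_simps)
  ultimately have "\<forall>d\<in>D. k d \<in> K"
    using K sK \<open>finite D\<close> by (intro eigen_components_mem[of g K D c]) (auto intro: inj_on_subset)
  then show ?thesis using assms by blast
qed

end

section \<open>Strings of a simple root and dominance of highest weights\<close>

context sl3_module
begin

lemma f_pow_highest:
  assumes "e a w = 0" "h a w = fs k w"
  shows "h a ((f a ^^ n) w) = fs (k - 2 * of_nat n) ((f a ^^ n) w)"
    and "e a ((f a ^^ Suc n) w) = fs (of_nat (Suc n) * (k - of_nat n)) ((f a ^^ n) w)"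
proof -
  show h: "h a ((f a ^^ n) w) = fs (k - 2 * of_nat n) ((f a ^^ n) w)" for n
  proof (induction n)
    case 0
    then show ?case using assms by simp
  next
    case (Suc n)
    have "h a ((f a ^^ Suc n) w) = fs (k - 2 * of_nat n) (f a ((f a ^^ n) w)) - fs 2 (f a ((f a ^^ n) w))"
      by (simp add: hf Suc lins cart_def)
    then show ?case by (simp only: funpow.simps o_apply) (simp only: pointwise, simp add: algebra_simps)
  qed
  show "e a ((f a ^^ Suc n) w) = fs (of_nat (Suc n) * (k - of_nat n)) ((f a ^^ n) w)"
  proof (induction n)
    case 0
    then show ?case using assms by (simp add: ef lins)
  next
    case (Suc n)
    have "e a ((f a ^^ Suc (Suc n)) w) = f a (e a ((f a ^^ Suc n) w)) + h a ((f a ^^ Suc n) w)"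
      by (simp add: ef)
    also have "\<dots> = fs (of_nat (Suc n) * (k - of_nat n)) ((f a ^^ Suc n) w)
         + fs (k - 2 * of_nat (Suc n)) ((f a ^^ Suc n) w)"
      by (simp only: Suc h) (simp add: lins)
    also have "\<dots> = fs (of_nat (Suc n) * (k - of_nat n) + (k - 2 * of_nat (Suc n))) ((f a ^^ Suc n) w)"
      by (simp only: fs.scale_left_distrib)
    also have "of_nat (Suc n) * (k - of_nat n) + (k - 2 * of_nat (Suc n)) = of_nat (Suc (Suc n)) * (k - of_nat (Suc n))"
      by (simp add: algebra_simps)
    finally show ?case .
  qed
qed

text \<open>The powers \<open>(f a ^^ n) w\<close> would have infinitely many eigenvalues
  \<open>k - 2n\<close> if none vanished. At the last nonzero power \<open>m\<close> the vanishing
  coefficient \<open>(m + 1) (k - m)\<close> gives \<open>k = m\<close>.\<close>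

lemma highest_weight_nat:
  assumes "e a w = 0" "h a w = fs k w" "w \<noteq> 0"
    and "w \<in> K" and K: "\<And>x. x \<in> K \<Longrightarrow> f a x \<in> K"
    and fin: "finite {c. \<exists>x\<in>K. x \<noteq> 0 \<and> h a x = fs c x}"
  obtains n where "k = of_nat n" "(f a ^^ Suc n) w = 0"
proof -
  have mem: "(f a ^^ n) w \<in> K" for n by (induction n) (use assms in auto)
  have "\<exists>n. (f a ^^ n) w = 0"
  proof (rule ccontr)
    assume "\<nexists>n. (f a ^^ n) w = 0"
    then have "range (\<lambda>n::nat. k - 2 * of_nat n) \<subseteq> {c. \<exists>x\<in>K. x \<noteq> 0 \<and> h a x = fs c x}"
      using f_pow_highest(1)[OF assms(1,2)] mem by blast
    then have "finite (range (\<lambda>n::nat. k - 2 * of_nat n))" using fin finite_subset by blast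
    moreover have "inj (\<lambda>n::nat. k - 2 * of_nat n)" by (auto simp: inj_def)
    ultimately show False by (metis finite_imageD infinite_UNIV_nat)
  qed
  then obtain n where n: "(f a ^^ n) w = 0" "\<And>m. m < n \<Longrightarrow> (f a ^^ m) w \<noteq> 0"
    using exists_least_iff[of "\<lambda>n. (f a ^^ n) w = 0"] by blast
  then obtain m where m: "n = Suc m" using assms(3) by (cases n) auto
  have "fs (of_nat (Suc m) * (k - of_nat m)) ((f a ^^ m) w) = 0"
    using f_pow_highest(2)[OF assms(1,2), of m] n(1) m by (simp only: lins)
  then have "k = of_nat m" using n(2)[of m] m by (auto simp del: of_nat_Suc)
  then show ?thesis using that n(1) m by blast
qed

end

context sl3_hw
begin

text \<open>A weight vector of minimal depth in \<open>K\<close> is a highest weight vector of a dominant weight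
  strictly below \<open>nu\<close>, but the Casimir element separates such weights.\<close>

lemma submodule_without_top_eq_zero:
  assumes K: "fs.subspace K" "K \<subseteq> word_span f y"
    and eK: "\<And>a x. x \<in> K \<Longrightarrow> e a x \<in> K" and fK: "\<And>a x. x \<in> K \<Longrightarrow> f a x \<in> K"
    and hK: "\<And>a x. x \<in> K \<Longrightarrow> h a x \<in> K" 
    and y: "y \<notin> K"
    and fin: "\<And>a. finite {c. \<exists>x\<in>K. x \<noteq> 0 \<and> h a x = fs c x}"
    and x: "x \<in> K"
  shows "x = 0"
proof (rule ccontr)
  assume "x \<noteq> 0"
  obtain D k where D: "finite D" "\<And>d. d \<in> D \<Longrightarrow> k d \<in> word_span_deg f y d" "x = (\<Sum>d\<in>D. k d)"
    using homogeneous_decomposition[of x UNIV] K(2) x unfolding word_span_def by blast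
  then have kK: "k d \<in> K" if "d \<in> D" for d
    using homogeneous_components_mem[OF K(1) hK D(1,2), of d] that x by blast
  obtain d0 where d0: "d0 \<in> D" "k d0 \<noteq> 0" using D(3) \<open>x \<noteq> 0\<close> by (meson sum.neutral)
  define P where "P d \<longleftrightarrow> (\<exists>w. w \<in> K \<and> w \<in> word_span_deg f y d \<and> w \<noteq> 0)" for d
  have "P d0" using d0 D(2) kK unfolding P_def by blast
  from ex_has_least_nat[of P, OF this, of "\<lambda>d. d True + d False"]
  obtain d where d: "P d" "\<And>d'. P d' \<Longrightarrow> d True + d False \<le> d' True + d' False" by blast
  then obtain w where w: "w \<in> K" "w \<in> word_span_deg f y d" "w \<noteq> 0" unfolding P_def by blast
  have ew: "e a w = 0" for a
  proof (rule ccontr)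
    assume ne: "e a w \<noteq> 0"
    then have "d a \<noteq> 0" "e a w \<in> word_span_deg f y (d(a := d a - 1))"
      using e_deg[OF w(2), of a] by (auto split: if_splits)
    moreover from this ne have "P (d(a := d a - 1))" using eK[OF w(1)] unfolding P_def by blast
    from d(2)[OF this] \<open>d a \<noteq> 0\<close> show False by (cases a) auto
  qed
  have hw: "h a w = fs (weight_sub nu d a) w" for a by (rule h_deg[OF w(2)])
  have "\<exists>n. weight_sub nu d a = of_nat n" for a
    using highest_weight_nat[OF ew hw w(3) w(1) fK fin] by metis
  then obtain q where q: "\<And>a. weight_sub nu d a = of_nat (q a)" by metis
  define p where "p a = int (nu a)" for a
  have qT: "p True = int (q True) + 2 * int (d True) - int (d False)"
    and qF: "p False = int (q False) + 2 * int (d False) - int (d True)"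
    using q[of True] q[of False] unfolding weight_sub_def cart_def p_def
    by (simp_all add: algebra_simps) (metis (mono_tags, lifting) of_nat_add of_nat_eq_iff of_nat_mult of_nat_numeral)+
  have "casimir w = fs (2 * (of_nat (q True) ^ 2 + of_nat (q True) * of_nat (q False) + of_nat (q False) ^ 2)
     + 6 * (of_nat (q True) + of_nat (q False))) w"
    by (simp only: casimir_def ew hw q lins) (simp add: pointwise algebra_simps power2_eq_square)
  with casimir_word_span[of w] w K(2)
  have "2 * (of_nat (q True) ^ 2 + of_nat (q True) * of_nat (q False) + of_nat (q False) ^ 2)
     + 6 * (of_nat (q True) + of_nat (q False)) = 2 * (of_nat (nu True) ^ 2 + of_nat (nu True) * of_nat (nu False) + of_nat (nu False) ^ 2)
     + 6 * (of_nat (nu True) + (of_nat (nu False) :: complex))"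
    using fs.scale_cancel_right by (metis subsetD)
  then have "(of_int (2 * (int (q True) ^ 2 + int (q True) * int (q False) + int (q False) ^ 2)
     + 6 * (int (q True) + int (q False))) :: complex) = of_int (2 * (p True ^ 2 + p True * p False + p False ^ 2)
     + 6 * (p True + p False))"
    unfolding p_def by simp
  then have "2 * (int (q True) ^ 2 + int (q True) * int (q False) + int (q False) ^ 2)
     + 6 * (int (q True) + int (q False)) = 2 * (p True ^ 2 + p True * p False + p False ^ 2)
     + 6 * (p True + p False)" by (simp only: of_int_eq_iff)
  \<comment> \<open>With \<beta> the root combination of coefficients \<open>d\<close>, the two
    Casimir scalars differ by 3 times 2(\<beta>, q) + (\<beta>, \<beta>) + 2(\<beta>, \<rho>). The
    first two terms are nonnegative, so the third, the height of \<beta> up to a factor, is at most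
    0.\<close>
  then have sum0: "6 * (int (d True) * int (q True) + int (d False) * int (q False))
     + 6 * (int (d True) ^ 2 - int (d True) * int (d False) + int (d False) ^ 2) + 6 * (int (d True) + int (d False)) = 0"
    unfolding qT qF by (simp add: algebra_simps power2_eq_square)
  have "4 * (int (d True) ^ 2 - int (d True) * int (d False) + int (d False) ^ 2)
      = (2 * int (d True) - int (d False)) ^ 2 + 3 * int (d False) ^ 2"
    by (simp add: algebra_simps power2_eq_square)
  then have "int (d True) ^ 2 - int (d True) * int (d False) + int (d False) ^ 2 \<ge> 0"
    by (smt (verit) zero_le_power2)
  moreover have "int (d True) * int (q True) + int (d False) * int (q False) \<ge> 0" by simp
  moreover have "A \<ge> 0 \<Longrightarrow> B \<ge> 0 \<Longrightarrow> 6 * B + 6 * A + 6 * C = 0 \<Longrightarrow> C \<le> 0" for A B C :: int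
    by linarith
  ultimately have "int (d True) + int (d False) \<le> 0" using sum0 by blast
  then have "d True = 0" "d False = 0" by linarith+
  then have "{w. count_list w = d} \<subseteq> {[]}" 
  proof -
    have "w = []" if "count_list w = d" for w
      using that \<open>d True = 0\<close> \<open>d False = 0\<close> by (cases w; cases "hd w") auto
    then show ?thesis by blast
  qed
  \<comment> \<open>Only the empty word has degree zero, so \<open>w\<close> is a nonzero multiple
    of \<open>y\<close>, which \<open>K\<close> does not contain.\<close>
  then have "w \<in> fs.span {y}"
    using w(2) fs.span_mono[of "(\<lambda>w. act f w y) ` {w. count_list w = d}" "{y}"]
    unfolding word_span_deg_def by fastforce
  then obtain c where c: "w = fs c y" by (auto simp: fs.span_singleton)
  with w(3) have "c \<noteq> 0" by auto
  then have "y = fs (inverse c) w" by (simp add: c)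
  with fs.subspace_scale[OF K(1) w(1)] y show False by metis
qed

end

section \<open>Direct sums and homomorphisms out of highest weight modules\<close>

lemma comp_add: "(x + z) \<circ> g = (x \<circ> g) + (z \<circ> g)" and comp_fs: "fs c x \<circ> g = fs c (x \<circ> g)"
  for x z :: "'i \<Rightarrow> complex"
  by (auto simp: pointwise)

definition sum_op :: "(bool \<Rightarrow> ('i \<Rightarrow> complex) \<Rightarrow> 'i \<Rightarrow> complex) \<Rightarrow> (bool \<Rightarrow> ('j \<Rightarrow> complex) \<Rightarrow> 'j \<Rightarrow> complex)
    \<Rightarrow> bool \<Rightarrow> ('i + 'j \<Rightarrow> complex) \<Rightarrow> 'i + 'j \<Rightarrow> complex" where
  "sum_op e e' = (\<lambda>a z. djoin (e a (z \<circ> Inl)) (e' a (z \<circ> Inr)))"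

lemma sum_op_djoin: "sum_op e e' a (djoin x x') = djoin (e a x) (e' a x')"
  by (simp add: sum_op_def)

lemma act_sum_op: "act (sum_op f f') w (djoin x x') = djoin (act f w x) (act f' w x')"
  by (induction w) (simp_all add: sum_op_djoin)

lemma sl3_sum:
  assumes "sl3_module e f h" "sl3_module e' f' h'"
  shows "sl3_module (sum_op e e') (sum_op f f') (sum_op h h')"
proof -
  interpret A: sl3_module e f h by fact
  interpret B: sl3_module e' f' h' by fact
  show ?thesis
  proof (rule sl3_module.intro)
    show "flin (sum_op e e' a)" "flin (sum_op f f' a)" "flin (sum_op h h' a)" for a
      by (rule flinI; simp add: sum_op_def comp_add comp_fs A.lins B.lins djoin_add djoin_fs)+
    fix a b z
    show "sum_op e e' a (sum_op f f' b z) = sum_op f f' b (sum_op e e' a z) + (if a = b then sum_op h h' a z else 0)"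
      by (cases "a = b") (simp_all add: sum_op_def A.ef B.ef djoin_add)
    show "sum_op h h' a (sum_op e e' b z) = sum_op e e' b (sum_op h h' a z) + fs (cart a b) (sum_op e e' b z)"
      by (simp add: sum_op_def A.he B.he djoin_add djoin_fs)
    show "sum_op h h' a (sum_op f f' b z) = sum_op f f' b (sum_op h h' a z) - fs (cart a b) (sum_op f f' b z)"
      by (simp add: sum_op_def A.hf B.hf djoin_diff djoin_fs)
    show "sum_op h h' a (sum_op h h' b z) = sum_op h h' b (sum_op h h' a z)"
      using A.hh B.hh by (simp add: sum_op_def)
    show "sum_op e e' a (sum_op e e' a (sum_op e e' (\<not> a) z)) =
       fs 2 (sum_op e e' a (sum_op e e' (\<not> a) (sum_op e e' a z))) - sum_op e e' (\<not> a) (sum_op e e' a (sum_op e e' a z))"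
      by (simp add: sum_op_def A.serre_e B.serre_e djoin_diff djoin_fs)
    show "sum_op f f' a (sum_op f f' a (sum_op f f' (\<not> a) z)) =
       fs 2 (sum_op f f' a (sum_op f f' (\<not> a) (sum_op f f' a z))) - sum_op f f' (\<not> a) (sum_op f f' a (sum_op f f' a z))"
      by (simp add: sum_op_def A.serre_f B.serre_f djoin_diff djoin_fs)
  qed
qed

text \<open>An integrable highest weight module is a quotient of every module generated by a highest weight vector
  of the same weight.\<close>

theorem highest_weight_hom_exists:
  assumes S1: "sl3_hw e f h y nu" and "y \<noteq> 0" and S2: "sl3_hw e' f' h' u nu"
    and fin: "\<And>a. finite {c. \<exists>x\<in>word_span f' u. x \<noteq> 0 \<and> h' a x = fs c x}"
  shows "\<exists>T. flin T \<and> (\<forall>w. T (act f w y) = act f' w u)"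
proof (rule linear_map_on_family_exists)
  interpret A: sl3_hw e f h y nu by fact
  interpret B: sl3_hw e' f' h' u nu by fact
  let ?E = "sum_op e e'" and ?F = "sum_op f f'" and ?H = "sum_op h h'" and ?y = "djoin y u"
  interpret C: sl3_module ?E ?F ?H by (rule sl3_sum) unfold_locales
  interpret C: sl3_hw ?E ?F ?H ?y nu
    by unfold_locales (simp_all add: sum_op_djoin A.e_y A.h_y B.e_y B.h_y djoin_zero djoin_fs)
  fix z assume z: "z \<in> fs.span (range (\<lambda>w. djoin (act f w y) (act f' w u)))" "z \<circ> Inl = 0"
  have ws: "word_span ?F ?y = fs.span (range (\<lambda>w. djoin (act f w y) (act f' w u)))"
    by (simp add: word_span_def act_sum_op)
  \<comment> \<open>\<open>K\<close> is the obstruction to the submodule generated by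
    \<open>?y\<close> being a graph over the first summand; \<open>y \<noteq> 0\<close> keeps
    \<open>?y\<close> out of it.\<close>
  define K where "K = {z \<in> word_span ?F ?y. z \<circ> Inl = 0}"
  have comp0: "(0 :: 'a + 'c \<Rightarrow> complex) \<circ> Inl = 0" by (auto simp: pointwise)
  have "z = 0"
  proof (rule C.submodule_without_top_eq_zero[of K])
    show "z \<in> K" using z by (simp add: K_def ws)
    show "fs.subspace K"
      unfolding K_def word_span_def
      by (intro fs.subspaceI) (auto simp: comp0 comp_add comp_fs fs.span_zero fs.span_add fs.span_scale)
    show "K \<subseteq> word_span ?F ?y" by (auto simp: K_def)
    fix a x assume x: "x \<in> K"
    show "?E a x \<in> K" "?F a x \<in> K" "?H a x \<in> K"
      using x C.e_word_span[of x a] C.f_word_span[of x a] C.h_word_span[of x a]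
      by (auto simp: K_def sum_op_def A.lins)
  next
    show "?y \<notin> K" using \<open>y \<noteq> 0\<close> by (simp add: K_def)
    fix a
    \<comment> \<open>An element of \<open>K\<close> is determined by its second component, so
      finiteness of the spectrum is inherited from the second module alone.\<close>
    have "{c. \<exists>x\<in>K. x \<noteq> 0 \<and> ?H a x = fs c x} \<subseteq> {c. \<exists>x\<in>word_span f' u. x \<noteq> 0 \<and> h' a x = fs c x}"
    proof safe
      fix c x assume x: "x \<in> K" "x \<noteq> 0" "?H a x = fs c x"
      have "x \<circ> Inr \<in> word_span f' u"
        using x(1) unfolding K_def ws word_span_def mem_Collect_eq act_sum_op
        by (intro span_image_subset[OF flin_precomp, of x _ Inr]) (auto intro: fs.span_base)
      moreover have "x \<circ> Inr \<noteq> 0"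
      proof
        assume "x \<circ> Inr = 0"
        with x(1) have "x s = 0" for s unfolding K_def by (cases s) (auto simp: pointwise)
        with x(2) show False by (auto simp: pointwise)
      qed
      moreover have "h' a (x \<circ> Inr) = fs c (x \<circ> Inr)"
        using arg_cong[OF x(3), of "\<lambda>z. z \<circ> Inr"] by (simp add: sum_op_def comp_fs)
      ultimately show "\<exists>x\<in>word_span f' u. x \<noteq> 0 \<and> h' a x = fs c x" by blast
    qed
    then show "finite {c. \<exists>x\<in>K. x \<noteq> 0 \<and> ?H a x = fs c x}" using fin finite_subset by blast
  qed
  then show "z \<circ> Inr = 0" by (auto simp: pointwise)
qed

lemma (in sl3_hw) f_pow_zero:
  assumes "y \<noteq> 0" "finite {c. \<exists>x\<in>word_span f y. x \<noteq> 0 \<and> h a x = fs c x}" "nu a < n"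
  shows "(f a ^^ n) y = 0"
proof -
  have "y \<in> word_span f y" unfolding word_span_def by (rule fs.span_base) (rule range_eqI[of _ _ "[]"], simp)
  from highest_weight_nat[OF e_y h_y assms(1) this f_word_span assms(2)]
  obtain m where m: "of_nat (nu a) = (of_nat m :: complex)" "(f a ^^ Suc m) y = 0" by metis
  then have 0: "(f a ^^ Suc (nu a)) y = 0" by simp
  have "n = (n - Suc (nu a)) + Suc (nu a)" using assms(3) by simp
  then have "(f a ^^ n) y = (f a ^^ (n - Suc (nu a))) ((f a ^^ Suc (nu a)) y)"
    by (metis funpow_add o_apply)
  moreover have "(f a ^^ k) 0 = 0" for k by (induction k) (simp_all add: lins)
  ultimately show ?thesis using 0 by simp
qed

section \<open>Straightening of words in the lowering operators\<close>

context sl3_module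
begin

text \<open>A root vector for the negative of the highest root. Since the two lowering operators
  generate a Heisenberg algebra, it commutes with both.\<close>

definition f_comm :: "bool \<Rightarrow> ('i \<Rightarrow> complex) \<Rightarrow> 'i \<Rightarrow> complex" where
  "f_comm a x = f a (f (\<not> a) x) - f (\<not> a) (f a x)"

lemma f_pow_lins:
  "(f a ^^ n) (x + z) = (f a ^^ n) x + (f a ^^ n) z" "(f a ^^ n) (x - z) = (f a ^^ n) x - (f a ^^ n) z" 
  "(f a ^^ n) (fs c x) = fs c ((f a ^^ n) x)" "(f a ^^ n) 0 = 0"
  by (induction n) (simp_all add: lins)

lemma f_f_comm: "f b (f_comm a x) = f_comm a (f b x)"
proof (cases "b = a")
  case True
  then show ?thesis using serre_f[of a x]
    by (simp only: f_comm_def lins) (simp only: pointwise, simp add: algebra_simps)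
next
  case False
  then have b: "b = (\<not> a)" by simp
  show ?thesis using serre_f[of "\<not> a" x] unfolding b
    by (simp only: f_comm_def lins not_not) (simp only: pointwise, simp add: algebra_simps)
qed

lemma lin_f_comm: "flin (f_comm a)"
  by (rule flinI) (simp_all add: f_comm_def lins, simp_all add: pointwise algebra_simps)

lemma f_pow_f_comm_pow: "(f b ^^ n) ((f_comm a ^^ k) x) = (f_comm a ^^ k) ((f b ^^ n) x)"
proof -
  have "f b ((f_comm a ^^ k) x) = (f_comm a ^^ k) (f b x)" for x
    by (induction k) (simp_all add: f_f_comm)
  then show ?thesis by (induction n) simp_all
qed

text \<open>Each of the \<open>n\<close> exchanges yields the same central commutator. At
  \<open>n = 0\<close> the truncated exponent \<open>n - 1\<close> is neutralised by the
  coefficient.\<close>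

lemma f_f_pow: "f (\<not> a) ((f a ^^ n) x) = (f a ^^ n) (f (\<not> a) x) - fs (of_nat n) ((f a ^^ (n - 1)) (f_comm a x))"
proof (induction n arbitrary: x)
  case 0
  then show ?case by simp
next
  case (Suc n)
  have "f (\<not> a) ((f a ^^ Suc n) x) = f (\<not> a) ((f a ^^ n) (f a x))"
    by (simp only: funpow_swap1 funpow.simps o_apply)
  also have "\<dots> = (f a ^^ n) (f (\<not> a) (f a x)) - fs (of_nat n) ((f a ^^ (n - 1)) (f_comm a (f a x)))"
    by (rule Suc)
  also have "f (\<not> a) (f a x) = f a (f (\<not> a) x) - f_comm a x"
    by (simp add: f_comm_def)
  also have "(f a ^^ n) (f a (f (\<not> a) x) - f_comm a x) = (f a ^^ Suc n) (f (\<not> a) x) - (f a ^^ n) (f_comm a x)"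
    by (simp only: f_pow_lins funpow_swap1 funpow.simps o_apply)
  also have "fs (of_nat n) ((f a ^^ (n - 1)) (f_comm a (f a x))) = fs (of_nat n) ((f a ^^ n) (f_comm a x))"
    by (cases n) (simp_all add: f_f_comm[symmetric] funpow_swap1)
  finally show ?case by (simp only: diff_Suc_1) (simp only: pointwise, simp add: algebra_simps)
qed

text \<open>By \<open>f_f_pow\<close>, passing one \<open>f (\<not> a)\<close> consumes at most one
  power of \<open>f a\<close>. On covectors this yields the vanishing conditions that involve a
  two-letter block.\<close>

lemma f_pow_pow_zero:
  assumes "(f a ^^ s) x = 0"
  shows "(f a ^^ (s + l)) ((f (\<not> a) ^^ l) x) = 0"
proof (induction l)
  case 0
  then show ?case using assms by simp
next
  case (Suc l)
  let ?z = "(f (\<not> a) ^^ l) x" and ?n = "s + l"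
  have "(f a ^^ ?n) (f_comm a ?z) = f_comm a ((f a ^^ ?n) ?z)"
    using f_pow_f_comm_pow[of ?n a 1 a ?z] by simp
  also have "\<dots> = 0" using Suc by (simp add: fp.linear_0[OF lin_f_comm])
  finally have "(f a ^^ Suc ?n) (f (\<not> a) ?z) = f (\<not> a) ((f a ^^ Suc ?n) ?z)"
    using f_f_pow[of a "Suc ?n" ?z] by simp
  then show ?case using Suc by (simp add: lins)
qed

text \<open>The spanning half of the PBW theorem: each exchange trades one \<open>a\<close> and one
  \<open>\<not> a\<close> for a central commutator, and \<open>i\<close> counts the trades.\<close>

lemma word_mem_pbw_span:
  "act f w x \<in> fs.span ((\<lambda>i. (f a ^^ (count_list w a - i)) ((f (\<not> a) ^^ (count_list w (\<not> a) - i)) ((f_comm a ^^ i) x)))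
     ` {i. i \<le> count_list w a \<and> i \<le> count_list w (\<not> a)})"
    (is "_ \<in> fs.span (?S w)")
proof (induction w)
  case Nil
  then show ?case by (auto intro: fs.span_base)
next
  case (Cons b w)
  have "f b (act f w x) \<in> fs.span (?S (b # w))"
  proof (rule span_image_subset[OF lin(2) Cons], clarify)
    fix i assume i: "i \<le> count_list w a" "i \<le> count_list w (\<not> a)"
    let ?r = "count_list w a - i" and ?s = "count_list w (\<not> a) - i"
    let ?v = "(f (\<not> a) ^^ ?s) ((f_comm a ^^ i) x)"
    show "f b ((f a ^^ ?r) ?v) \<in> fs.span (?S (b # w))"
    proof (cases "b = a")
      case True
      then have "f b ((f a ^^ ?r) ?v) = (f a ^^ (count_list (b # w) a - i)) ((f (\<not> a) ^^ (count_list (b # w) (\<not> a) - i)) ((f_comm a ^^ i) x))"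
        using i by (simp add: Suc_diff_le)
      then show ?thesis using i True by (auto intro!: fs.span_base)
    next
      case False
      then have b: "b = (\<not> a)" by simp
      have 1: "(f a ^^ ?r) (f (\<not> a) ?v) \<in> fs.span (?S (b # w))"
        using i b by (intro fs.span_base image_eqI[of _ _ i]) (auto simp: Suc_diff_le)
      have 2: "fs (of_nat ?r) ((f a ^^ (?r - 1)) (f_comm a ?v)) \<in> fs.span (?S (b # w))"
      proof (cases "?r = 0")
        case True
        then show ?thesis by (simp add: fs.span_zero)
      next
        case False
        have "f_comm a ?v = (f (\<not> a) ^^ ?s) ((f_comm a ^^ Suc i) x)"
          using f_pow_f_comm_pow[of ?s "\<not> a" 1 a "(f_comm a ^^ i) x"] by simp
        then have "(f a ^^ (?r - 1)) (f_comm a ?v) \<in> fs.span (?S (b # w))"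
          using i b False by (intro fs.span_base image_eqI[of _ _ "Suc i"]) auto
        then show ?thesis by (rule fs.span_scale)
      qed
      show ?thesis unfolding b f_f_pow using 1 2 b by (simp add: fs.span_diff)
    qed
  qed
  then show ?case by simp
qed

text \<open>The matrix expressing the words \<open>f\<^sub>b\<^sup>i f\<^sub>a\<^sup>m f\<^sub>b\<^bsup>n-i\<^esup>\<close> in the PBW basis is triangular with nonzero
  diagonal for \<open>n \<le> m\<close>, so these words span.\<close>

lemma f_pow_triangular:
  assumes "i \<le> m"
  shows "\<exists>c. c \<noteq> 0 \<and> (f (\<not> a) ^^ i) ((f a ^^ m) v) - fs c ((f a ^^ (m - i)) ((f_comm a ^^ i) v))
    \<in> fs.span ((\<lambda>k. (f a ^^ (m - k)) ((f (\<not> a) ^^ (i - k)) ((f_comm a ^^ k) v))) ` {..<i})"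
  using assms
proof (induction i)
  case 0
  then show ?case by (intro exI[of _ 1]) (simp add: fs.span_zero)
next
  case (Suc i)
  let ?g = "\<lambda>i k. (f a ^^ (m - k)) ((f (\<not> a) ^^ (i - k)) ((f_comm a ^^ k) v))"
  let ?S = "\<lambda>i. fs.span (?g i ` {..<i})"
  let ?x = "(f (\<not> a) ^^ i) ((f a ^^ m) v)" and ?t = "\<lambda>i. (f a ^^ (m - i)) ((f_comm a ^^ i) v)"
  obtain c where c: "c \<noteq> 0" "?x - fs c (?t i) \<in> ?S i"
    using Suc.IH[OF Suc_leD[OF Suc.prems]] by blast
  have step: "f (\<not> a) (?g i k) = ?g (Suc i) k - fs (of_nat (m - k)) (?g (Suc i) (Suc k))" if "k \<le> i" for k
  proof -
    have "f_comm a ((f (\<not> a) ^^ (i - k)) ((f_comm a ^^ k) v)) = (f (\<not> a) ^^ (i - k)) ((f_comm a ^^ Suc k) v)"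
      using f_pow_f_comm_pow[of "i - k" "\<not> a" 1 a "(f_comm a ^^ k) v"] by simp
    then show ?thesis using that f_f_pow[of a "m - k" "(f (\<not> a) ^^ (i - k)) ((f_comm a ^^ k) v)"]
      by (simp add: Suc_diff_le)
  qed
  have "f (\<not> a) (?x - fs c (?t i)) \<in> ?S (Suc i)"
    using c(2)
  proof (rule span_image_subset[OF lin(2)], clarify)
    fix k assume "k < i"
    then show "f (\<not> a) (?g i k) \<in> ?S (Suc i)"
      unfolding step[OF less_imp_le[OF \<open>k < i\<close>]]
      by (intro fs.span_diff[OF fs.span_base[OF image_eqI[of _ _ k]] fs.span_scale[OF fs.span_base[OF image_eqI[of _ _ "Suc k"]]]])
        auto
  qed
  moreover have "fs c (?g (Suc i) i) \<in> ?S (Suc i)"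
    by (intro fs.span_scale[OF fs.span_base[OF image_eqI[of _ _ i]]]) auto
  ultimately have mem: "f (\<not> a) (?x - fs c (?t i)) + fs c (?g (Suc i) i) \<in> ?S (Suc i)"
    by (rule fs.span_add)
  have eq: "f (\<not> a) (?x - fs c (?t i)) + fs c (?g (Suc i) i) = f (\<not> a) ?x - fs (- c * of_nat (m - i)) (?t (Suc i))"
    using step[of i] by (simp only: lins diff_self_eq_0 funpow_0 le_refl simp_thms)
      (simp only: pointwise, simp add: algebra_simps)
  show ?case
  proof (intro exI conjI)
    \<comment> \<open>Each further letter \<open>\<not> a\<close> multiplies the diagonal entry by
      \<open>-(m - i)\<close>, nonzero as long as \<open>i < m\<close>.\<close>
    show "- c * of_nat (m - i) \<noteq> 0" using c(1) Suc.prems by simp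
    show "(f (\<not> a) ^^ Suc i) ((f a ^^ m) v) - fs (- c * of_nat (m - i)) (?t (Suc i)) \<in> ?S (Suc i)"
      using mem unfolding eq by simp
  qed
qed

text \<open>Inverts the triangular matrix by strong induction: \<open>f_pow_triangular\<close> at
  \<open>(f (\<not> a) ^^ (n - i)) x\<close> expresses the PBW vector with \<open>i\<close>
  commutators by a listed word and PBW vectors with fewer commutators.\<close>

lemma word_mem_span:
  assumes "count_list w (\<not> a) = n" "count_list w a = m" "n \<le> m"
  shows "act f w x \<in> fs.span ((\<lambda>j. (f (\<not> a) ^^ j) ((f a ^^ m) ((f (\<not> a) ^^ (n - j)) x))) ` {..n})"
    (is "_ \<in> ?S")
proof -
  let ?g = "\<lambda>i. (f a ^^ (m - i)) ((f (\<not> a) ^^ (n - i)) ((f_comm a ^^ i) x))"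
  have g: "?g i \<in> ?S" if "i \<le> n" for i
    using that
  proof (induction i rule: less_induct)
    case (less i)
    let ?v = "(f (\<not> a) ^^ (n - i)) x"
    obtain c where c: "c \<noteq> 0" "(f (\<not> a) ^^ i) ((f a ^^ m) ?v) - fs c ((f a ^^ (m - i)) ((f_comm a ^^ i) ?v))
        \<in> fs.span ((\<lambda>k. (f a ^^ (m - k)) ((f (\<not> a) ^^ (i - k)) ((f_comm a ^^ k) ?v))) ` {..<i})"
      using f_pow_triangular[of i m a ?v] less.prems assms(3) by auto
    have "(\<lambda>k. (f a ^^ (m - k)) ((f (\<not> a) ^^ (i - k)) ((f_comm a ^^ k) ?v))) ` {..<i} \<subseteq> ?S"
    proof clarify
      fix k assume k: "k < i"
      have "(f (\<not> a) ^^ (i - k)) ((f_comm a ^^ k) ?v) = (f (\<not> a) ^^ (i - k)) ((f (\<not> a) ^^ (n - i)) ((f_comm a ^^ k) x))"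
        by (simp only: f_pow_f_comm_pow)
      also have "\<dots> = (f (\<not> a) ^^ (n - k)) ((f_comm a ^^ k) x)"
        using k less.prems by (simp add: funpow_add[symmetric, THEN fun_cong, unfolded o_apply])
      finally show "(f a ^^ (m - k)) ((f (\<not> a) ^^ (i - k)) ((f_comm a ^^ k) ?v)) \<in> ?S"
        using less.IH[OF k] k less.prems by simp
    qed
    then have "fs.span ((\<lambda>k. (f a ^^ (m - k)) ((f (\<not> a) ^^ (i - k)) ((f_comm a ^^ k) ?v))) ` {..<i}) \<subseteq> ?S"
      by (rule fs.span_minimal) simp
    with c(2) have 1: "(f (\<not> a) ^^ i) ((f a ^^ m) ?v) - fs c (?g i) \<in> ?S"
      by (auto simp: f_pow_f_comm_pow)
    have 2: "(f (\<not> a) ^^ i) ((f a ^^ m) ?v) \<in> ?S"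
      using less.prems by (intro fs.span_base) auto
    from fs.span_diff[OF 2 1] have "fs c (?g i) \<in> ?S" by simp
    from fs.span_scale[OF this, of "inverse c"] c(1) show ?case by simp
  qed
  have "fs.span (?g ` {i. i \<le> m \<and> i \<le> n}) \<subseteq> ?S"
    using g by (intro fs.span_minimal) auto
  then show ?thesis using word_mem_pbw_span[of w x a] assms by auto
qed

end

section \<open>A polynomial model\<close>

text \<open>Inner copies of \<open>R\<close> may be dropped from a product, so each relation is
  \<open>R\<close> applied to the original one. For a projection \<open>R\<close> this is the
  quotient module by its kernel.\<close>

lemma sl3_restrict:
  assumes "sl3_module e f h" and R: "flin R"
    and Re: "\<And>a x. R (e a (R x)) = R (e a x)" and Rf: "\<And>a x. R (f a (R x)) = R (f a x)"
    and Rh: "\<And>a x. R (h a (R x)) = R (h a x)"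
  shows "sl3_module (\<lambda>a x. R (e a x)) (\<lambda>a x. R (f a x)) (\<lambda>a x. R (h a x))"
proof -
  interpret sl3_module e f h by fact
  note Rlin = fp.linear_add[OF R] fp.linear_diff[OF R] fp.linear_scale[OF R] fp.linear_0[OF R]
  show ?thesis
  proof (rule sl3_module.intro)
    show "flin (\<lambda>x. R (e a x))" "flin (\<lambda>x. R (f a x))" "flin (\<lambda>x. R (h a x))" for a
      by (rule flinI; simp add: lins Rlin)+
  next
    fix a b x
    show "R (e a (R (f b x))) = R (f b (R (e a x))) + (if a = b then R (h a x) else 0)"
      by (simp add: Re Rf ef Rlin)
    show "R (h a (R (e b x))) = R (e b (R (h a x))) + fs (cart a b) (R (e b x))"
      by (simp add: Re Rh he Rlin)
    show "R (h a (R (f b x))) = R (f b (R (h a x))) - fs (cart a b) (R (f b x))"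
      by (simp add: Rf Rh hf Rlin)
    show "R (h a (R (h b x))) = R (h b (R (h a x)))" using hh by (simp add: Rh)
    show "R (e a (R (e a (R (e (\<not> a) x))))) = fs 2 (R (e a (R (e (\<not> a) (R (e a x)))))) - R (e (\<not> a) (R (e a (R (e a x)))))"
    proof -
      have "R (e a (R (e b (R (e c x))))) = R (e a (e b (e c x)))" for a b c
        by (simp add: Re)
      then show ?thesis by (simp add: serre_e Rlin)
    qed
    show "R (f a (R (f a (R (f (\<not> a) x))))) = fs 2 (R (f a (R (f (\<not> a) (R (f a x)))))) - R (f (\<not> a) (R (f a (R (f a x)))))"
    proof -
      have "R (f a (R (f b (R (f c x))))) = R (f a (f b (f c x)))" for a b c
        by (simp add: Rf)
      then show ?thesis by (simp add: serre_f Rlin)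
    qed
  qed
qed

type_synonym expo = "nat \<times> nat \<times> nat \<times> nat"

text \<open>A functional \<open>g\<close> on \<open>\<complex>[x, y, z, w]\<close> is given by its values \<open>g (i, j, k, l)\<close> on the monomials
  \<open>x\<^sup>i z\<^sup>j y\<^sup>k w\<^sup>l\<close>. The lowering operators are the transposes of the derivations
  \<open>\<partial>\<^sub>x + y \<partial>\<^sub>w\<close> and \<open>\<partial>\<^sub>y + x \<partial>\<^sub>z\<close>; modulo \<open>x y = z + w\<close> these are the right invariant
  vector fields on the unipotent group.\<close>

definition lowop :: "bool \<Rightarrow> (expo \<Rightarrow> complex) \<Rightarrow> expo \<Rightarrow> complex" where
  "lowop a g = (\<lambda>(i, j, k, l).
     if a then of_nat i * g (i - 1, j, k, l) + of_nat l * g (i, j, Suc k, l - 1)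
     else of_nat k * g (i, j, k - 1, l) + of_nat j * g (Suc i, j - 1, k, l))"

text \<open>For \<open>a = True\<close> the transpose of \<open>la True * x - x\<^sup>2
  \<partial>\<^sub>x - x z \<partial>\<^sub>z + w \<partial>\<^sub>y\<close>, otherwise its mirror
  image under exchanging x with y and z with w. These operators preserve the ideal of x y = z + w,
  but the module relations already hold over the free polynomial ring.\<close>

definition raiseop :: "(bool \<Rightarrow> nat) \<Rightarrow> bool \<Rightarrow> (expo \<Rightarrow> complex) \<Rightarrow> expo \<Rightarrow> complex" where
  "raiseop la a g = (\<lambda>(i, j, k, l).
     if a then (of_nat (la True) - of_nat i - of_nat j) * g (Suc i, j, k, l) + of_nat k * g (i, j, k - 1, Suc l)
     else (of_nat (la False) - of_nat k - of_nat l) * g (i, j, Suc k, l) + of_nat i * g (i - 1, Suc j, k, l))"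

definition expo_weight :: "(bool \<Rightarrow> nat) \<Rightarrow> bool \<Rightarrow> expo \<Rightarrow> complex" where
  "expo_weight la a = (\<lambda>(i, j, k, l).
     if a then of_nat (la True) - 2 * of_nat i - of_nat j + of_nat k - of_nat l
     else of_nat (la False) + of_nat i - of_nat j - 2 * of_nat k - of_nat l)"

definition cartop :: "(bool \<Rightarrow> nat) \<Rightarrow> bool \<Rightarrow> (expo \<Rightarrow> complex) \<Rightarrow> expo \<Rightarrow> complex" where
  "cartop la a g = (\<lambda>x. expo_weight la a x * g x)"

lemmas modelop_defs = lowop_def raiseop_def cartop_def expo_weight_def

lemma nat_zero_one_cases: "n = 0 \<or> n = Suc 0 \<or> (\<exists>m. n = Suc (Suc m))"
  by (metis not0_implies_Suc)

lemma serre_lowop: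
  "lowop a (lowop a (lowop (\<not> a) g)) (i, j, k, l) =
     (fs 2 (lowop a (lowop (\<not> a) (lowop a g))) - lowop (\<not> a) (lowop a (lowop a g))) (i, j, k, l)"
proof -
  have r: "lowop True g (i, j, k, l) = of_nat i * g (i - 1, j, k, l) + of_nat l * g (i, j, Suc k, l - 1)"
    "lowop False g (i, j, k, l) = of_nat k * g (i, j, k - 1, l) + of_nat j * g (Suc i, j - 1, k, l)" for g i j k l
    by (simp_all add: lowop_def)
  show ?thesis
    using nat_zero_one_cases[of i] nat_zero_one_cases[of k]
    by (cases a; elim disjE exE; hypsubst)
      (simp_all only: r fs_apply minus_fun_apply' diff_Suc_1 of_nat_Suc of_nat_0 mult_zero_left add_0_right add_0_left
        not_True_eq_False not_False_eq_True, simp_all add: ring_distribs)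
qed

lemma serre_raiseop:
  "raiseop la a (raiseop la a (raiseop la (\<not> a) g)) (i,j,k,l) =
    (fs 2 (raiseop la a (raiseop la (\<not> a) (raiseop la a g))) - raiseop la (\<not> a) (raiseop la a (raiseop la a g))) (i,j,k,l)"
proof -
    define p where "p a i j = of_nat (la a) - of_nat i - (of_nat j :: complex)" for a i j
    have p: "p a (Suc i) j = p a i j - 1" "p a i (Suc j) = p a i j - 1" for a i j
      by (simp_all add: p_def)
    have r: "raiseop la True g (i, j, k, l) = p True i j * g (Suc i, j, k, l) + of_nat k * g (i, j, k - 1, Suc l)"
      "raiseop la False g (i, j, k, l) = p False k l * g (i, j, Suc k, l) + of_nat i * g (i - 1, Suc j, k, l)" for g i j k l
      by (simp_all add: raiseop_def p_def)
    show ?thesis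
      using nat_zero_one_cases[of i] nat_zero_one_cases[of k] by (cases a; elim disjE exE; hypsubst)
        (simp_all only: r fs_apply minus_fun_apply' diff_Suc_1 p of_nat_Suc of_nat_0 mult_zero_left add_0_right add_0_left not_True_eq_False not_False_eq_True, simp_all add: ring_distribs)
qed

lemma sl3_model: "sl3_module (raiseop la) lowop (cartop la)"
proof (rule sl3_module.intro)
  show "flin (raiseop la a)" "flin (lowop a)" "flin (cartop la a)" for a
    by (rule flinI; cases a; auto simp: modelop_defs pointwise algebra_simps)+
next
  fix a b and g :: "expo \<Rightarrow> complex"
  show "raiseop la a (lowop b g) = lowop b (raiseop la a g) + (if a = b then cartop la a g else 0)"
  proof
    fix x :: expo
    obtain i j k l where x: "x = (i, j, k, l)" by (metis surj_pair)
    show "raiseop la a (lowop b g) x = (lowop b (raiseop la a g) + (if a = b then cartop la a g else 0)) x"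
      unfolding x
      by (cases a; cases b; cases i; cases j; cases k; cases l)
        (simp_all add: modelop_defs pointwise algebra_simps)
  qed
  show "cartop la a (raiseop la b g) = raiseop la b (cartop la a g) + fs (cart a b) (raiseop la b g)"
  proof
    fix x :: expo
    obtain i j k l where x: "x = (i, j, k, l)" by (metis surj_pair)
    show "cartop la a (raiseop la b g) x = (raiseop la b (cartop la a g) + fs (cart a b) (raiseop la b g)) x"
      unfolding x
      by (cases a; cases b; cases i; cases j; cases k; cases l)
        (simp_all add: modelop_defs pointwise cart_def algebra_simps)
  qed
  show "cartop la a (lowop b g) = lowop b (cartop la a g) - fs (cart a b) (lowop b g)"
  proof
    fix x :: expo
    obtain i j k l where x: "x = (i, j, k, l)" by (metis surj_pair)
    show "cartop la a (lowop b g) x = (lowop b (cartop la a g) - fs (cart a b) (lowop b g)) x"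
      unfolding x
      by (cases a; cases b; cases i; cases j; cases k; cases l)
        (simp_all add: modelop_defs pointwise cart_def algebra_simps)
  qed
  show "cartop la a (cartop la b g) = cartop la b (cartop la a g)"
    by (auto simp: cartop_def)
  show "raiseop la a (raiseop la a (raiseop la (\<not> a) g)) =
     fs 2 (raiseop la a (raiseop la (\<not> a) (raiseop la a g))) - raiseop la (\<not> a) (raiseop la a (raiseop la a g))"
  proof
    fix x :: expo
    obtain i j k l where x: "x = (i, j, k, l)" by (metis surj_pair)
    show "raiseop la a (raiseop la a (raiseop la (\<not> a) g)) x =
     (fs 2 (raiseop la a (raiseop la (\<not> a) (raiseop la a g))) - raiseop la (\<not> a) (raiseop la a (raiseop la a g))) x"
      unfolding x by (rule serre_raiseop)
  qed
  show "lowop a (lowop a (lowop (\<not> a) g)) =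
     fs 2 (lowop a (lowop (\<not> a) (lowop a g))) - lowop (\<not> a) (lowop a (lowop a g))"
  proof
    fix x :: expo
    obtain i j k l where x: "x = (i, j, k, l)" by (metis surj_pair)
    show "lowop a (lowop a (lowop (\<not> a) g)) x =
     (fs 2 (lowop a (lowop (\<not> a) (lowop a g))) - lowop (\<not> a) (lowop a (lowop a g))) x"
      unfolding x by (rule serre_lowop)
  qed
qed

text \<open>The monomials of degree at most \<open>la True\<close> in x, z and at most
  \<open>la False\<close> in y, w: in affine coordinates, a symmetric power of a three-dimensional
  representation times a symmetric power of its dual.\<close>

definition box :: "(bool \<Rightarrow> nat) \<Rightarrow> expo set" where
  "box la = {(i, j, k, l). i + j \<le> la True \<and> k + l \<le> la False}"

definition trunc :: "(bool \<Rightarrow> nat) \<Rightarrow> (expo \<Rightarrow> complex) \<Rightarrow> expo \<Rightarrow> complex" where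
  "trunc la g x = (if x \<in> box la then g x else 0)"

lemma finite_box: "finite (box la)"
  by (rule finite_subset[of _ "{..la True} \<times> {..la True} \<times> {..la False} \<times> {..la False}"])
    (auto simp: box_def)

lemma lin_trunc: "flin (trunc la)"
  by (rule flinI) (auto simp: trunc_def pointwise)

lemma trunc_lowop: "trunc la (lowop a (trunc la g)) = trunc la (lowop a g)"
proof
  fix x :: expo
  obtain i j k l where x: "x = (i, j, k, l)" by (metis surj_pair)
  show "trunc la (lowop a (trunc la g)) x = trunc la (lowop a g) x"
    unfolding x by (cases i; cases j; cases k; cases l) (auto simp: trunc_def lowop_def box_def)
qed

text \<open>Only the shifts of \<open>i\<close> and of \<open>k\<close> upwards can leave the box,
  and their coefficients vanish exactly on its boundary.\<close>

lemma trunc_raiseop: "trunc la (raiseop la a (trunc la g)) = trunc la (raiseop la a g)"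
proof
  fix x :: expo
  obtain i j k l where x: "x = (i, j, k, l)" by (metis surj_pair)
  show "trunc la (raiseop la a (trunc la g)) x = trunc la (raiseop la a g) x"
  proof (cases "x \<in> box la")
    case True
    then have b: "i + j \<le> la True" "k + l \<le> la False" by (auto simp: x box_def)
    have "(of_nat (la True) - of_nat i - of_nat j) * trunc la g (Suc i, j, k, l)
        = (of_nat (la True) - of_nat i - of_nat j) * g (Suc i, j, k, l)"
    proof (cases "la True = i + j")
      case False
      with b show ?thesis by (simp add: trunc_def box_def)
    qed simp
    moreover have "(of_nat (la False) - of_nat k - of_nat l) * trunc la g (i, j, Suc k, l)
        = (of_nat (la False) - of_nat k - of_nat l) * g (i, j, Suc k, l)"
    proof (cases "la False = k + l")
      case False
      with b show ?thesis by (simp add: trunc_def box_def)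
    qed simp
    moreover have "of_nat k * trunc la g (i, j, k - 1, Suc l) = of_nat k * g (i, j, k - 1, Suc l)"
      "of_nat i * trunc la g (i - 1, Suc j, k, l) = of_nat i * g (i - 1, Suc j, k, l)"
      using b by (cases k; cases i; simp add: trunc_def box_def)+
    ultimately have "raiseop la a (trunc la g) x = raiseop la a g x"
      unfolding raiseop_def x prod.case by (simp only:)
    then show ?thesis by (simp only: trunc_def)
  qed (simp add: trunc_def)
qed

lemma trunc_cartop: "trunc la (cartop la a (trunc la g)) = trunc la (cartop la a g)"
  by (auto simp: trunc_def cartop_def fun_eq_iff)

definition delta0 :: "expo \<Rightarrow> complex" where
  "delta0 x = (if x = (0, 0, 0, 0) then 1 else 0)"

lemma sl3_hw_box:
  "sl3_hw (\<lambda>a x. trunc la (raiseop la a x)) (\<lambda>a x. trunc la (lowop a x)) (\<lambda>a x. trunc la (cartop la a x)) delta0 la"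
proof (intro sl3_hw.intro sl3_hw_axioms.intro)
  show "sl3_module (\<lambda>a x. trunc la (raiseop la a x)) (\<lambda>a x. trunc la (lowop a x)) (\<lambda>a x. trunc la (cartop la a x))"
    using sl3_restrict[where e = "raiseop la" and f = lowop and h = "cartop la" and R = "trunc la"]
      sl3_model lin_trunc trunc_raiseop trunc_lowop trunc_cartop by blast
  fix a
  show "trunc la (raiseop la a delta0) = 0"
    by (auto simp: trunc_def raiseop_def delta0_def pointwise)
  show "trunc la (cartop la a delta0) = fs (of_nat (la a)) delta0"
    by (cases a) (auto simp: trunc_def cartop_def expo_weight_def delta0_def box_def pointwise)
qed

lemma finite_box_eigenvalues: "finite {c. \<exists>x\<in>K. x \<noteq> 0 \<and> trunc la (cartop la a x) = fs c x}"
proof (rule finite_subset)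
  \<comment> \<open>The eigenvalue 0 accounts for functions with values outside the box, where
    \<open>trunc\<close> returns 0.\<close>
  show "{c. \<exists>x\<in>K. x \<noteq> 0 \<and> trunc la (cartop la a x) = fs c x} \<subseteq> insert 0 (expo_weight la a ` box la)"
  proof clarify
    fix c g assume g: "g \<noteq> 0" "trunc la (cartop la a g) = fs c g" "c \<notin> expo_weight la a ` box la"
    then obtain x where x: "g x \<noteq> 0" by (auto simp: pointwise)
    with g(2) have "trunc la (cartop la a g) x = c * g x" by (simp add: fs_apply)
    with x g(3) show "c = 0" by (auto simp: trunc_def cartop_def split: if_splits)
  qed
qed (simp add: finite_box)

lemma trunc_act_lowop: "trunc la (act lowop w (trunc la g)) = trunc la (act lowop w g)"
proof (induction w)
  case Nil
  then show ?case by (simp add: trunc_def fun_eq_iff)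
next
  case (Cons a w)
  then show ?case by (metis act_simps(2) trunc_lowop)
qed

lemma act_trunc_lowop: "act (\<lambda>a x. trunc la (lowop a x)) w (trunc la g) = trunc la (act lowop w g)"
  by (induction w) (simp_all add: trunc_lowop)

lemma lin_act:
  assumes "\<And>a. flin (f a)"
  shows "flin (act f w)"
proof (induction w)
  case Nil
  then show ?case by (simp add: flinI)
next
  case (Cons a w)
  then show ?case
    by (intro flinI) (simp_all add: fp.linear_add[OF Cons] fp.linear_add[OF assms] fp.linear_scale[OF Cons] fp.linear_scale[OF assms])
qed

text \<open>Exchanges z and w. On the unipotent group this is the anti-automorphism that fixes x and
  y, so it reverses words.\<close>

definition lr_swap :: "expo \<Rightarrow> expo" where
  "lr_swap = (\<lambda>(i, j, k, l). (i, l, k, j))"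

text \<open>Conjugating with \<open>lr_swap\<close> turns right into left invariant vector fields, and these commute.\<close>

lemma act_lowop_rev: "act lowop (rev w) delta0 x = act lowop w delta0 (lr_swap x)"
proof -
  define L where "L a g = lowop a (g \<circ> lr_swap) \<circ> lr_swap" for a g
  have inv: "g \<circ> lr_swap \<circ> lr_swap = g" for g :: "expo \<Rightarrow> complex"
    by (auto simp: lr_swap_def)
  have comm: "L b (lowop a g) = lowop a (L b g)" for a b g
  proof
    fix x :: expo
    obtain i j k l where x: "x = (i, j, k, l)" by (metis surj_pair)
    show "L b (lowop a g) x = lowop a (L b g) x"
      unfolding x by (cases a; cases b; cases i; cases j; cases k; cases l)
        (simp_all add: L_def lowop_def lr_swap_def algebra_simps)
  qed
  have comm_act: "L b (act lowop w g) = act lowop w (L b g)" for b w g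
    by (induction w) (simp_all add: comm)
  have d: "L a delta0 = lowop a delta0" for a
    by (cases a) (auto simp: L_def lowop_def lr_swap_def delta0_def fun_eq_iff)
  have "act L w delta0 = act lowop (rev w) delta0"
    by (induction w) (simp_all add: comm_act d)
  moreover have "act L w delta0 = act lowop w delta0 \<circ> lr_swap"
  proof (induction w)
    case Nil
    then show ?case by (auto simp: lr_swap_def delta0_def fun_eq_iff)
  next
    case (Cons a w)
    then show ?case by (simp only: act_simps L_def inv)
  qed
  ultimately show ?thesis by (metis comp_apply)
qed

text \<open>The diagram automorphism of A2; it reduces statements for \<open>a = False\<close> to
  \<open>a = True\<close>.\<close>

definition xy_swap :: "expo \<Rightarrow> expo" where
  "xy_swap = (\<lambda>(i, j, k, l). (k, l, i, j))"

lemma act_lowop_Not: "act lowop (map Not w) delta0 (xy_swap x) = act lowop w delta0 x"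
proof -
  have "act lowop (map Not w) delta0 \<circ> xy_swap = act lowop w delta0"
  proof (induction w)
    case Nil
    then show ?case by (auto simp: xy_swap_def delta0_def fun_eq_iff)
  next
    case (Cons a w)
    have "lowop (\<not> a) g \<circ> xy_swap = lowop a (g \<circ> xy_swap)" for g
      by (auto simp: lowop_def xy_swap_def fun_eq_iff)
    then show ?case using Cons by (simp only: list.map act_simps)
  qed
  then show ?thesis by (metis comp_apply)
qed

lemma act_lowop_support:
  "act lowop w delta0 (i, j, k, l) \<noteq> 0 \<Longrightarrow> count_list w True = i + j + l \<and> count_list w False = k + j + l"
proof (induction w arbitrary: i j k l)
  case Nil
  then show ?case by (simp add: delta0_def split: if_splits)
next
  case (Cons a w)
  let ?g = "act lowop w delta0"
  have nz: "lowop a ?g (i, j, k, l) \<noteq> 0" using Cons.prems by simp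
  show ?case
  proof (cases a)
    case True
    with nz have "(i > 0 \<and> ?g (i - 1, j, k, l) \<noteq> 0) \<or> (l > 0 \<and> ?g (i, j, Suc k, l - 1) \<noteq> 0)"
      by (auto simp: lowop_def)
    then show ?thesis using Cons.IH[of "i - 1" j k l] Cons.IH[of i j "Suc k" "l - 1"] True by auto
  next
    case False
    with nz have "(k > 0 \<and> ?g (i, j, k - 1, l) \<noteq> 0) \<or> (j > 0 \<and> ?g (Suc i, j - 1, k, l) \<noteq> 0)"
      by (auto simp: lowop_def)
    then show ?thesis using Cons.IH[of i j "k - 1" l] Cons.IH[of "Suc i" "j - 1" k l] False by auto
  qed
qed

section \<open>Triangularity of words against monomials\<close>

lemma act_replicate: "act f (replicate n a) x = (f a ^^ n) x"
  by (induction n) simp_all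

text \<open>The spanning words of \<open>word_mem_span\<close> as lists. The head of a list acts
  last on a vector, hence its transpose acts first on a monomial.\<close>

definition test_word :: "bool \<Rightarrow> nat \<Rightarrow> nat \<Rightarrow> nat \<Rightarrow> bool list" where
  "test_word a m n b = replicate b (\<not> a) @ replicate m a @ replicate (n - b) (\<not> a)"

lemma act_test_word: "act f (test_word a m n b) x = (f (\<not> a) ^^ b) ((f a ^^ m) ((f (\<not> a) ^^ (n - b)) x))"
  by (simp add: test_word_def act_replicate)

text \<open>x^d z^j w^l for \<open>a = True\<close>, and y^d w^j z^l otherwise. Since x y = z + w,
  monomials without the factor x y suffice.\<close>

definition mono_expo :: "bool \<Rightarrow> nat \<Rightarrow> nat \<Rightarrow> nat \<Rightarrow> expo" where
  "mono_expo a d j l = (if a then (d, j, 0, l) else (0, l, d, j))"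

lemma mono_expo_box: "mono_expo a d j l \<in> box la \<longleftrightarrow> d + j \<le> la a \<and> l \<le> la (\<not> a)"
  by (auto simp: mono_expo_def box_def)

lemma lr_swap_mono_expo: "lr_swap (mono_expo a d j l) = mono_expo a d l j"
  by (simp add: mono_expo_def lr_swap_def)

lemma lowop_False_pow_zero: "j < b \<Longrightarrow> (lowop False ^^ b) g (i, j, 0, l) = 0"
proof (induction b arbitrary: i j)
  case (Suc b)
  then show ?case by (cases j) (simp_all add: lowop_def)
qed simp

lemma lowop_False_pow: "(lowop False ^^ j) g (i, j, 0, l) = fact j * g (i + j, 0, 0, l)"
proof (induction j arbitrary: i)
  case (Suc j)
  have "(lowop False ^^ Suc j) g (i, Suc j, 0, l) = of_nat (Suc j) * (lowop False ^^ j) g (Suc i, j, 0, l)"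
    by (simp add: lowop_def)
  then show ?case using Suc[of "Suc i"] by (simp add: algebra_simps)
qed simp

lemma lowop_True_pow: "(lowop True ^^ (i + l)) g (i, 0, k, l) = fact (i + l) * g (0, 0, k + l, 0)"
proof (induction "i + l" arbitrary: i k l)
  case 0
  then show ?case by simp
next
  case (Suc n)
  have "(lowop True ^^ Suc n) g (i, 0, k, l) = of_nat i * (lowop True ^^ n) g (i - 1, 0, k, l)
      + of_nat l * (lowop True ^^ n) g (i, 0, Suc k, l - 1)"
    by (simp add: lowop_def)
  also have "of_nat i * (lowop True ^^ n) g (i - 1, 0, k, l) = of_nat i * (fact n * g (0, 0, k + l, 0))"
    using Suc(1)[of "i - 1" l k] Suc(2) by (cases i) simp_all
  also have "of_nat l * (lowop True ^^ n) g (i, 0, Suc k, l - 1) = of_nat l * (fact n * g (0, 0, k + l, 0))"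
    using Suc(1)[of i "l - 1" "Suc k"] Suc(2) by (cases l) simp_all
  also have "of_nat i * (fact n * g (0, 0, k + l, 0)) + of_nat l * (fact n * g (0, 0, k + l, 0))
      = of_nat (Suc n) * fact n * g (0, 0, k + l, 0)"
    unfolding Suc(2) by (simp add: algebra_simps)
  finally show ?case using Suc(2)[symmetric] by simp
qed

lemma lowop_False_pow_delta0: "(lowop False ^^ k) delta0 (0, 0, k, 0) = fact k"
proof (induction k)
  case (Suc k)
  have "(lowop False ^^ Suc k) delta0 (0, 0, Suc k, 0) = of_nat (Suc k) * (lowop False ^^ k) delta0 (0, 0, k, 0)"
    by (simp add: lowop_def)
  then show ?case using Suc by simp
qed (simp add: delta0_def)

text \<open>Transposed, the word applies \<partial>y + x \<partial>z to x^d z^j w^(n-j)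
  \<open>b\<close> times, which gives 0 for \<open>b > j\<close> and j! x^(d+j) w^(n-j) for
  \<open>b = j\<close>. The next block turns this into (d+n)! y^(n-j), the last one contributes
  (n-j)!.\<close>

lemma test_word_triangular:
  assumes "j \<le> n"
  shows "j < b \<Longrightarrow> act lowop (test_word a (d + n) n b) delta0 (mono_expo a d j (n - j)) = 0"
    and "act lowop (test_word a (d + n) n j) delta0 (mono_expo a d j (n - j)) \<noteq> 0"
proof -
  have True_case: "(j < b \<longrightarrow> act lowop (test_word True (d + n) n b) delta0 (mono_expo True d j (n - j)) = 0)
    \<and> act lowop (test_word True (d + n) n j) delta0 (mono_expo True d j (n - j)) \<noteq> 0"
    using assms lowop_True_pow[of "d + j" "n - j" _ 0]
    by (auto simp: act_test_word mono_expo_def lowop_False_pow_zero lowop_False_pow lowop_False_pow_delta0)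
  have "test_word False m n b = map Not (test_word True m n b)" for m n b
    by (simp add: test_word_def)
  moreover have "mono_expo False d j l = xy_swap (mono_expo True d j l)" for l
    by (simp add: mono_expo_def xy_swap_def)
  ultimately show "j < b \<Longrightarrow> act lowop (test_word a (d + n) n b) delta0 (mono_expo a d j (n - j)) = 0"
    and "act lowop (test_word a (d + n) n j) delta0 (mono_expo a d j (n - j)) \<noteq> 0"
    using True_case by (cases a; simp add: act_lowop_Not)+
qed

section \<open>Matrix representations\<close>

text \<open>Vectors of length \<open>n\<close> are represented by functions on \<^typ>\<open>nat\<close> that vanish from \<open>n\<close> on. Extending
  matrices by zero makes the bracket relations hold on the whole function type.\<close>

definition mop :: "complex mat \<Rightarrow> (nat \<Rightarrow> complex) \<Rightarrow> nat \<Rightarrow> complex" where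
  "mop A x i = (if i < dim_row A then \<Sum>j<dim_col A. A $$ (i, j) * x j else 0)"

lemma lin_mop: "flin (mop A)"
  by (rule flinI) (auto simp: mop_def pointwise sum.distrib sum_distrib_left algebra_simps)

lemma mop_add: "A \<in> carrier_mat n m \<Longrightarrow> B \<in> carrier_mat n m \<Longrightarrow> mop (A + B) x = mop A x + mop B x"
  by (auto simp: mop_def pointwise sum.distrib algebra_simps)

lemma mop_diff: "A \<in> carrier_mat n m \<Longrightarrow> B \<in> carrier_mat n m \<Longrightarrow> mop (A - B) x = mop A x - mop B x"
  by (auto simp: mop_def pointwise sum_subtractf algebra_simps)

lemma mop_smult: "mop (c \<cdot>\<^sub>m A) x = fs c (mop A x)"
  by (auto simp: mop_def pointwise sum_distrib_left algebra_simps)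

lemma mop_zero: "mop (0\<^sub>m n m) x = 0"
  by (auto simp: mop_def pointwise)

lemma mop_mult:
  assumes "A \<in> carrier_mat n m" "B \<in> carrier_mat m k"
  shows "mop (A * B) x = mop A (mop B x)"
proof
  fix i
  have "(\<Sum>j<k. (\<Sum>l<m. A $$ (i, l) * B $$ (l, j)) * x j) = (\<Sum>l<m. A $$ (i, l) * (\<Sum>j<k. B $$ (l, j) * x j))"
    by (simp add: sum_distrib_left sum_distrib_right mult.assoc sum.swap[of _ "{..<m}"])
  then show "mop (A * B) x i = mop A (mop B x) i"
    using assms by (auto simp: mop_def scalar_prod_def atLeast0LessThan)
qed

lemma mop_support: "dim_row A \<le> i \<Longrightarrow> mop A x i = 0"
  by (simp add: mop_def)

section \<open>Chevalley generators of sl3 and their action\<close>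

definition Em :: "bool \<Rightarrow> complex mat" where "Em a = (if a then Emat 0 1 else Emat 1 2)"
definition Fm :: "bool \<Rightarrow> complex mat" where "Fm a = (if a then Emat 1 0 else Emat 2 1)"
definition Hm :: "bool \<Rightarrow> complex mat" where "Hm a = (if a then diag3 1 (-1) 0 else diag3 0 1 (-1))"

lemma gens_sl3: "Em a \<in> sl3" "Fm a \<in> sl3" "Hm a \<in> sl3"
  by (auto simp: sl3_def Em_def Fm_def Hm_def Emat_def diag3_def tr3_def)

lemma sl3_add: "X \<in> sl3 \<Longrightarrow> Y \<in> sl3 \<Longrightarrow> X + Y \<in> sl3"
proof -
  assume XY: "X \<in> sl3" "Y \<in> sl3"
  then have "X \<in> carrier_mat 3 3" "Y \<in> carrier_mat 3 3" by (simp_all add: sl3_def)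
  then have "tr3 (X + Y) = tr3 X + tr3 Y" by (simp add: tr3_def)
  then show ?thesis using XY by (simp add: sl3_def)
qed

lemma sl3_smult: "X \<in> sl3 \<Longrightarrow> c \<cdot>\<^sub>m X \<in> sl3"
  by (auto simp: sl3_def tr3_def simp flip: distrib_left)

lemma mat3_eqI:
  assumes "A \<in> carrier_mat 3 3" "B \<in> carrier_mat 3 3"
    and "A $$ (0,0) = B $$ (0,0)" "A $$ (0,1) = B $$ (0,1)" "A $$ (0,2) = B $$ (0,2)"
    and "A $$ (1,0) = B $$ (1,0)" "A $$ (1,1) = B $$ (1,1)" "A $$ (1,2) = B $$ (1,2)"
    and "A $$ (2,0) = B $$ (2,0)" "A $$ (2,1) = B $$ (2,1)" "A $$ (2,2) = B $$ (2,2)"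
  shows "A = B"
proof (rule eq_matI)
  fix i j assume "i < dim_row B" "j < dim_col B"
  with assms(2) have "i = 0 \<or> i = 1 \<or> i = 2" "j = 0 \<or> j = 1 \<or> j = 2" by auto
  then show "A $$ (i, j) = B $$ (i, j)" using assms by auto
qed (use assms in auto)

lemmas gen_defs = Em_def Fm_def Hm_def Emat_def diag3_def

lemma lie_br_carrier:
  "X \<in> carrier_mat n n \<Longrightarrow> Y \<in> carrier_mat n n \<Longrightarrow> lie_br X Y \<in> carrier_mat n n"
  unfolding lie_br_def by (intro minus_carrier_mat mult_carrier_mat)

lemma lie_br_entry:
  assumes "X \<in> carrier_mat 3 3" "Y \<in> carrier_mat 3 3" "i < 3" "j < 3"
  shows "lie_br X Y $$ (i, j) =
    (X $$ (i,0) * Y $$ (0,j) + X $$ (i,1) * Y $$ (1,j) + X $$ (i,2) * Y $$ (2,j))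
    - (Y $$ (i,0) * X $$ (0,j) + Y $$ (i,1) * X $$ (1,j) + Y $$ (i,2) * X $$ (2,j))"
proof -
  have "{0..<3} = {0, 1, 2 :: nat}" by auto
  then show ?thesis using assms by (simp add: lie_br_def scalar_prod_def)
qed

lemma gens_carrier: "Em a \<in> carrier_mat 3 3" "Fm a \<in> carrier_mat 3 3" "Hm a \<in> carrier_mat 3 3"
  by (simp_all add: gen_defs)

lemma lie_br_sl3: "X \<in> sl3 \<Longrightarrow> Y \<in> sl3 \<Longrightarrow> lie_br X Y \<in> sl3"
  by (simp add: sl3_def lie_br_carrier tr3_def lie_br_entry algebra_simps)

lemma gens_lie_br:
  "lie_br (Em a) (Fm b) = (if a = b then Hm a else 0\<^sub>m 3 3)"
  "lie_br (Hm a) (Em b) = cart a b \<cdot>\<^sub>m Em b"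
  "lie_br (Hm a) (Fm b) = (- cart a b) \<cdot>\<^sub>m Fm b"
  "lie_br (Hm a) (Hm b) = 0\<^sub>m 3 3"
  "lie_br (Em a) (lie_br (Em a) (Em (\<not> a))) = 0\<^sub>m 3 3"
  "lie_br (Fm a) (lie_br (Fm a) (Fm (\<not> a))) = 0\<^sub>m 3 3"
  by (cases a; cases b; intro mat3_eqI;
      simp add: lie_br_entry lie_br_carrier gens_carrier; simp add: gen_defs cart_def)+

lemma gens_transpose: "(Em a)\<^sup>T = Fm a" "(Fm a)\<^sup>T = Em a" "(Hm a)\<^sup>T = Hm a"
  by (rule mat3_eqI; cases a; simp add: gen_defs)+

text \<open>The simple root vectors generate sl3 as a Lie algebra, so stability and intertwining
  need a check on them only.\<close>

lemma sl3_induct [consumes 1, case_names E F add smult lie]: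
  assumes "X \<in> sl3"
    and E: "\<And>a. P (Em a)" and F: "\<And>a. P (Fm a)"
    and add: "\<And>X Y. X \<in> sl3 \<Longrightarrow> Y \<in> sl3 \<Longrightarrow> P X \<Longrightarrow> P Y \<Longrightarrow> P (X + Y)"
    and smult: "\<And>c X. X \<in> sl3 \<Longrightarrow> P X \<Longrightarrow> P (c \<cdot>\<^sub>m X)"
    and lie: "\<And>X Y. X \<in> sl3 \<Longrightarrow> Y \<in> sl3 \<Longrightarrow> P X \<Longrightarrow> P Y \<Longrightarrow> P (lie_br X Y)"
  shows "P X"
proof -
  let ?E3 = "lie_br (Em True) (Em False)" and ?F3 = "lie_br (Fm False) (Fm True)"
  have H: "P (Hm a)" for a using lie[of "Em a" "Fm a"] E F gens_sl3 gens_lie_br(1)[of a a] by simp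
  have 3: "P ?E3" "P ?F3" "?E3 \<in> sl3" "?F3 \<in> sl3"
    by (rule lie lie_br_sl3; rule E F gens_sl3)+
  define c where "c i j = X $$ (i, j)" for i j
  \<comment> \<open>The two commutators are the matrix units at (0,2) and (2,0). The trace condition
    determines the last diagonal entry, hence the coefficients of \<open>Hm True\<close> and
    \<open>Hm False\<close>.\<close>
  let ?Y = "c 0 1 \<cdot>\<^sub>m Em True + (c 1 2 \<cdot>\<^sub>m Em False + (c 0 2 \<cdot>\<^sub>m ?E3 + (c 1 0 \<cdot>\<^sub>m Fm True + (c 2 1 \<cdot>\<^sub>m Fm False
    + (c 2 0 \<cdot>\<^sub>m ?F3 + (c 0 0 \<cdot>\<^sub>m Hm True + (c 0 0 + c 1 1) \<cdot>\<^sub>m Hm False))))))"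
  have "X = ?Y"
  proof -
    have E3: "?E3 = Emat 0 2"
      by (rule mat3_eqI; simp add: lie_br_entry lie_br_carrier gens_carrier gen_defs)
    have F3: "?F3 = Emat 2 0"
      by (rule mat3_eqI; simp add: lie_br_entry lie_br_carrier gens_carrier gen_defs)
    have X: "X \<in> carrier_mat 3 3" "X $$ (0,0) + X $$ (1,1) + X $$ (2,2) = 0" 
      using assms(1) by (auto simp: sl3_def tr3_def)
    then have "X $$ (2,2) = - X $$ (0,0) - X $$ (1,1)" by (simp add: algebra_simps eq_neg_iff_add_eq_0)
    then show ?thesis
      unfolding E3 F3 using X(1) by (intro mat3_eqI) (simp_all add: gen_defs c_def)
  qed
  moreover have "P ?Y"
    by (intro add smult sl3_add sl3_smult gens_sl3 H E F 3)
  ultimately show ?thesis by simp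
qed

context
  fixes n \<rho> assumes rep: "is_rep n \<rho>"
begin

lemma rep_carrier: "X \<in> sl3 \<Longrightarrow> \<rho> X \<in> carrier_mat n n"
  using rep by (simp add: is_rep_def)

lemma rep_add: "X \<in> sl3 \<Longrightarrow> Y \<in> sl3 \<Longrightarrow> \<rho> (X + Y) = \<rho> X + \<rho> Y"
  and rep_smult: "X \<in> sl3 \<Longrightarrow> \<rho> (c \<cdot>\<^sub>m X) = c \<cdot>\<^sub>m \<rho> X"
  and rep_lie: "X \<in> sl3 \<Longrightarrow> Y \<in> sl3 \<Longrightarrow> \<rho> (lie_br X Y) = lie_br (\<rho> X) (\<rho> Y)"
  using rep by (simp_all add: is_rep_def)

lemma rep_zero: "\<rho> (0\<^sub>m 3 3) = 0\<^sub>m n n"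
proof -
  have "0\<^sub>m 3 3 = 0 \<cdot>\<^sub>m Em True" by (rule eq_matI) (auto simp: gen_defs)
  then show ?thesis using rep_smult[of "Em True" 0] gens_sl3 rep_carrier[of "Em True"] by auto
qed

lemma mop_lie:
  assumes "X \<in> sl3" "Y \<in> sl3"
  shows "mop (\<rho> (lie_br X Y)) x = mop (\<rho> X) (mop (\<rho> Y) x) - mop (\<rho> Y) (mop (\<rho> X) x)"
proof -
  note c = rep_carrier[OF assms(1)] rep_carrier[OF assms(2)]
  show ?thesis
    unfolding rep_lie[OF assms] lie_br_def[of "\<rho> X"]
      mop_diff[OF mult_carrier_mat[OF c] mult_carrier_mat[OF c(2,1)]] mop_mult[OF c] mop_mult[OF c(2,1)] ..
qed

lemma sl3_rep: "sl3_module (\<lambda>a. mop (\<rho> (Em a))) (\<lambda>a. mop (\<rho> (Fm a))) (\<lambda>a. mop (\<rho> (Hm a)))"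
proof (rule sl3_module.intro)
  note s = gens_sl3 lie_br_sl3[OF gens_sl3(1,1)] lie_br_sl3[OF gens_sl3(2,2)]
  note lins = fp.linear_diff[OF lin_mop]
  fix a b x
  show "mop (\<rho> (Em a)) (mop (\<rho> (Fm b)) x) = mop (\<rho> (Fm b)) (mop (\<rho> (Em a)) x) + (if a = b then mop (\<rho> (Hm a)) x else 0)"
    using mop_lie[OF s(1)[of a] s(2)[of b], of x] 
    by (auto simp: gens_lie_br rep_zero mop_zero algebra_simps)
  show "mop (\<rho> (Hm a)) (mop (\<rho> (Em b)) x) = mop (\<rho> (Em b)) (mop (\<rho> (Hm a)) x) + fs (cart a b) (mop (\<rho> (Em b)) x)"
    using mop_lie[OF s(3)[of a] s(1)[of b], of x] 
    by (simp add: gens_lie_br rep_smult[OF s(1)] mop_smult algebra_simps)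
  show "mop (\<rho> (Hm a)) (mop (\<rho> (Fm b)) x) = mop (\<rho> (Fm b)) (mop (\<rho> (Hm a)) x) - fs (cart a b) (mop (\<rho> (Fm b)) x)"
    using mop_lie[OF s(3)[of a] s(2)[of b], of x] 
    by (simp add: gens_lie_br rep_smult[OF s(2)] mop_smult algebra_simps)
  show "mop (\<rho> (Hm a)) (mop (\<rho> (Hm b)) x) = mop (\<rho> (Hm b)) (mop (\<rho> (Hm a)) x)"
    using mop_lie[OF s(3)[of a] s(3)[of b], of x] 
    by (simp add: gens_lie_br rep_zero mop_zero)
  show "mop (\<rho> (Em a)) (mop (\<rho> (Em a)) (mop (\<rho> (Em (\<not> a))) x)) =
       fs 2 (mop (\<rho> (Em a)) (mop (\<rho> (Em (\<not> a))) (mop (\<rho> (Em a)) x))) - mop (\<rho> (Em (\<not> a))) (mop (\<rho> (Em a)) (mop (\<rho> (Em a)) x))"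
    using mop_lie[OF s(1)[of a] s(4)[of a "\<not> a"], of x] 
    by (simp only: gens_lie_br rep_zero mop_zero mop_lie[OF s(1,1)] lins)
      (simp only: pointwise, simp add: algebra_simps)
  show "mop (\<rho> (Fm a)) (mop (\<rho> (Fm a)) (mop (\<rho> (Fm (\<not> a))) x)) =
       fs 2 (mop (\<rho> (Fm a)) (mop (\<rho> (Fm (\<not> a))) (mop (\<rho> (Fm a)) x))) - mop (\<rho> (Fm (\<not> a))) (mop (\<rho> (Fm a)) (mop (\<rho> (Fm a)) x))"
    using mop_lie[OF s(2)[of a] s(5)[of a "\<not> a"], of x] 
    by (simp only: gens_lie_br rep_zero mop_zero mop_lie[OF s(2,2)] lins)
      (simp only: pointwise, simp add: algebra_simps)
qed (rule lin_mop)+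

end

definition dual_rep :: "(complex mat \<Rightarrow> complex mat) \<Rightarrow> complex mat \<Rightarrow> complex mat" where
  "dual_rep \<rho> X = (\<rho> (X\<^sup>T))\<^sup>T"

text \<open>The transpose is the Chevalley anti-involution, so the dual is again a highest weight module.\<close>

lemma is_rep_dual:
  assumes "is_rep n \<rho>"
  shows "is_rep n (dual_rep \<rho>)"
proof -
  have t: "X\<^sup>T \<in> sl3" if "X \<in> sl3" for X using that by (auto simp: sl3_def tr3_def)
  have c: "X \<in> carrier_mat 3 3" if "X \<in> sl3" for X using that by (simp add: sl3_def)
  note rc = rep_carrier[OF assms]
  have lie: "(lie_br A B)\<^sup>T = lie_br (B\<^sup>T) (A\<^sup>T)" if "A \<in> carrier_mat k k" "B \<in> carrier_mat k k" for A B :: "complex mat" and k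
    using that by (simp add: lie_br_def transpose_minus[of _ k k] transpose_mult[of _ k k])
  have smult: "(c \<cdot>\<^sub>m A)\<^sup>T = c \<cdot>\<^sub>m A\<^sup>T" for c and A :: "complex mat" by (rule eq_matI) auto
  show ?thesis
    unfolding is_rep_def
  proof (intro conjI ballI allI)
    fix X c assume X: "X \<in> sl3"
    show "dual_rep \<rho> X \<in> carrier_mat n n" using rc t X by (simp add: dual_rep_def)
    show "dual_rep \<rho> (c \<cdot>\<^sub>m X) = c \<cdot>\<^sub>m dual_rep \<rho> X"
      by (simp add: dual_rep_def smult rep_smult[OF assms t[OF X]])
  next
    fix X Y assume X: "X \<in> sl3" and Y: "Y \<in> sl3"
    show "dual_rep \<rho> (X + Y) = dual_rep \<rho> X + dual_rep \<rho> Y"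
      using rc t X Y c rep_add[OF assms t[OF X] t[OF Y]]
      by (simp add: dual_rep_def transpose_add[of _ 3 3] transpose_add[of _ n n])
    show "dual_rep \<rho> (lie_br X Y) = lie_br (dual_rep \<rho> X) (dual_rep \<rho> Y)"
      using lie[OF c[OF X] c[OF Y]] lie[OF rc[OF t[OF Y]] rc[OF t[OF X]]]
      by (simp add: dual_rep_def rep_lie[OF assms t[OF Y] t[OF X]])
  qed
qed

section \<open>Pairings and Kronecker products\<close>

definition pairing :: "nat \<Rightarrow> (nat \<Rightarrow> complex) \<Rightarrow> (nat \<Rightarrow> complex) \<Rightarrow> complex" where
  "pairing n \<xi> x = (\<Sum>i<n. \<xi> i * x i)"

lemma pairing_transpose:
  assumes "A \<in> carrier_mat n n"
  shows "pairing n (mop A\<^sup>T \<xi>) x = pairing n \<xi> (mop A x)"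
proof -
  have "pairing n (mop A\<^sup>T \<xi>) x = (\<Sum>i<n. \<Sum>j<n. A $$ (j, i) * \<xi> j * x i)"
    using assms by (auto simp: pairing_def mop_def sum_distrib_right intro!: sum.cong)
  also have "\<dots> = (\<Sum>j<n. \<Sum>i<n. A $$ (j, i) * \<xi> j * x i)" by (rule sum.swap)
  also have "\<dots> = pairing n \<xi> (mop A x)"
    using assms by (auto simp: pairing_def mop_def sum_distrib_left algebra_simps intro!: sum.cong)
  finally show ?thesis .
qed

lemma pairing_lins:
  "pairing n (\<xi> + \<zeta>) x = pairing n \<xi> x + pairing n \<zeta> x" "pairing n (fs c \<xi>) x = c * pairing n \<xi> x"
  "pairing n \<xi> (x + y) = pairing n \<xi> x + pairing n \<xi> y" "pairing n \<xi> (fs c x) = c * pairing n \<xi> x"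
  "pairing n 0 x = 0" "pairing n \<xi> 0 = 0"
  by (simp_all add: pairing_def pointwise sum.distrib sum_distrib_left algebra_simps)

lemma sum_div_mod:
  fixes F :: "nat \<Rightarrow> nat \<Rightarrow> complex"
  shows "(\<Sum>k<n * m. F (k div m) (k mod m)) = (\<Sum>a<n. \<Sum>b<m. F a b)"
proof -
  have "(\<Sum>k<n * m. F (k div m) (k mod m)) = (\<Sum>(a, b)\<in>{..<n} \<times> {..<m}. F a b)"
  proof (rule sum.reindex_bij_witness[of _ "\<lambda>(a, b). a * m + b" "\<lambda>k. (k div m, k mod m)"])
    fix k assume "k \<in> {..<n * m}"
    then show "(k div m, k mod m) \<in> {..<n} \<times> {..<m}"
      by (cases m) (auto simp: less_mult_imp_div_less)
  next
    fix ab assume "ab \<in> {..<n} \<times> {..<m}"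
    then obtain a b where ab: "ab = (a, b)" "a < n" "b < m" by auto
    then have "a * m + b < Suc a * m" by simp
    also have "\<dots> \<le> n * m" using ab by (intro mult_right_mono) auto
    finally show "(case ab of (a, b) \<Rightarrow> a * m + b) \<in> {..<n * m}" using ab by simp
  qed auto
  then show ?thesis by (simp add: sum.cartesian_product)
qed

lemma kron_carrier: "A \<in> carrier_mat n n' \<Longrightarrow> B \<in> carrier_mat m m' \<Longrightarrow> kron A B \<in> carrier_mat (n * m) (n' * m')"
  by (auto simp: kron_def)

lemma div_mod_less: "k < n * m \<Longrightarrow> k div m < n \<and> k mod m < m" for k n m :: nat
  by (cases m) (auto simp: less_mult_imp_div_less)

lemma kron_mult:
  assumes A: "A \<in> carrier_mat n n" "C \<in> carrier_mat n n" and B: "B \<in> carrier_mat m m" "D \<in> carrier_mat m m"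
  shows "kron A B * kron C D = kron (A * C) (B * D)"
proof (rule eq_matI)
  fix i j assume "i < dim_row (kron (A * C) (B * D))" "j < dim_col (kron (A * C) (B * D))"
  then have ij: "i < n * m" "j < n * m" using assms by (auto simp: kron_def)
  note d = div_mod_less[OF ij(1)] div_mod_less[OF ij(2)]
  have "(kron A B * kron C D) $$ (i, j) = (\<Sum>k<n * m. (A $$ (i div m, k div m) * B $$ (i mod m, k mod m)) *
      (C $$ (k div m, j div m) * D $$ (k mod m, j mod m)))"
    using assms ij by (simp add: kron_def scalar_prod_def atLeast0LessThan)
  also have "\<dots> = (\<Sum>a<n. \<Sum>b<m. (A $$ (i div m, a) * B $$ (i mod m, b)) * (C $$ (a, j div m) * D $$ (b, j mod m)))"
    by (rule sum_div_mod)
  also have "\<dots> = (\<Sum>a<n. A $$ (i div m, a) * C $$ (a, j div m)) * (\<Sum>b<m. B $$ (i mod m, b) * D $$ (b, j mod m))"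
    by (simp add: sum_product algebra_simps)
  also have "\<dots> = kron (A * C) (B * D) $$ (i, j)"
    using assms ij d by (simp add: kron_def scalar_prod_def atLeast0LessThan)
  finally show "(kron A B * kron C D) $$ (i, j) = kron (A * C) (B * D) $$ (i, j)" .
qed (use assms in \<open>auto simp: kron_def\<close>)

lemma is_rep_tensor:
  assumes rho: "is_rep n \<rho>" and sig: "is_rep m \<sigma>"
  shows "is_rep (n * m) (tensor_rep n \<rho> m \<sigma>)"
proof -
  note rc = rep_carrier[OF rho] and sc = rep_carrier[OF sig]
  have ext: "M = N" if "M \<in> carrier_mat (n * m) (n * m)" "N \<in> carrier_mat (n * m) (n * m)"
    and "\<And>i j. i < n * m \<Longrightarrow> j < n * m \<Longrightarrow> i div m < n \<Longrightarrow> j div m < n \<Longrightarrow> i mod m < m \<Longrightarrow> j mod m < m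
      \<Longrightarrow> M $$ (i, j) = N $$ (i, j)" for M N :: "complex mat"
    using that div_mod_less by (intro eq_matI) auto
  have kl: "kron (A + A') B = kron A B + kron A' B" if "A \<in> carrier_mat n n" "A' \<in> carrier_mat n n" "B \<in> carrier_mat m m" for A A' B
    using that by (intro ext) (auto simp: kron_def ring_distribs)
  have kr: "kron A (B + B') = kron A B + kron A B'" if "A \<in> carrier_mat n n" "B' \<in> carrier_mat m m" "B \<in> carrier_mat m m" for A B B'
    using that by (intro ext) (auto simp: kron_def ring_distribs)
  have kdl: "kron (A - A') B = kron A B - kron A' B" if "A \<in> carrier_mat n n" "A' \<in> carrier_mat n n" "B \<in> carrier_mat m m" for A A' B
    using that by (intro ext) (auto simp: kron_def ring_distribs)
  have kdr: "kron A (B - B') = kron A B - kron A B'" if "A \<in> carrier_mat n n" "B' \<in> carrier_mat m m" "B \<in> carrier_mat m m" for A B B'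
    using that by (intro ext) (auto simp: kron_def ring_distribs)
  have ksl: "kron (c \<cdot>\<^sub>m A) B = c \<cdot>\<^sub>m kron A B" and ksr: "kron A (c \<cdot>\<^sub>m B) = c \<cdot>\<^sub>m kron A B"
    if "A \<in> carrier_mat n n" "B \<in> carrier_mat m m" for c A B
    using that by (intro ext; auto simp: kron_def ring_distribs)+
  have tc: "tensor_rep n \<rho> m \<sigma> X \<in> carrier_mat (n * m) (n * m)" if "X \<in> sl3" for X
    using kron_carrier[OF rc[OF that] one_carrier_mat] kron_carrier[OF one_carrier_mat sc[OF that]]
    by (simp add: tensor_rep_def)
  have kc: "kron A B \<in> carrier_mat (n * m) (n * m)" if "A \<in> carrier_mat n n" "B \<in> carrier_mat m m" for A B
    by (rule kron_carrier[OF that])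
  show ?thesis
    unfolding is_rep_def
  proof (intro conjI ballI allI tc)
    fix X Y assume X: "X \<in> sl3" and Y: "Y \<in> sl3"
    note cc = rc[OF X] rc[OF Y] sc[OF X] sc[OF Y]
    note k = kc[OF cc(1) one_carrier_mat] kc[OF cc(2) one_carrier_mat] kc[OF one_carrier_mat cc(3)] kc[OF one_carrier_mat cc(4)]
    show "tensor_rep n \<rho> m \<sigma> (X + Y) = tensor_rep n \<rho> m \<sigma> X + tensor_rep n \<rho> m \<sigma> Y"
      using k cc by (simp add: tensor_rep_def rep_add[OF rho X Y] rep_add[OF sig X Y] kl kr)
        (rule eq_matI, auto)
    show "tensor_rep n \<rho> m \<sigma> (lie_br X Y) = lie_br (tensor_rep n \<rho> m \<sigma> X) (tensor_rep n \<rho> m \<sigma> Y)"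
    proof -
      \<comment> \<open>The two mixed terms are interchanged together with \<open>X\<close> and
        \<open>Y\<close>, so they cancel in the bracket.\<close>
      have mult: "tensor_rep n \<rho> m \<sigma> X * tensor_rep n \<rho> m \<sigma> Y = kron (\<rho> X * \<rho> Y) (1\<^sub>m m) + kron (\<rho> Y) (\<sigma> X)
          + (kron (\<rho> X) (\<sigma> Y) + kron (1\<^sub>m n) (\<sigma> X * \<sigma> Y))" if X: "X \<in> sl3" and Y: "Y \<in> sl3" for X Y
      proof -
        note cc = rc[OF X] rc[OF Y] sc[OF X] sc[OF Y]
        note k = kc[OF cc(1) one_carrier_mat] kc[OF cc(2) one_carrier_mat] kc[OF one_carrier_mat cc(3)] kc[OF one_carrier_mat cc(4)]
        show ?thesis
          unfolding tensor_rep_def mult_add_distrib_mat[OF add_carrier_mat[OF k(3)] k(2,4)]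
            add_mult_distrib_mat[OF k(1,3,2)] add_mult_distrib_mat[OF k(1,3,4)]
          using cc by (simp add: kron_mult[of _ n _ _ m])
      qed
      note kk = kc[OF mult_carrier_mat[OF cc(1,2)] one_carrier_mat[of m]] kc[OF mult_carrier_mat[OF cc(2,1)] one_carrier_mat[of m]] 
        kc[OF one_carrier_mat[of n] mult_carrier_mat[OF cc(3,4)]] kc[OF one_carrier_mat[of n] mult_carrier_mat[OF cc(4,3)]]
        kc[OF cc(1,4)] kc[OF cc(2,3)] kc[OF cc(1,3)] kc[OF cc(2,4)]
      show ?thesis
        unfolding lie_br_def[of "tensor_rep n \<rho> m \<sigma> X"] mult[OF X Y] mult[OF Y X]
        unfolding tensor_rep_def unfolding rep_lie[OF rho X Y] rep_lie[OF sig X Y] unfolding lie_br_def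
        using kk cc by (simp add: kdl kdr) (rule eq_matI, auto)
    qed
  next
    fix X c assume X: "X \<in> sl3"
    show "tensor_rep n \<rho> m \<sigma> (c \<cdot>\<^sub>m X) = c \<cdot>\<^sub>m tensor_rep n \<rho> m \<sigma> X"
      using rc[OF X] sc[OF X] kc[OF rc[OF X] one_carrier_mat] kc[OF one_carrier_mat sc[OF X]]
      by (simp add: tensor_rep_def rep_smult[OF rho X] rep_smult[OF sig X] ksl ksr)
        (rule eq_matI, auto simp: algebra_simps)
  qed
qed

section \<open>Irreducible representations\<close>

definition supp :: "nat \<Rightarrow> (nat \<Rightarrow> complex) set" where
  "supp n = {x. \<forall>i\<ge>n. x i = 0}"

definition unit_fun :: "nat \<Rightarrow> nat \<Rightarrow> complex" where
  "unit_fun i = (\<lambda>j. if j = i then 1 else 0)"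

lemma subspace_supp: "fs.subspace (supp n)"
  by (rule fs.subspaceI) (auto simp: supp_def pointwise)

lemma mop_supp: "A \<in> carrier_mat n m \<Longrightarrow> mop A x \<in> supp n"
  by (auto simp: supp_def mop_def)

lemma unit_fun_supp: "i < n \<Longrightarrow> unit_fun i \<in> supp n"
  by (auto simp: supp_def unit_fun_def)

lemma supp_expand:
  assumes "x \<in> supp n"
  shows "x = (\<Sum>i<n. fs (x i) (unit_fun i))"
proof
  fix j
  have "(\<Sum>i<n. x i * (if j = i then 1 else 0)) = (if j < n then x j else 0)"
    by (simp add: if_distrib[of "\<lambda>z. _ * z"] cong: if_cong)
  then show "x j = (\<Sum>i<n. fs (x i) (unit_fun i)) j"
    using assms by (auto simp: pointwise unit_fun_def supp_def)
qed

lemma linear_supp_expand: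
  assumes "flin T" "x \<in> supp n"
  shows "T x j = (\<Sum>i<n. x i * T (unit_fun i) j)"
proof -
  have "T x = (\<Sum>i<n. fs (x i) (T (unit_fun i)))"
    by (subst supp_expand[OF assms(2)]) (simp add: fp.linear_sum[OF assms(1)] fp.linear_scale[OF assms(1)])
  then show ?thesis by (simp add: pointwise)
qed

lemma supp_subset_span: "supp n \<subseteq> fs.span (unit_fun ` {..<n})"
proof
  fix x assume "x \<in> supp n"
  from supp_expand[OF this] show "x \<in> fs.span (unit_fun ` {..<n})"
    by (metis (no_types, lifting) fs.span_base fs.span_scale fs.span_sum image_eqI)
qed

lemma finite_mop_eigenvalues:
  assumes "K \<subseteq> supp n"
  shows "finite {c. \<exists>x\<in>K. x \<noteq> 0 \<and> mop A x = fs c x}"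
proof (rule finite_subset)
  have "K \<subseteq> fs.span (unit_fun ` {..<n})" using assms supp_subset_span by (rule subset_trans)
  then show "{c. \<exists>x\<in>K. x \<noteq> 0 \<and> mop A x = fs c x} \<subseteq> {c. \<exists>x\<in>fs.span (unit_fun ` {..<n}). x \<noteq> 0 \<and> mop A x = fs c x}"
    by blast
qed (simp add: finite_eigenvalues[OF lin_mop])

lemma pairing_unit: "i < n \<Longrightarrow> pairing n x (unit_fun i) = x i"
  by (simp add: pairing_def unit_fun_def if_distrib[of "\<lambda>z. _ * z"] cong: if_cong)

lemma pairing_eqI:
  assumes "\<xi> \<in> supp n" "\<zeta> \<in> supp n" "\<And>x. x \<in> supp n \<Longrightarrow> pairing n \<xi> x = pairing n \<zeta> x"
  shows "\<xi> = \<zeta>"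
proof
  fix i show "\<xi> i = \<zeta> i"
    using assms(1,2) assms(3)[OF unit_fun_supp, of i] pairing_unit[of i n]
    by (cases "i < n") (auto simp: supp_def)
qed

lemma separating_pairing:
  assumes "S \<subseteq> supp n" "x \<in> supp n" "x \<notin> fs.span S"
  obtains \<xi> where "\<xi> \<in> supp n" "\<And>z. z \<in> fs.span S \<Longrightarrow> pairing n \<xi> z = 0" "pairing n \<xi> x = 1"
proof -
  obtain g :: "(nat \<Rightarrow> complex) \<Rightarrow> unit \<Rightarrow> complex"
    where g: "flin g" "\<And>z. z \<in> fs.span S \<Longrightarrow> g z = 0" "g x = 1"
    using separating_functional[OF assms(3)] by blast
  define \<xi> where "\<xi> i = (if i < n then g (unit_fun i) () else 0)" for i
  have p: "pairing n \<xi> z = g z ()" if "z \<in> supp n" for z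
    using linear_supp_expand[OF g(1) that] by (simp add: pairing_def \<xi>_def mult.commute)
  have "fs.span S \<subseteq> supp n" using assms(1) subspace_supp by (rule fs.span_minimal)
  then show ?thesis
    using g p assms(2) by (intro that[of \<xi>]) (auto simp: supp_def \<xi>_def zero_fun_apply one_fun_apply)
qed

lemma irreducible_stable_subspace:
  assumes irr: "irreducible_rep n \<rho>" and S: "fs.subspace S" "S \<subseteq> supp n"
    and E: "\<And>a x. x \<in> S \<Longrightarrow> mop (\<rho> (Em a)) x \<in> S" and F: "\<And>a x. x \<in> S \<Longrightarrow> mop (\<rho> (Fm a)) x \<in> S"
    and x0: "x0 \<in> S" "x0 \<noteq> 0"
  shows "S = supp n"
proof -
  have rep: "is_rep n \<rho>" using irr by (simp add: irreducible_rep_def)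
  note rc = rep_carrier[OF rep]
  have stable: "\<forall>x\<in>S. mop (\<rho> X) x \<in> S" if "X \<in> sl3" for X
    using that
  proof (induction rule: sl3_induct)
    case (add X Y)
    then show ?case using S(1) by (auto simp: rep_add[OF rep] mop_add[OF rc rc] intro: fs.subspace_add)
  next
    case (smult c X)
    then show ?case using S(1) by (auto simp: rep_smult[OF rep] mop_smult intro: fs.subspace_scale)
  next
    case (lie X Y)
    show ?case
      unfolding mop_lie[OF rep lie(1,2)] using lie by (intro ballI fs.subspace_diff[OF S(1)]) blast+
  qed (use E F in auto)
  define U where "U = vec n ` S"
  have mv: "\<rho> X *\<^sub>v vec n x = vec n (mop (\<rho> X) x)" if "X \<in> sl3" for X x
    using rc[OF that] by (intro eq_vecI) (auto simp: mop_def scalar_prod_def atLeast0LessThan)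
  have "is_subspace n U"
    unfolding is_subspace_def
  proof (intro conjI ballI allI)
    show "0\<^sub>v n \<in> U" unfolding U_def
      by (rule image_eqI[of _ _ 0]) (auto simp: fs.subspace_0[OF S(1)] zero_fun_apply)
    fix u v assume "u \<in> U" "v \<in> U"
    then obtain x z where "u = vec n x" "v = vec n z" "x \<in> S" "z \<in> S" by (auto simp: U_def)
    then show "u + v \<in> U" unfolding U_def
      by (intro image_eqI[of _ _ "x + z"]) (auto simp: fs.subspace_add[OF S(1)] plus_fun_apply)
  next
    fix u c assume "u \<in> U"
    then obtain x where "u = vec n x" "x \<in> S" by (auto simp: U_def)
    then show "c \<cdot>\<^sub>v u \<in> U" unfolding U_def
      by (intro image_eqI[of _ _ "fs c x"]) (auto simp: fs.subspace_scale[OF S(1)] fs_apply)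
  qed (auto simp: U_def)
  moreover have "\<forall>X\<in>sl3. \<forall>u\<in>U. \<rho> X *\<^sub>v u \<in> U"
    using stable by (auto simp: U_def mv)
  ultimately have "U = {0\<^sub>v n} \<or> U = carrier_vec n" using irr by (simp add: irreducible_rep_def)
  moreover have "U \<noteq> {0\<^sub>v n}"
  proof
    assume "U = {0\<^sub>v n}"
    then have "vec n x0 = 0\<^sub>v n" using x0 by (auto simp: U_def)
    then have z: "x0 i = 0" if "i < n" for i using that by (metis index_vec index_zero_vec(1))
    have "x0 \<in> supp n" using x0(1) S(2) by blast
    then have "x0 i = 0" for i using z by (cases "i < n") (auto simp: supp_def)
    then have "x0 = 0" by (auto simp: pointwise)
    then show False using x0 by simp
  qed
  ultimately have U: "U = carrier_vec n" by simp
  have "supp n \<subseteq> S"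
  proof
    fix z assume z: "z \<in> supp n"
    have "vec n z \<in> U" by (simp add: U)
    then obtain x where x: "x \<in> S" "vec n z = vec n x" by (auto simp: U_def)
    then have eq: "z i = x i" if "i < n" for i using that by (metis index_vec)
    have "x \<in> supp n" using x S by auto
    then have "z i = x i" for i using z eq by (cases "i < n") (auto simp: supp_def)
    then have "z = x" by auto
    then show "z \<in> S" using x by simp
  qed
  then show ?thesis using S by auto
qed

definition coord :: "dweight \<Rightarrow> bool \<Rightarrow> nat" where
  "coord la a = (if a then fst la else snd la)"

abbreviation eop where "eop \<rho> \<equiv> \<lambda>a. mop (\<rho> (Em a))"
abbreviation fop where "fop \<rho> \<equiv> \<lambda>a. mop (\<rho> (Fm a))"
abbreviation hop where "hop \<rho> \<equiv> \<lambda>a. mop (\<rho> (Hm a))"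

lemma pairing_dual:
  assumes "is_rep n \<rho>"
  shows "pairing n (fop (dual_rep \<rho>) a \<xi>) x = pairing n \<xi> (eop \<rho> a x)"
    and "pairing n (eop (dual_rep \<rho>) a \<xi>) x = pairing n \<xi> (fop \<rho> a x)"
    and "pairing n (hop (dual_rep \<rho>) a \<xi>) x = pairing n \<xi> (hop \<rho> a x)"
  using pairing_transpose[OF rep_carrier[OF assms]] gens_sl3 by (simp_all add: dual_rep_def gens_transpose)

lemma act_fop_supp: "is_rep n \<rho> \<Longrightarrow> x \<in> supp n \<Longrightarrow> act (fop \<rho>) w x \<in> supp n"
  by (cases w) (simp_all add: mop_supp[OF rep_carrier[OF _ gens_sl3(2)]])

lemma word_span_supp:
  assumes "is_rep n \<rho>" "x \<in> supp n"
  shows "word_span (fop \<rho>) x \<subseteq> supp n"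
  unfolding word_span_def using act_fop_supp[OF assms] subspace_supp by (intro fs.span_minimal) auto

text \<open>Simplicity is recorded by two consequences: lowering words on \<open>v\<close> fill the
  space, and lowering words on the covector \<open>\<phi>\<close> separate its points. The covector
  is a highest weight vector of the dual, where the transposed raising operators lower.\<close>

locale irrep =
  fixes n :: nat and \<rho> :: "complex mat \<Rightarrow> complex mat" and la :: "bool \<Rightarrow> nat" and v \<phi> :: "nat \<Rightarrow> complex"
  assumes rep: "is_rep n \<rho>"
    and hw_v: "sl3_hw (eop \<rho>) (fop \<rho>) (hop \<rho>) v la"
    and hw_phi: "sl3_hw (eop (dual_rep \<rho>)) (fop (dual_rep \<rho>)) (hop (dual_rep \<rho>)) \<phi> la"
    and v_supp: "v \<in> supp n" and phi_supp: "\<phi> \<in> supp n" and pairing_v: "pairing n \<phi> v = 1"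
    and word_span_v: "word_span (fop \<rho>) v = supp n"
    and separates: "x \<in> supp n \<Longrightarrow> (\<And>w. pairing n (act (fop (dual_rep \<rho>)) w \<phi>) x = 0) \<Longrightarrow> x = 0"
begin

lemma v_nonzero: "v \<noteq> 0" and phi_nonzero: "\<phi> \<noteq> 0"
  using pairing_v by (auto simp: pairing_lins)

lemma word_span_phi: "word_span (fop (dual_rep \<rho>)) \<phi> = supp n"
proof
  show sub: "word_span (fop (dual_rep \<rho>)) \<phi> \<subseteq> supp n"
    by (rule word_span_supp[OF is_rep_dual[OF rep] phi_supp])
  show "supp n \<subseteq> word_span (fop (dual_rep \<rho>)) \<phi>"
  proof (rule subsetI, rule ccontr)
    fix x assume x: "x \<in> supp n" "x \<notin> word_span (fop (dual_rep \<rho>)) \<phi>"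
    obtain \<xi> where xi: "\<xi> \<in> supp n" "\<And>z. z \<in> word_span (fop (dual_rep \<rho>)) \<phi> \<Longrightarrow> pairing n \<xi> z = 0" "pairing n \<xi> x = 1"
      using separating_pairing[of "range (\<lambda>w. act (fop (dual_rep \<rho>)) w \<phi>)" n x] x
        act_fop_supp[OF is_rep_dual[OF rep] phi_supp] unfolding word_span_def by blast
    have "pairing n (act (fop (dual_rep \<rho>)) w \<phi>) \<xi> = 0" for w
    proof -
      have "act (fop (dual_rep \<rho>)) w \<phi> \<in> word_span (fop (dual_rep \<rho>)) \<phi>"
        unfolding word_span_def by (rule fs.span_base) simp
      from xi(2)[OF this] show ?thesis by (simp add: pairing_def mult.commute)
    qed
    then have "\<xi> = 0" using separates[OF xi(1)] by blast
    then show False using xi(3) by (simp add: pairing_lins)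
  qed
qed

end

text \<open>\<open>\<phi>\<close> is chosen to vanish on the images of all lowering operators and to
  be 1 on \<open>v\<close>. By adjointness the first property says that the raising operators of the
  dual kill \<open>\<phi>\<close>.\<close>

lemma irrep_exists:
  assumes "is_V n \<rho> la"
  shows "\<exists>v \<phi>. irrep n \<rho> (coord la) v \<phi>"
proof -
  have irr: "irreducible_rep n \<rho>" and hw: "has_hw n \<rho> la" using assms by (simp_all add: is_V_def)
  have rep: "is_rep n \<rho>" using irr by (simp add: irreducible_rep_def)
  note drep = is_rep_dual[OF rep]
  note rc = rep_carrier[OF rep]
  obtain v0 where v0: "v0 \<in> carrier_vec n" "v0 \<noteq> 0\<^sub>v n" "\<And>H. H \<in> cartan \<Longrightarrow> \<rho> H *\<^sub>v v0 = wt la H \<cdot>\<^sub>v v0"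
    "\<And>E. E \<in> pos_root_vectors \<Longrightarrow> \<rho> E *\<^sub>v v0 = 0\<^sub>v n"
    using hw unfolding has_hw_def by blast
  define v where "v i = (if i < n then v0 $ i else 0)" for i
  have v: "v \<in> supp n" by (simp add: supp_def v_def)
  have "v \<noteq> 0"
  proof
    assume "v = 0"
    then have "v0 $ i = 0" if "i < n" for i using that by (auto simp: v_def pointwise split: if_splits)
    then have "v0 = 0\<^sub>v n" using v0(1) by (intro eq_vecI) auto
    then show False using v0(2) by simp
  qed
  have mv: "mop (\<rho> X) v i = (\<rho> X *\<^sub>v v0) $ i" if "X \<in> sl3" "i < n" for X i
    using rc[OF that(1)] v0(1) that(2) by (auto simp: mop_def v_def scalar_prod_def atLeast0LessThan)
  interpret A: sl3_hw "eop \<rho>" "fop \<rho>" "hop \<rho>" v "coord la"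
  proof (intro sl3_hw.intro sl3_hw_axioms.intro)
    show "sl3_module (eop \<rho>) (fop \<rho>) (hop \<rho>)" by (rule sl3_rep[OF rep])
    fix a
    have "Em a \<in> pos_root_vectors" by (simp add: Em_def pos_root_vectors_def)
    then show "eop \<rho> a v = 0"
      using v0(4) mv[OF gens_sl3(1)] rc[OF gens_sl3(1), of a]
      by (auto simp: fun_eq_iff zero_fun_apply mop_support) (metis carrier_matD(1) index_zero_vec(1) mop_support not_le)
    have "Hm a \<in> cartan" using gens_sl3(3)[of a] by (auto simp: cartan_def Hm_def diag3_def)
    moreover have "wt la (Hm a) = of_nat (coord la a)"
      by (auto simp: wt_def Hm_def diag3_def coord_def)
    ultimately show "hop \<rho> a v = fs (of_nat (coord la a)) v"
      using v0(1,3) mv[OF gens_sl3(3)] rc[OF gens_sl3(3), of a]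
      by (intro ext) (auto simp: fs_apply mop_support v_def)
  qed
  have v_mem: "v \<in> word_span (fop \<rho>) v"
    unfolding word_span_def by (rule fs.span_base) (rule range_eqI[of _ _ "[]"], simp)
  have full: "word_span (fop \<rho>) v = supp n"
    by (rule irreducible_stable_subspace[OF irr _ _ _ _ v_mem \<open>v \<noteq> 0\<close>])
      (simp_all add: word_span_supp[OF rep v] A.e_word_span A.f_word_span, simp add: word_span_def)
  let ?N = "fs.span ((\<lambda>w. act (fop \<rho>) w v) ` {w. w \<noteq> []})"
  have "v \<notin> ?N"
  proof
    assume "v \<in> ?N"
    then obtain D k where D: "finite D" "D \<subseteq> count_list ` {w. w \<noteq> []}" 
      "\<And>d. d \<in> D \<Longrightarrow> k d \<in> word_span_deg (fop \<rho>) v d" "v = (\<Sum>d\<in>D. k d)"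
      using A.homogeneous_decomposition by blast
    define z where "z = (\<lambda>_::bool. 0::nat)"
    have z: "z \<notin> D"
    proof
      assume "z \<in> D"
      then obtain w where w: "w \<noteq> []" "count_list w = z" using D(2) by blast
      then have "count_list w (hd w) = 0" by (simp add: z_def)
      with w(1) show False by (cases w) auto
    qed
    \<comment> \<open>Subtracting \<open>v\<close>, which has degree \<open>z\<close>, turns the
      decomposition into a vanishing sum over distinct degrees; its component at \<open>z\<close> is
      then 0.\<close>
    define k' where "k' = k(z := - v)"
    have k': "k' d \<in> word_span_deg (fop \<rho>) v d" if "d \<in> insert z D" for d
    proof (cases "d = z")
      case True
      have "v \<in> word_span_deg (fop \<rho>) v z" unfolding word_span_deg_def z_def
        by (rule fs.span_base) (rule image_eqI[of _ _ "[]"], auto)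
      then show ?thesis using True by (simp add: k'_def word_span_deg_def fs.span_neg)
    qed (use that D(3) in \<open>simp add: k'_def\<close>)
    have "(\<Sum>d\<in>D. k' d) = (\<Sum>d\<in>D. k d)"
      by (rule sum.cong) (use z in \<open>auto simp: k'_def\<close>)
    then have s: "(\<Sum>d\<in>insert z D. k' d) \<in> {0}" using D(4) z D(1) by (simp add: k'_def)
    have "k' z \<in> {0}"
      by (rule A.homogeneous_components_mem[OF _ _ _ k' s]) (use D(1) A.lins(12) in auto)
    then show False using \<open>v \<noteq> 0\<close> by (simp add: k'_def)
  qed
  then obtain \<phi> where phi: "\<phi> \<in> supp n" "\<And>z. z \<in> ?N \<Longrightarrow> pairing n \<phi> z = 0" "pairing n \<phi> v = 1"
    using separating_pairing[of "(\<lambda>w. act (fop \<rho>) w v) ` {w. w \<noteq> []}" n v] act_fop_supp[OF rep v] v by blast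
  have fN: "fop \<rho> a x \<in> ?N" if "x \<in> supp n" for a x
    using that unfolding full[symmetric] word_span_def
  proof (rule span_image_subset[OF lin_mop], clarify)
    fix w show "fop \<rho> a (act (fop \<rho>) w v) \<in> ?N"
      by (rule fs.span_base) (rule image_eqI[of _ _ "a # w"], auto)
  qed
  have dc: "dual_rep \<rho> X \<in> carrier_mat n n" if "X \<in> sl3" for X by (rule rep_carrier[OF drep that])
  interpret B: sl3_hw "eop (dual_rep \<rho>)" "fop (dual_rep \<rho>)" "hop (dual_rep \<rho>)" \<phi> "coord la"
  proof (intro sl3_hw.intro sl3_hw_axioms.intro)
    show "sl3_module (eop (dual_rep \<rho>)) (fop (dual_rep \<rho>)) (hop (dual_rep \<rho>))" by (rule sl3_rep[OF drep])
    fix a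
    show "eop (dual_rep \<rho>) a \<phi> = 0"
    proof (rule pairing_eqI[of _ n])
      show "eop (dual_rep \<rho>) a \<phi> \<in> supp n" by (rule mop_supp[OF dc[OF gens_sl3(1)]])
      show "0 \<in> supp n" by (rule fs.subspace_0[OF subspace_supp])
      show "pairing n (eop (dual_rep \<rho>) a \<phi>) x = pairing n 0 x" if "x \<in> supp n" for x
        using phi(2)[OF fN[OF that]] by (simp add: pairing_dual[OF rep] pairing_lins)
    qed
    show "hop (dual_rep \<rho>) a \<phi> = fs (of_nat (coord la a)) \<phi>"
    proof (rule pairing_eqI[of _ n])
      show "hop (dual_rep \<rho>) a \<phi> \<in> supp n" by (rule mop_supp[OF dc[OF gens_sl3(3)]])
      show "fs (of_nat (coord la a)) \<phi> \<in> supp n" by (rule fs.subspace_scale[OF subspace_supp phi(1)])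
      fix x assume "x \<in> supp n"
      then have x: "x \<in> fs.span (range (\<lambda>w. act (fop \<rho>) w v))" using full by (simp add: word_span_def)
      define G1 where "G1 x = (\<lambda>_::unit. pairing n \<phi> (hop \<rho> a x))" for x
      define G2 where "G2 x = (\<lambda>_::unit. of_nat (coord la a) * pairing n \<phi> x)" for x
      have "G1 x = G2 x"
      proof (rule span_transfer[OF _ _ x])
        show "flin G1" "flin G2"
          by (rule flinI; simp add: G1_def G2_def pointwise fp.linear_add[OF lin_mop] fp.linear_scale[OF lin_mop]
              pairing_lins algebra_simps)+
        fix s assume "s \<in> range (\<lambda>w. act (fop \<rho>) w v)"
        then obtain w where s: "s = act (fop \<rho>) w v" by blast
        show "G1 s = G2 s"
        proof (cases "w = []")
          case True
          then show ?thesis by (simp add: G1_def G2_def s A.h_y pairing_lins)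
        next
          case False
          then have "s \<in> ?N" using s by (auto intro: fs.span_base)
          from phi(2)[OF this] show ?thesis by (simp add: G1_def G2_def s A.h_act pairing_lins)
        qed
      qed
      then show "pairing n (hop (dual_rep \<rho>) a \<phi>) x = pairing n (fs (of_nat (coord la a)) \<phi>) x"
        by (simp add: G1_def G2_def pairing_dual[OF rep] pairing_lins fun_eq_iff)
    qed
  qed
  have "x = 0" if x: "x \<in> supp n" "\<And>w. pairing n (act (fop (dual_rep \<rho>)) w \<phi>) x = 0" for x
  proof (rule ccontr)
    assume "x \<noteq> 0"
    \<comment> \<open>The annihilator of the dual module generated by \<open>\<phi>\<close> is a
      submodule. If it contained \<open>x \<noteq> 0\<close> it would be everything, including
      \<open>v\<close>, on which \<open>\<phi>\<close> is 1.\<close>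
    define S where "S = {x \<in> supp n. \<forall>\<xi>\<in>word_span (fop (dual_rep \<rho>)) \<phi>. pairing n \<xi> x = 0}"
    have "S = supp n"
    proof (rule irreducible_stable_subspace[OF irr])
      show "fs.subspace S" unfolding S_def
        using fs.subspace_0[OF subspace_supp[of n]] fs.subspace_add[OF subspace_supp[of n]] fs.subspace_scale[OF subspace_supp[of n]]
        by (intro fs.subspaceI) (auto simp: pairing_lins)
      show "S \<subseteq> supp n" by (auto simp: S_def)
      show "eop \<rho> a z \<in> S" if "z \<in> S" for a z
        using that B.f_word_span unfolding S_def 
        by (auto simp: mop_supp[OF rc[OF gens_sl3(1)]] simp flip: pairing_dual[OF rep])
      show "fop \<rho> a z \<in> S" if "z \<in> S" for a z
        using that B.e_word_span unfolding S_def 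
        by (auto simp: mop_supp[OF rc[OF gens_sl3(2)]] simp flip: pairing_dual[OF rep])
      define G where "G \<xi> = (\<lambda>_::unit. pairing n \<xi> x)" for \<xi>
      have "G \<xi> = (\<lambda>_. 0) \<xi>" if "\<xi> \<in> fs.span (range (\<lambda>w. act (fop (dual_rep \<rho>)) w \<phi>))" for \<xi>
      proof (rule span_transfer[OF _ _ that])
        show "flin G" by (rule flinI; simp add: G_def pairing_lins pointwise)
        show "flin (\<lambda>_. 0)" by (rule flinI) simp_all
      qed (auto simp: G_def x(2) pointwise)
      then show "x \<in> S" using x(1) by (simp add: S_def word_span_def G_def fun_eq_iff zero_fun_apply)
    qed fact
    then have "v \<in> S" using v by simp
    moreover have "\<phi> \<in> word_span (fop (dual_rep \<rho>)) \<phi>"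
      unfolding word_span_def by (rule fs.span_base) (rule range_eqI[of _ _ "[]"], simp)
    ultimately have "pairing n \<phi> v = 0" by (simp add: S_def)
    then show False using phi(3) by simp
  qed
  then have "irrep n \<rho> (coord la) v \<phi>"
    using rep v phi(1,3) full A.sl3_hw_axioms B.sl3_hw_axioms by unfold_locales auto
  then show ?thesis by blast
qed

section \<open>Tensor products\<close>

definition tpair :: "nat \<Rightarrow> nat \<Rightarrow> (nat \<Rightarrow> complex) \<Rightarrow> (nat \<Rightarrow> complex) \<Rightarrow> (nat \<Rightarrow> complex) \<Rightarrow> complex" where
  "tpair n m \<xi> \<zeta> x = (\<Sum>i<n. \<Sum>j<m. \<xi> i * \<zeta> j * x (i * m + j))"

lemma tpair_lins:
  "tpair n m (\<xi> + \<xi>') \<zeta> x = tpair n m \<xi> \<zeta> x + tpair n m \<xi>' \<zeta> x" "tpair n m (fs c \<xi>) \<zeta> x = c * tpair n m \<xi> \<zeta> x"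
  "tpair n m \<xi> (\<zeta> + \<zeta>') x = tpair n m \<xi> \<zeta> x + tpair n m \<xi> \<zeta>' x" "tpair n m \<xi> (fs c \<zeta>) x = c * tpair n m \<xi> \<zeta> x"
  "tpair n m \<xi> \<zeta> (x + x') = tpair n m \<xi> \<zeta> x + tpair n m \<xi> \<zeta> x'" "tpair n m \<xi> \<zeta> (fs c x) = c * tpair n m \<xi> \<zeta> x"
  "tpair n m 0 \<zeta> x = 0" "tpair n m \<xi> 0 x = 0" "tpair n m \<xi> \<zeta> 0 = 0"
  by (simp_all add: tpair_def pointwise sum.distrib sum_distrib_left algebra_simps)

lemma tpair_sum: "tpair n m \<xi> \<zeta> (\<Sum>a\<in>A. f a) = (\<Sum>a\<in>A. tpair n m \<xi> \<zeta> (f a))"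
  by (induction A rule: infinite_finite_induct) (simp_all add: tpair_lins)

lemma mop_kron:
  assumes "A \<in> carrier_mat n n" "B \<in> carrier_mat m m" "i < n" "j < m"
  shows "mop (kron A B) x (i * m + j) = (\<Sum>a<n. \<Sum>b<m. A $$ (i, a) * B $$ (j, b) * x (a * m + b))"
proof -
  have "i * m + j < Suc i * m" using assms(4) by simp
  also have "\<dots> \<le> n * m" using assms(3) by (intro mult_right_mono) auto
  finally have lt: "i * m + j < n * m" .
  have "mop (kron A B) x (i * m + j) = (\<Sum>k<n * m. A $$ (i, k div m) * B $$ (j, k mod m) * x (k div m * m + k mod m))"
    using assms lt by (simp add: mop_def kron_def)
  also have "\<dots> = (\<Sum>a<n. \<Sum>b<m. A $$ (i, a) * B $$ (j, b) * x (a * m + b))"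
    by (rule sum_div_mod)
  finally show ?thesis .
qed

lemma sum4_swap:
  fixes F :: "nat \<Rightarrow> nat \<Rightarrow> nat \<Rightarrow> nat \<Rightarrow> complex"
  shows "(\<Sum>i\<in>I. \<Sum>j\<in>J. \<Sum>a\<in>A. \<Sum>b\<in>B. F i j a b) = (\<Sum>a\<in>A. \<Sum>b\<in>B. \<Sum>i\<in>I. \<Sum>j\<in>J. F i j a b)"
proof -
  have "(\<Sum>i\<in>I. \<Sum>j\<in>J. \<Sum>a\<in>A. \<Sum>b\<in>B. F i j a b) = (\<Sum>i\<in>I. \<Sum>a\<in>A. \<Sum>b\<in>B. \<Sum>j\<in>J. F i j a b)"
  proof (rule sum.cong[OF refl])
    fix i
    have "(\<Sum>j\<in>J. \<Sum>a\<in>A. \<Sum>b\<in>B. F i j a b) = (\<Sum>a\<in>A. \<Sum>j\<in>J. \<Sum>b\<in>B. F i j a b)"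
      by (rule sum.swap)
    also have "\<dots> = (\<Sum>a\<in>A. \<Sum>b\<in>B. \<Sum>j\<in>J. F i j a b)"
      by (intro sum.cong[OF refl] sum.swap)
    finally show "(\<Sum>j\<in>J. \<Sum>a\<in>A. \<Sum>b\<in>B. F i j a b) = (\<Sum>a\<in>A. \<Sum>b\<in>B. \<Sum>j\<in>J. F i j a b)" .
  qed
  also have "\<dots> = (\<Sum>a\<in>A. \<Sum>i\<in>I. \<Sum>b\<in>B. \<Sum>j\<in>J. F i j a b)" by (rule sum.swap)
  also have "\<dots> = (\<Sum>a\<in>A. \<Sum>b\<in>B. \<Sum>i\<in>I. \<Sum>j\<in>J. F i j a b)"
    by (intro sum.cong[OF refl] sum.swap)
  finally show ?thesis .
qed

lemma tpair_kron:
  assumes "A \<in> carrier_mat n n" "B \<in> carrier_mat m m"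
  shows "tpair n m \<xi> \<zeta> (mop (kron A B) x) = tpair n m (mop A\<^sup>T \<xi>) (mop B\<^sup>T \<zeta>) x"
proof -
  have "tpair n m \<xi> \<zeta> (mop (kron A B) x)
      = (\<Sum>i<n. \<Sum>j<m. \<xi> i * \<zeta> j * (\<Sum>a<n. \<Sum>b<m. A $$ (i, a) * B $$ (j, b) * x (a * m + b)))"
    by (simp add: tpair_def mop_kron[OF assms])
  also have "\<dots> = (\<Sum>i<n. \<Sum>j<m. \<Sum>a<n. \<Sum>b<m. (A $$ (i, a) * \<xi> i) * (B $$ (j, b) * \<zeta> j) * x (a * m + b))"
    by (simp add: sum_distrib_left mult_ac)
  also have "\<dots> = (\<Sum>a<n. \<Sum>b<m. \<Sum>i<n. \<Sum>j<m. (A $$ (i, a) * \<xi> i) * (B $$ (j, b) * \<zeta> j) * x (a * m + b))"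
    by (rule sum4_swap)
  also have "\<dots> = (\<Sum>a<n. \<Sum>b<m. (\<Sum>i<n. A $$ (i, a) * \<xi> i) * (\<Sum>j<m. B $$ (j, b) * \<zeta> j) * x (a * m + b))"
  proof (intro sum.cong[OF refl])
    fix a b
    show "(\<Sum>i<n. \<Sum>j<m. (A $$ (i, a) * \<xi> i) * (B $$ (j, b) * \<zeta> j) * x (a * m + b))
      = (\<Sum>i<n. A $$ (i, a) * \<xi> i) * (\<Sum>j<m. B $$ (j, b) * \<zeta> j) * x (a * m + b)"
      by (subst sum_product) (simp add: sum_distrib_right)
  qed
  also have "\<dots> = tpair n m (mop A\<^sup>T \<xi>) (mop B\<^sup>T \<zeta>) x"
    using assms by (simp add: tpair_def mop_def)
  finally show ?thesis .
qed

lemma tpair_tensor: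
  assumes "is_rep n \<rho>" "is_rep m \<sigma>" "X \<in> sl3"
  shows "tpair n m \<xi> \<zeta> (mop (tensor_rep n \<rho> m \<sigma> X) x) = tpair n m (mop (\<rho> X)\<^sup>T \<xi>) \<zeta> x + tpair n m \<xi> (mop (\<sigma> X)\<^sup>T \<zeta>) x"
proof -
  note c = rep_carrier[OF assms(1,3)] rep_carrier[OF assms(2,3)]
  have one: "mop (1\<^sub>m k) z i = z i" if "i < k" for k z i
  proof -
    have "mop (1\<^sub>m k) z i = (\<Sum>j<k. (if i = j then 1 else 0) * z j)"
      using that by (simp add: mop_def)
    also have "\<dots> = (\<Sum>j<k. if i = j then z j else 0)" by (rule sum.cong) auto
    finally show ?thesis using that by simp
  qed
  show ?thesis
    unfolding tensor_rep_def mop_add[OF kron_carrier[OF c(1) one_carrier_mat] kron_carrier[OF one_carrier_mat c(2)]]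
      tpair_lins tpair_kron[OF c(1) one_carrier_mat] tpair_kron[OF one_carrier_mat c(2)]
    by (simp add: tpair_def one)
qed

text \<open>\<open>d\<close> gives the coefficients of \<open>la + mu - nu\<close> in the simple roots.\<close>

definition weight_drop :: "(bool \<Rightarrow> nat) \<Rightarrow> (bool \<Rightarrow> nat) \<Rightarrow> (bool \<Rightarrow> nat) \<Rightarrow> (bool \<Rightarrow> nat) \<Rightarrow> bool" where
  "weight_drop la mu nu d \<longleftrightarrow> (\<forall>b. of_nat (nu b) = weight_sub la d b + of_nat (mu b))"

lemma weight_drop_unique: 
  assumes "weight_drop la mu nu d" "weight_drop la mu nu d'"
  shows "d = d'"
proof -
  have "weight_sub la d b = weight_sub la d' b" for b
    using assms unfolding weight_drop_def by (metis add_right_cancel)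
  from this[of True] this[of False] have eq: "2 * of_nat (d True) - of_nat (d False) = 2 * of_nat (d' True) - (of_nat (d' False) :: complex)"
    "2 * of_nat (d False) - of_nat (d True) = 2 * of_nat (d' False) - (of_nat (d' True) :: complex)"
    by (simp_all add: weight_sub_def cart_def algebra_simps)
  then have "2 * real (d True) - real (d False) = 2 * real (d' True) - real (d' False)"
    "2 * real (d False) - real (d True) = 2 * real (d' False) - real (d' True)"
    by (auto simp: complex_eq_iff)
  then have "d True = d' True" "d False = d' False" by linarith+
  then have "d b = d' b" for b by (cases b) auto
  then show ?thesis by auto
qed

text \<open>The second membership concerns the image of the first monomial under
  \<open>lr_swap\<close>, as words reach the second factor reversed.\<close>

definition mult_index_set :: "(bool \<Rightarrow> nat) \<Rightarrow> (bool \<Rightarrow> nat) \<Rightarrow> bool \<Rightarrow> nat \<Rightarrow> nat \<Rightarrow> nat set" where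
  "mult_index_set la mu a d n = {j. j \<le> n \<and> mono_expo a d j (n - j) \<in> box la \<and> mono_expo a d (n - j) j \<in> box mu}"

lemma length_count_list_bool: "length w = count_list w True + count_list w False"
  by (induction w) auto

lemma (in sl3_module) f_pow_zero_mono: "(f a ^^ s) x = 0 \<Longrightarrow> s \<le> t \<Longrightarrow> (f a ^^ t) x = 0"
proof -
  assume s: "(f a ^^ s) x = 0" "s \<le> t"
  have "(f a ^^ t) x = (f a ^^ (t - s)) ((f a ^^ s) x)"
    using s(2) by (metis funpow_add o_apply le_add_diff_inverse2)
  then show ?thesis using s(1) f_pow_lins(4) by simp
qed

lemma (in irrep) phi_pow_zero:
  shows "la a < l \<Longrightarrow> (fop (dual_rep \<rho>) a ^^ l) \<phi> = 0"
    and "la a + l < k \<Longrightarrow> (fop (dual_rep \<rho>) a ^^ k) ((fop (dual_rep \<rho>) (\<not> a) ^^ l) \<phi>) = 0"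
proof -
  interpret D: sl3_hw "eop (dual_rep \<rho>)" "fop (dual_rep \<rho>)" "hop (dual_rep \<rho>)" \<phi> la by (rule hw_phi)
  show z: "la a < l \<Longrightarrow> (fop (dual_rep \<rho>) a ^^ l) \<phi> = 0" for l
    by (rule D.f_pow_zero[OF phi_nonzero finite_mop_eigenvalues[where n = n]]) (simp_all add: word_span_phi)
  show "la a + l < k \<Longrightarrow> (fop (dual_rep \<rho>) a ^^ k) ((fop (dual_rep \<rho>) (\<not> a) ^^ l) \<phi>) = 0"
    using D.f_pow_zero_mono[OF D.f_pow_pow_zero[OF z[of "Suc (la a)"], of l]] by simp
qed

locale tensor_irrep = V: irrep n \<rho> la v \<phi> + W: irrep m \<sigma> mu w \<psi>
  for n \<rho> la v \<phi> m \<sigma> mu w \<psi>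
begin

abbreviation "tens \<equiv> tensor_rep n \<rho> m \<sigma>"
abbreviation "fV \<equiv> fop (dual_rep \<rho>)"
abbreviation "fW \<equiv> fop (dual_rep \<sigma>)"
abbreviation "tp \<equiv> tpair n m"

lemma tens_rep: "is_rep (n * m) tens"
  by (rule is_rep_tensor[OF V.rep W.rep])

lemma tp_e: "tp \<xi> \<zeta> (eop tens b x) = tp (fV b \<xi>) \<zeta> x + tp \<xi> (fW b \<zeta>) x"
  and tp_h: "tp \<xi> \<zeta> (hop tens b x) = tp (hop (dual_rep \<rho>) b \<xi>) \<zeta> x + tp \<xi> (hop (dual_rep \<sigma>) b \<zeta>) x"
  using tpair_tensor[OF V.rep W.rep] gens_sl3 by (simp_all add: dual_rep_def gens_transpose)

text \<open>Separation is applied in the first factor with the second covector fixed, then in the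
  second factor for each row.\<close>

lemma tp_separates:
  assumes x: "x \<in> supp (n * m)" and z: "\<And>p q. tp (act fV p \<phi>) (act fW q \<psi>) x = 0"
  shows "x = 0"
proof -
  have 1: "(\<Sum>j<m. act fW q \<psi> j * x (i * m + j)) = 0" if "i < n" for q i
  proof -
    define y where "y i = (if i < n then \<Sum>j<m. act fW q \<psi> j * x (i * m + j) else 0)" for i
    have "pairing n (act fV p \<phi>) y = tp (act fV p \<phi>) (act fW q \<psi>) x" for p
      by (simp add: pairing_def y_def tpair_def sum_distrib_left mult.assoc)
    then have "y = 0" using z by (intro V.separates) (auto simp: supp_def y_def)
    then have "y i = 0" by (simp add: zero_fun_apply)
    then show ?thesis using that by (simp add: y_def)
  qed
  have 2: "x (i * m + j) = 0" if "i < n" "j < m" for i j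
  proof -
    define y where "y j = (if j < m then x (i * m + j) else 0)" for j
    have "pairing m (act fW q \<psi>) y = 0" for q
      using 1[OF that(1), of q] by (simp add: pairing_def y_def)
    then have "y = 0" by (intro W.separates) (auto simp: supp_def y_def)
    then have "y j = 0" by (simp add: zero_fun_apply)
    then show ?thesis using that(2) by (simp add: y_def)
  qed
  show ?thesis
  proof
    fix k show "x k = 0 k"
    proof (cases "k < n * m")
      case True
      then have "x (k div m * m + k mod m) = 0" using div_mod_less[OF True] by (intro 2) auto
      then show ?thesis by (simp add: zero_fun_apply)
    qed (use x in \<open>simp add: supp_def zero_fun_apply\<close>)
  qed
qed

text \<open>On a vector killed by the raising operators a letter on one factor equals minus the same
  letter on the other. Moving the letters one by one reverses the word: the antipode.\<close>

lemma tp_move: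
  assumes "\<And>b. eop tens b u = 0"
  shows "tp (act fV p \<xi>) \<zeta> u = (- 1) ^ length p * tp \<xi> (act fW (rev p) \<zeta>) u"
proof (induction p arbitrary: \<zeta>)
  case (Cons b p)
  have "tp (fV b (act fV p \<xi>)) \<zeta> u + tp (act fV p \<xi>) (fW b \<zeta>) u = 0"
    using tp_e[of "act fV p \<xi>" \<zeta> b u] by (simp add: assms tpair_lins)
  then have "tp (act fV (b # p) \<xi>) \<zeta> u = - tp (act fV p \<xi>) (fW b \<zeta>) u"
    by (simp add: add_eq_0_iff2)
  then show ?case using Cons by simp
qed simp

lemma tp_move_all:
  assumes "\<And>b. eop tens b u = 0"
  shows "tp (act fV p \<phi>) (act fW q \<psi>) u = (- 1) ^ length q * tp (act fV (rev q @ p) \<phi>) \<psi> u"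
proof -
  have "(- 1) ^ length q * ((- 1) ^ length q * c) = c" for c :: complex
    by (simp flip: mult.assoc power_add)
  then show ?thesis
    using tp_move[OF assms, of "rev q" "act fV p \<phi>" \<psi>] by simp
qed

lemma tp_weight:
  assumes "hop tens b u = fs (of_nat (nu b)) u"
  shows "of_nat (nu b) * tp (act fV p \<phi>) (act fW q \<psi>) u
    = (weight_sub la (count_list p) b + weight_sub mu (count_list q) b) * tp (act fV p \<phi>) (act fW q \<psi>) u"
  using tp_h[of "act fV p \<phi>" "act fW q \<psi>" b u]
  by (simp add: assms sl3_hw.h_act[OF V.hw_phi] sl3_hw.h_act[OF W.hw_phi] tpair_lins algebra_simps)

lemma tp_deg:
  assumes "\<And>b. hop tens b u = fs (of_nat (nu b)) u" "tp (act fV p \<phi>) \<psi> u \<noteq> 0"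
  shows "weight_drop la mu nu (count_list p)"
  unfolding weight_drop_def
proof
  fix b
  show "of_nat (nu b) = weight_sub la (count_list p) b + of_nat (mu b)"
    using tp_weight[where nu = nu and p = p and q = "[]", OF assms(1)] assms(2)
    by (simp add: weight_sub_def[of mu])
qed

text \<open>\<open>tp_move_all\<close> reduces all pairings to those against \<open>\<psi>\<close>,
  and \<open>tp_deg\<close> leaves a single degree among these.\<close>

lemma highest_weight_vector_eq_zero:
  assumes u: "u \<in> supp (n * m)" "\<And>b. eop tens b u = 0" "\<And>b. hop tens b u = fs (of_nat (nu b)) u"
    and z: "\<And>p. weight_drop la mu nu (count_list p) \<Longrightarrow> tp (act fV p \<phi>) \<psi> u = 0"
  shows "u = 0"
proof (rule tp_separates[OF u(1)])
  fix p q
  have "tp (act fV (rev q @ p) \<phi>) \<psi> u = 0"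
  proof (rule ccontr)
    assume "tp (act fV (rev q @ p) \<phi>) \<psi> u \<noteq> 0"
    with z[OF tp_deg[OF u(3) this]] show False by simp
  qed
  then show "tp (act fV p \<phi>) (act fW q \<psi>) u = 0" by (simp add: tp_move_all[OF u(2), of p q])
qed

text \<open>For an index outside \<open>mult_index_set\<close> the test word pairs to zero. In cases
  1 and 2 its right end already kills \<open>\<phi>\<close>; in cases 3 and 4 its left end, moved
  across, kills \<open>\<psi>\<close>.\<close>

lemma highest_weight_vector_determined:
  assumes u: "u \<in> supp (n * m)" "\<And>b. eop tens b u = 0" "\<And>b. hop tens b u = fs (of_nat (nu b)) u"
    and d: "weight_drop la mu nu d" "d a = r + k" "d (\<not> a) = k"
    and z: "\<And>j. j \<in> mult_index_set la mu a r k \<Longrightarrow> tp (act fV (test_word a (r + k) k j) \<phi>) \<psi> u = 0"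
  shows "u = 0"
proof (rule highest_weight_vector_eq_zero[OF u])
  fix p assume "weight_drop la mu nu (count_list p)"
  then have p: "count_list p = d" using d(1) by (rule weight_drop_unique)
  interpret D: sl3_hw "eop (dual_rep \<rho>)" fV "hop (dual_rep \<rho>)" \<phi> la by (rule V.hw_phi)
  have test: "tp (act fV (test_word a (r + k) k j) \<phi>) \<psi> u = 0" if "j \<le> k" for j
  proof (cases "j \<in> mult_index_set la mu a r k")
    case False
    then have "\<not> (r + j \<le> la a \<and> k - j \<le> la (\<not> a) \<and> r + (k - j) \<le> mu a \<and> j \<le> mu (\<not> a))"
      using that by (simp add: mult_index_set_def mono_expo_box)
    then consider "la (\<not> a) < k - j" | "la a < r + j" | "mu (\<not> a) < j" | "mu a < r + (k - j)"
      by (meson not_le)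
    then show ?thesis
    proof cases
      case 1
      then show ?thesis
        using V.phi_pow_zero(1)[of "\<not> a" "k - j"] by (simp add: act_test_word D.f_pow_lins tpair_lins)
    next
      case 2
      then show ?thesis
        using V.phi_pow_zero(2)[of a "k - j" "r + k"] that by (simp add: act_test_word D.f_pow_lins tpair_lins)
    next
      case 3
      have "tp (act fV (test_word a (r + k) k j) \<phi>) \<psi> u
        = (- 1) ^ j * tp (act fV (replicate (r + k) a @ replicate (k - j) (\<not> a)) \<phi>) (act fW (replicate j (\<not> a)) \<psi>) u"
        using tp_move[OF u(2), of "replicate j (\<not> a)"] by (simp add: test_word_def)
      also have "act fW (replicate j (\<not> a)) \<psi> = 0"
        using W.phi_pow_zero(1)[OF 3] by (simp add: act_replicate)
      finally show ?thesis by (simp add: tpair_lins)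
    next
      case 4
      have "tp (act fV (test_word a (r + k) k j) \<phi>) \<psi> u
        = (- 1) ^ (j + (r + k)) * tp (act fV (replicate (k - j) (\<not> a)) \<phi>) (act fW (replicate (r + k) a @ replicate j (\<not> a)) \<psi>) u"
        using tp_move[OF u(2), of "replicate j (\<not> a) @ replicate (r + k) a"] by (simp add: test_word_def)
      also have "act fW (replicate (r + k) a @ replicate j (\<not> a)) \<psi> = 0"
        using W.phi_pow_zero(2)[of a j "r + k"] 4 that by (simp add: act_replicate)
      finally show ?thesis by (simp add: tpair_lins)
    qed
  qed (rule z)
  define G where "G x = (\<lambda>_::unit. tp x \<psi> u)" for x
  have "act fV p \<phi> \<in> fs.span ((\<lambda>j. (fV (\<not> a) ^^ j) ((fV a ^^ (r + k)) ((fV (\<not> a) ^^ (k - j)) \<phi>))) ` {..k})"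
    using p d by (intro D.word_mem_span) auto
  then have "G (act fV p \<phi>) = (\<lambda>_. 0) (act fV p \<phi>)"
  proof (rule span_transfer[rotated 2])
    show "flin G" by (rule flinI; simp add: G_def tpair_lins pointwise)
    show "flin (\<lambda>_. 0)" by (rule flinI) simp_all
  qed (use test in \<open>auto simp: G_def act_test_word pointwise\<close>)
  then show "tp (act fV p \<phi>) \<psi> u = 0" by (simp add: G_def fun_eq_iff zero_fun_apply)
qed

text \<open>Every linear relation between words acting on the covector therefore holds between their
  values at each monomial of the box.\<close>

lemma model_hom_exists:
  "irrep n' \<rho>' la' v' \<phi>' \<Longrightarrow> \<exists>T. flin T \<and> (\<forall>p. T (act (fop (dual_rep \<rho>')) p \<phi>') = trunc la' (act lowop p delta0))"
proof -
  assume "irrep n' \<rho>' la' v' \<phi>'"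
  then interpret U: irrep n' \<rho>' la' v' \<phi>' .
  have d: "trunc la' delta0 = delta0" by (auto simp: trunc_def delta0_def box_def)
  show ?thesis
    using highest_weight_hom_exists[OF U.hw_phi U.phi_nonzero sl3_hw_box finite_box_eigenvalues]
      act_trunc_lowop[of la' _ delta0] by (simp add: d)
qed

text \<open>The vector with prescribed pairings \<open>\<plusminus> L (p S(q))\<close>, where \<open>L\<close> is evaluation of words at one
  monomial and \<open>S\<close> the antipode. The two box conditions make this well defined in each argument.\<close>

lemma vector_of_monomial:
  assumes j: "j \<in> mult_index_set la mu a r k"
  shows "\<exists>u\<in>supp (n * m). \<forall>p q. tp (act fV p \<phi>) (act fW q \<psi>) u
    = (- 1) ^ length q * act lowop (rev q @ p) delta0 (mono_expo a r j (k - j))"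
proof -
  define x where "x = mono_expo a r j (k - j)"
  have xb: "x \<in> box la" "lr_swap x \<in> box mu" and jk: "j \<le> k"
    using j by (simp_all add: x_def mult_index_set_def lr_swap_mono_expo)
  \<comment> \<open>All words that the monomial detects have the same length, so the sign of
    \<open>q\<close> can be written as \<open>(- 1) ^ (length p + r)\<close>, which involves the
    first argument alone.\<close>
  have supp_len: "length w = r + 2 * k" if "act lowop w delta0 x \<noteq> 0" for w
    using that act_lowop_support[of w] jk
    by (cases a) (force simp: x_def mono_expo_def length_count_list_bool[of w])+
  obtain T where T: "flin T" "\<And>p. T (act fV p \<phi>) = trunc la (act lowop p delta0)"
    using model_hom_exists[OF V.irrep_axioms] by blast
  obtain T' where T': "flin T'" "\<And>q. T' (act fW q \<psi>) = trunc mu (act lowop q delta0)"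
    using model_hom_exists[OF W.irrep_axioms] by blast
  have trunc_eval: "y \<in> box nu \<Longrightarrow> act lowop s (trunc nu g) y = act lowop s g y" for y nu s g
    using fun_cong[OF trunc_act_lowop, of nu s g y] by (simp add: trunc_def)
  have lin_lowop: "flin (lowop b)" for b using sl3_model by (rule sl3_module.lin)
  have "\<exists>I c. finite I \<and> unit_fun i = (\<Sum>p\<in>I. fs (c p) (act fV p \<phi>))" if "i < n" for i
  proof -
    have "unit_fun i \<in> fs.span (range (\<lambda>w. act fV w \<phi>))"
      using unit_fun_supp[OF that] V.word_span_phi by (simp add: word_span_def)
    then show ?thesis by (rule mem_span_sum) blast
  qed
  then obtain I c where I: "\<And>i. i < n \<Longrightarrow> finite (I i) \<and> unit_fun i = (\<Sum>p\<in>I i. fs (c i p) (act fV p \<phi>))"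
    by metis
  \<comment> \<open>Row \<open>i\<close> of the tensor as a functional of the second covector:
    \<open>unit_fun i\<close> is expanded in words on \<open>\<phi>\<close>, and each word is
    carried, reversed, to the model of the second factor.\<close>
  define R where "R i \<zeta> = (\<lambda>_::unit. \<Sum>p\<in>I i. c i p * (- 1) ^ (length p + r) * act lowop (rev p) (T' \<zeta>) (lr_swap x))" for i \<zeta>
  have linR: "flin (R i)" for i
    by (rule flinI; simp add: R_def pointwise fp.linear_add[OF T'(1)] fp.linear_scale[OF T'(1)]
        fp.linear_add[OF lin_act[OF lin_lowop]] fp.linear_scale[OF lin_act[OF lin_lowop]] sum.distrib sum_distrib_left algebra_simps)
  define u where "u l = (if l < n * m then R (l div m) (unit_fun (l mod m)) () else 0)" for l
  have u: "u (i * m + j) = R i (unit_fun j) ()" if "i < n" "j < m" for i j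
  proof -
    have "i * m + j < Suc i * m" using that by simp
    also have "\<dots> \<le> n * m" using that by (intro mult_right_mono) auto
    finally show ?thesis using that by (simp add: u_def)
  qed
  have "tp (act fV p \<phi>) (act fW q \<psi>) u = (- 1) ^ length q * act lowop (rev q @ p) delta0 x" for p q
  proof -
    let ?\<zeta> = "act fW q \<psi>" and ?\<xi> = "act fV p \<phi>"
    \<comment> \<open>The same values read in the first factor. Since \<open>G\<close> is linear
      through \<open>T\<close>, the choice of the expansions of \<open>unit_fun i\<close> does not
      matter.\<close>
    define G where "G \<xi> = (\<lambda>_::unit. act lowop (rev q) (T \<xi>) x)" for \<xi>
    have linG: "flin G"
      by (rule flinI; simp add: G_def pointwise fp.linear_add[OF T(1)] fp.linear_scale[OF T(1)]
        fp.linear_add[OF lin_act[OF lin_lowop]] fp.linear_scale[OF lin_act[OF lin_lowop]])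
    have G: "G (act fV p \<phi>) () = act lowop (rev q @ p) delta0 x" for p
      by (simp add: G_def T(2) trunc_eval[OF xb(1)])
    have \<zeta>: "?\<zeta> \<in> supp m" by (rule act_fop_supp[OF is_rep_dual[OF W.rep] W.phi_supp])
    have \<xi>: "?\<xi> \<in> supp n" by (rule act_fop_supp[OF is_rep_dual[OF V.rep] V.phi_supp])
    have inner: "(\<Sum>j<m. ?\<zeta> j * u (i * m + j)) = (- 1) ^ length q * G (unit_fun i) ()" if i: "i < n" for i
    proof -
      have "(\<Sum>j<m. ?\<zeta> j * u (i * m + j)) = R i ?\<zeta> ()"
        using linear_supp_expand[OF linR \<zeta>] u[OF i] by simp
      also have "\<dots> = (\<Sum>p\<in>I i. c i p * (- 1) ^ (length p + r) * act lowop (rev q @ p) delta0 x)"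
        using act_lowop_rev[of "rev _ @ q" x] 
        by (simp add: R_def T'(2) trunc_eval[OF xb(2)])
      also have "\<dots> = (\<Sum>p\<in>I i. (- 1) ^ length q * (c i p * G (act fV p \<phi>) ()))"
      proof (rule sum.cong[OF refl])
        fix p
        show "c i p * (- 1) ^ (length p + r) * act lowop (rev q @ p) delta0 x = (- 1) ^ length q * (c i p * G (act fV p \<phi>) ())"
        proof (cases "act lowop (rev q @ p) delta0 x = 0")
          case True
          then show ?thesis unfolding G by simp
        next
          case False
          then have "length p + length q = r + 2 * k" using supp_len[of "rev q @ p"] by simp
          then have "even (length p + r) \<longleftrightarrow> even (length q)" by presburger
          then have "(- 1) ^ (length p + r) = ((- 1) ^ length q :: complex)"
            by (simp add: minus_one_power_iff)
          then show ?thesis unfolding G by simp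
        qed
      qed
      also have "\<dots> = (- 1) ^ length q * G (unit_fun i) ()"
      proof -
        have "unit_fun i = (\<Sum>p\<in>I i. fs (c i p) (act fV p \<phi>))" using I[OF i] by blast
        then have "G (unit_fun i) = (\<Sum>p\<in>I i. fs (c i p) (G (act fV p \<phi>)))"
          by (simp only: fp.linear_sum[OF linG] fp.linear_scale[OF linG])
        then show ?thesis by (simp add: pointwise sum_distrib_left)
      qed
      finally show ?thesis .
    qed
    have "tp ?\<xi> ?\<zeta> u = (\<Sum>i<n. ?\<xi> i * (\<Sum>j<m. ?\<zeta> j * u (i * m + j)))"
      by (simp add: tpair_def sum_distrib_left mult.assoc)
    also have "\<dots> = (\<Sum>i<n. ?\<xi> i * ((- 1) ^ length q * G (unit_fun i) ()))"
      by (rule sum.cong) (simp_all only: inner lessThan_iff)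
    also have "\<dots> = (- 1) ^ length q * (\<Sum>i<n. ?\<xi> i * G (unit_fun i) ())"
      by (simp add: sum_distrib_left mult_ac)
    also have "\<dots> = (- 1) ^ length q * G ?\<xi> ()"
      using linear_supp_expand[OF linG \<xi>] by simp
    finally show ?thesis unfolding G .
  qed
  moreover have "u \<in> supp (n * m)" by (simp add: supp_def u_def)
  ultimately show ?thesis unfolding x_def by blast
qed

text \<open>Putting a letter \<open>b\<close> in front of \<open>p\<close> or in front of
  \<open>q\<close> gives the same word \<open>rev q @ p\<close> with opposite signs, so
  \<open>u\<close> is killed by the raising operators. Its weight comes from the degree of the
  monomial.\<close>

lemma highest_weight_vector_of_monomial:
  assumes j: "j \<in> mult_index_set la mu a r k" and d: "weight_drop la mu nu d" "d a = r + k" "d (\<not> a) = k"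
  shows "\<exists>u\<in>supp (n * m). sl3_hw (eop tens) (fop tens) (hop tens) u nu
    \<and> (\<forall>p. tp (act fV p \<phi>) \<psi> u = act lowop p delta0 (mono_expo a r j (k - j)))"
proof -
  let ?x = "mono_expo a r j (k - j)"
  obtain u where u: "u \<in> supp (n * m)" 
    "\<And>p q. tp (act fV p \<phi>) (act fW q \<psi>) u = (- 1) ^ length q * act lowop (rev q @ p) delta0 ?x"
    using vector_of_monomial[OF j] by blast
  have jk: "j \<le> k" using j by (simp add: mult_index_set_def)
  have deg: "count_list w = d" if "act lowop w delta0 ?x \<noteq> 0" for w
  proof -
    have "count_list w a = d a \<and> count_list w (\<not> a) = d (\<not> a)"
      using that act_lowop_support[of w] jk d(2,3) by (cases a) (force simp: mono_expo_def)+
    then have "count_list w b = d b" for b by (cases "b = a") auto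
    then show ?thesis by auto
  qed
  have e: "eop tens b u = 0" for b
  proof (rule tp_separates)
    show "eop tens b u \<in> supp (n * m)" by (rule mop_supp[OF rep_carrier[OF tens_rep gens_sl3(1)]])
    show "tp (act fV p \<phi>) (act fW q \<psi>) (eop tens b u) = 0" for p q
      using u(2)[of "b # p" q] u(2)[of p "b # q"] by (simp add: tp_e)
  qed
  have h: "hop tens b u = fs (of_nat (nu b)) u" for b
  proof -
    have "hop tens b u - fs (of_nat (nu b)) u = 0"
    proof (rule tp_separates)
      show "hop tens b u - fs (of_nat (nu b)) u \<in> supp (n * m)"
        by (intro fs.subspace_diff[OF subspace_supp] fs.subspace_scale[OF subspace_supp] u(1)
            mop_supp[OF rep_carrier[OF tens_rep gens_sl3(3)]])
      fix p q
      let ?t = "tp (act fV p \<phi>) (act fW q \<psi>)"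
      have "?t (hop tens b u) = (weight_sub la (count_list p) b + weight_sub mu (count_list q) b) * ?t u"
        by (simp add: tp_h sl3_hw.h_act[OF V.hw_phi] sl3_hw.h_act[OF W.hw_phi] tpair_lins algebra_simps)
      also have "\<dots> = of_nat (nu b) * ?t u"
      proof (cases "?t u = 0")
        case False
        then have "count_list (rev q @ p) = d" using u(2)[of p q] by (intro deg) auto
        then have "d c = count_list q c + count_list p c" for c by auto
        then have "weight_sub la (count_list p) b + weight_sub mu (count_list q) b = weight_sub la d b + of_nat (mu b)"
          by (simp add: weight_sub_def algebra_simps)
        then show ?thesis using d(1) by (simp add: weight_drop_def)
      qed simp
      finally have eq: "?t (hop tens b u) = of_nat (nu b) * ?t u" .
      have "hop tens b u - fs (of_nat (nu b)) u = hop tens b u + fs (- of_nat (nu b)) u"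
        by (simp add: pointwise)
      then show "?t (hop tens b u - fs (of_nat (nu b)) u) = 0"
        using eq by (simp only: tpair_lins) simp
    qed
    then show ?thesis by simp
  qed
  have "sl3_hw (eop tens) (fop tens) (hop tens) u nu"
    by (intro sl3_hw.intro sl3_hw_axioms.intro sl3_rep[OF tens_rep] e h)
  then show ?thesis using u(1) u(2)[of _ "[]"] by (intro bexI[of _ u]) auto
qed

end

section \<open>Homomorphisms and highest weight vectors\<close>

lemma hom_mop:
  assumes "T \<in> hom_g k \<tau> r \<theta>" "is_rep k \<tau>" "is_rep r \<theta>" "X \<in> sl3"
  shows "mop T (mop (\<tau> X) x) = mop (\<theta> X) (mop T x)"
proof -
  have T: "T \<in> carrier_mat r k" "T * \<tau> X = \<theta> X * T" using assms by (auto simp: hom_g_def)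
  show ?thesis
    using mop_mult[OF T(1) rep_carrier[OF assms(2,4)], of x] mop_mult[OF rep_carrier[OF assms(3,4)] T(1), of x] T(2) by simp
qed

lemma mat_eq_mop:
  assumes "A \<in> carrier_mat r k" "B \<in> carrier_mat r k" "\<And>x. x \<in> supp k \<Longrightarrow> mop A x = mop B x"
  shows "A = B"
proof (rule eq_matI)
  fix i j assume ij: "i < dim_row B" "j < dim_col B"
  have "mop C (unit_fun j) i = C $$ (i, j)" if "C \<in> carrier_mat r k" for C
    using that ij assms(2) by (simp add: mop_def unit_fun_def if_distrib[of "\<lambda>z. _ * z"] cong: if_cong)
  then show "A $$ (i, j) = B $$ (i, j)"
    using assms ij unit_fun_supp[of j k] by (metis carrier_matD(2))
qed (use assms in auto)

context irrep
begin

lemma v_hom_image: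
  assumes T: "T \<in> hom_g n \<rho> r \<theta>" and \<theta>: "is_rep r \<theta>"
  shows "mop T v \<in> supp r" "eop \<theta> b (mop T v) = 0" "hop \<theta> b (mop T v) = fs (of_nat (la b)) (mop T v)"
    "mop T (act (fop \<rho>) p v) = act (fop \<theta>) p (mop T v)"
proof -
  have Tc: "T \<in> carrier_mat r n" using T by (simp add: hom_g_def)
  note hm = hom_mop[OF T rep \<theta>]
  show "mop T v \<in> supp r" by (rule mop_supp[OF Tc])
  show "eop \<theta> b (mop T v) = 0"
    using hm[OF gens_sl3(1), of b v] sl3_hw.e_y[OF hw_v, of b] by (simp add: fp.linear_0[OF lin_mop])
  show "hop \<theta> b (mop T v) = fs (of_nat (la b)) (mop T v)"
    using hm[OF gens_sl3(3), of b v] sl3_hw.h_y[OF hw_v, of b] by (simp add: fp.linear_scale[OF lin_mop])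
  show "mop T (act (fop \<rho>) p v) = act (fop \<theta>) p (mop T v)"
    by (induction p) (simp_all add: hm gens_sl3)
qed

text \<open>The map from \<open>highest_weight_hom_exists\<close> is known to respect words in the
  lowering operators only; \<open>T\<close> is its matrix. Commutation with the raising operators is
  derived, the rest is \<open>sl3_induct\<close>.\<close>

lemma hom_of_highest_weight_vector:
  assumes \<theta>: "is_rep r \<theta>" and u: "u \<in> supp r" "sl3_hw (eop \<theta>) (fop \<theta>) (hop \<theta>) u la"
  obtains T where "T \<in> hom_g n \<rho> r \<theta>" "mop T v = u"
proof -
  interpret A: sl3_hw "eop \<rho>" "fop \<rho>" "hop \<rho>" v la by (rule hw_v)
  interpret B: sl3_hw "eop \<theta>" "fop \<theta>" "hop \<theta>" u la by (rule u(2))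
  have "\<exists>T. flin T \<and> (\<forall>p. T (act (fop \<rho>) p v) = act (fop \<theta>) p u)"
    by (rule highest_weight_hom_exists[OF hw_v v_nonzero u(2) finite_mop_eigenvalues])
      (rule word_span_supp[OF \<theta> u(1)])
  then obtain S where S: "flin S" "\<And>p. S (act (fop \<rho>) p v) = act (fop \<theta>) p u" by blast
  have S_supp: "S x \<in> supp r" if "x \<in> supp n" for x
  proof -
    have "S x \<in> fs.span (range (\<lambda>p. act (fop \<theta>) p u))"
      using that unfolding word_span_v[symmetric] word_span_def
      by (rule span_image_subset[OF S(1)]) (auto simp: S(2) intro: fs.span_base)
    then show ?thesis using word_span_supp[OF \<theta> u(1)] by (auto simp: word_span_def)
  qed
  define T where "T = mat r n (\<lambda>(i, j). S (unit_fun j) i)"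
  have Tc: "T \<in> carrier_mat r n" by (simp add: T_def)
  have mop_T: "mop T x = S x" if x: "x \<in> supp n" for x
  proof
    fix i show "mop T x i = S x i"
      using linear_supp_expand[OF S(1) x] S_supp[OF x] by (auto simp: mop_def T_def supp_def mult.commute)
  qed
  \<comment> \<open>Both sides obey the same recursion when the raising operator is moved through
    the word, and both start at 0 on a highest weight vector.\<close>
  have E: "S (eop \<rho> b (act (fop \<rho>) p v)) = eop \<theta> b (act (fop \<theta>) p u)" for b p
  proof (induction p)
    case Nil
    then show ?case by (simp add: A.e_y B.e_y fp.linear_0[OF S(1)])
  next
    case (Cons c p)
    have Sf: "S (fop \<rho> c x) = fop \<theta> c (S x)" if "x \<in> supp n" for x
    proof -
      have lin: "flin (\<lambda>x. S (fop \<rho> c x))" "flin (\<lambda>x. fop \<theta> c (S x))"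
        by (rule flinI; simp add: fp.linear_add[OF S(1)] fp.linear_scale[OF S(1)] fp.linear_add[OF lin_mop] fp.linear_scale[OF lin_mop])+
      show ?thesis
        using that unfolding word_span_v[symmetric] word_span_def
      proof (rule span_transfer[OF lin])
        fix s assume "s \<in> range (\<lambda>w. act (fop \<rho>) w v)"
        then obtain w where "s = act (fop \<rho>) w v" by blast
        then show "S (fop \<rho> c s) = fop \<theta> c (S s)" using S(2)[of "c # w"] S(2)[of w] by simp
      qed
    qed
    have "S (fop \<rho> c (eop \<rho> b (act (fop \<rho>) p v))) = fop \<theta> c (eop \<theta> b (act (fop \<theta>) p u))"
      using Sf[OF mop_supp[OF rep_carrier[OF rep gens_sl3(1)]]] Cons by simp
    moreover have "S (hop \<rho> b (act (fop \<rho>) p v)) = hop \<theta> b (act (fop \<theta>) p u)"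
      by (simp add: A.h_act B.h_act fp.linear_scale[OF S(1)] S(2))
    ultimately show ?case
      by (cases "b = c") (simp_all add: A.ef B.ef fp.linear_add[OF S(1)] fp.linear_0[OF S(1)])
  qed
  have comm: "T * \<rho> X = \<theta> X * T" 
    if X: "X \<in> sl3" and eq: "\<And>p. S (mop (\<rho> X) (act (fop \<rho>) p v)) = mop (\<theta> X) (act (fop \<theta>) p u)" for X
  proof (rule mat_eq_mop)
    note c = rep_carrier[OF rep X] rep_carrier[OF \<theta> X]
    show "T * \<rho> X \<in> carrier_mat r n" "\<theta> X * T \<in> carrier_mat r n" using c Tc by auto
    fix x assume x: "x \<in> supp n"
    have lin: "flin (\<lambda>x. S (mop (\<rho> X) x))" "flin (\<lambda>x. mop (\<theta> X) (S x))"
      by (rule flinI; simp add: fp.linear_add[OF S(1)] fp.linear_scale[OF S(1)] fp.linear_add[OF lin_mop] fp.linear_scale[OF lin_mop])+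
    have "S (mop (\<rho> X) x) = mop (\<theta> X) (S x)"
      using x unfolding word_span_v[symmetric] word_span_def
      by (rule span_transfer[OF lin]) (auto simp: eq S(2))
    then show "mop (T * \<rho> X) x = mop (\<theta> X * T) x"
      unfolding mop_mult[OF Tc c(1)] mop_mult[OF c(2) Tc] mop_T[OF x] mop_T[OF mop_supp[OF c(1)]] .
  qed
  have "T * \<rho> X = \<theta> X * T" if "X \<in> sl3" for X
    using that
  proof (induction rule: sl3_induct)
    case (E a)
    show ?case using \<open>\<And>b p. S (eop \<rho> b (act (fop \<rho>) p v)) = _\<close> by (intro comm gens_sl3)
  next
    case (F a)
    show ?case using S(2)[of "a # _"] by (intro comm gens_sl3) simp
  next
    case (add X Y)
    note c = rep_carrier[OF rep add(1)] rep_carrier[OF rep add(2)] rep_carrier[OF \<theta> add(1)] rep_carrier[OF \<theta> add(2)]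
    show ?case
      unfolding rep_add[OF rep add(1,2)] rep_add[OF \<theta> add(1,2)]
        mult_add_distrib_mat[OF Tc c(1,2)] add_mult_distrib_mat[OF c(3,4) Tc] add(3,4) ..
  next
    case (smult z X)
    note c = rep_carrier[OF rep smult(1)] rep_carrier[OF \<theta> smult(1)]
    show ?case
      unfolding rep_smult[OF rep smult(1)] rep_smult[OF \<theta> smult(1)]
        mult_smult_distrib[OF Tc c(1)] mult_smult_assoc_mat[OF c(2) Tc] smult(2) ..
  next
    case (lie X Y)
    note c = rep_carrier[OF rep lie(1)] rep_carrier[OF rep lie(2)] rep_carrier[OF \<theta> lie(1)] rep_carrier[OF \<theta> lie(2)]
    have m: "T * (A * B) = (A' * B') * T" if "T * A = A' * T" "T * B = B' * T" "A \<in> carrier_mat n n" "B \<in> carrier_mat n n"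
      "A' \<in> carrier_mat r r" "B' \<in> carrier_mat r r" for A B A' B'
    proof -
      have "T * (A * B) = (A' * T) * B" using that Tc by (metis assoc_mult_mat)
      also have "\<dots> = (A' * B') * T" using that Tc by (metis assoc_mult_mat)
      finally show ?thesis .
    qed
    show ?case
      unfolding rep_lie[OF rep lie(1,2)] rep_lie[OF \<theta> lie(1,2)]
      unfolding lie_br_def mult_minus_distrib_mat[OF Tc mult_carrier_mat[OF c(1,2)] mult_carrier_mat[OF c(2,1)]]
        minus_mult_distrib_mat[OF mult_carrier_mat[OF c(3,4)] mult_carrier_mat[OF c(4,3)] Tc]
        m[OF lie(3,4) c] m[OF lie(4,3) c(2,1,4,3)] ..
  qed
  then have "T \<in> hom_g n \<rho> r \<theta>" using Tc by (simp add: hom_g_def)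
  moreover have "mop T v = u" using mop_T[OF v_supp] S(2)[of "[]"] by simp
  ultimately show ?thesis by (rule that)
qed

end

section \<open>Multiplicities\<close>

text \<open>A common bound makes the set under \<open>Max\<close> finite, and the empty family makes
  it nonempty, so \<open>Max\<close> has its intended value.\<close>

lemma dim_mats_bounds:
  assumes bound: "\<And>B. finite B \<Longrightarrow> B \<subseteq> S \<Longrightarrow> lin_indep_mats m n B \<Longrightarrow> card B \<le> q"
  shows "dim_mats m n S \<le> q"
    and "finite B \<Longrightarrow> B \<subseteq> S \<Longrightarrow> lin_indep_mats m n B \<Longrightarrow> card B \<le> dim_mats m n S"
proof -
  let ?C = "{card B | B. finite B \<and> B \<subseteq> S \<and> lin_indep_mats m n B}"
  have fin: "finite ?C" by (rule finite_subset[of _ "{..q}"]) (use bound in auto)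
  have "card ({} :: complex mat set) \<in> ?C" by (force simp: lin_indep_mats_def)
  then show "dim_mats m n S \<le> q"
    unfolding dim_mats_def using fin bound by (subst Max_le_iff) auto
  show "card B \<le> dim_mats m n S" if "finite B" "B \<subseteq> S" "lin_indep_mats m n B"
    unfolding dim_mats_def using fin that by (intro Max_ge) auto
qed

lemma sum_difference_of_two:
  fixes g :: "'b \<Rightarrow> complex"
  assumes "finite B" "s \<in> B" "t \<in> B" "s \<noteq> t"
  shows "(\<Sum>x\<in>B. (if x = s then 1 else if x = t then - 1 else 0) * g x) = g s - g t"
proof -
  have "(\<Sum>x\<in>B. (if x = s then 1 else if x = t then - 1 else 0) * g x)
      = (\<Sum>x\<in>B. (if x = s then g x else 0) - (if x = t then g x else 0))"
    using assms(4) by (intro sum.cong) auto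
  then show ?thesis using assms by (simp add: sum_subtractf)
qed

text \<open>More vectors than coordinates. A repeated vector is treated apart, since dependence is a
  notion for sets, not families.\<close>

lemma nontrivial_relation:
  fixes l :: "'b \<Rightarrow> 'j \<Rightarrow> complex"
  assumes "finite B" "finite J" "card J < card B"
  shows "\<exists>c. (\<exists>t\<in>B. c t \<noteq> 0) \<and> (\<forall>j\<in>J. (\<Sum>t\<in>B. c t * l t j) = 0)"
proof -
  define g where "g t = (\<lambda>j. if j \<in> J then l t j else 0)" for t
  define e where "e j = (\<lambda>i. if i = j then 1 else 0 :: complex)" for j :: 'j
  show ?thesis
  proof (cases "inj_on g B")
    case True
    have "g t \<in> fs.span (e ` J)" for t
    proof -
      have "g t = (\<Sum>j\<in>J. fs (l t j) (e j))"
        using assms(2) by (auto simp: pointwise g_def e_def if_distrib[of "\<lambda>z. _ * z"] cong: if_cong)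
      then show ?thesis by (metis (no_types, lifting) fs.span_base fs.span_scale fs.span_sum image_eqI)
    qed
    then have "g ` B \<subseteq> fs.span (e ` J)" by blast
    moreover have "card (e ` J) < card (g ` B)"
      using card_image_le[OF assms(2), of e] card_image[OF True] assms(3) by linarith
    ultimately have "fs.dependent (g ` B)"
      using fs.independent_span_bound[of "e ` J" "g ` B"] assms(2) by fastforce
    then obtain u v where u: "v \<in> g ` B" "u v \<noteq> 0" "(\<Sum>v\<in>g ` B. fs (u v) v) = 0"
      using fs.dependent_finite[of "g ` B"] assms(1) by blast
    have "(\<Sum>t\<in>B. fs (u (g t)) (g t)) = 0" using u(3) True by (simp add: sum.reindex)
    then have 0: "(\<Sum>t\<in>B. u (g t) * g t j) = 0" for j by (simp add: pointwise)
    have "(\<Sum>t\<in>B. u (g t) * l t j) = 0" if "j \<in> J" for j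
    proof -
      have "g t j = l t j" for t using that by (simp add: g_def)
      then show ?thesis using 0[of j] by simp
    qed
    then show ?thesis using u(1,2) by (intro exI[of _ "\<lambda>t. u (g t)"]) auto
  next
    case False
    then obtain s t where st: "s \<in> B" "t \<in> B" "s \<noteq> t" "g s = g t" by (auto simp: inj_on_def)
    have "l s j = l t j" if "j \<in> J" for j
    proof -
      have "g s j = g t j" by (simp only: st(4))
      then show ?thesis using that by (simp add: g_def)
    qed
    then show ?thesis
      using st sum_difference_of_two[OF assms(1) st(1-3)]
      by (intro exI[of _ "\<lambda>x. if x = s then 1 else if x = t then - 1 else 0"]) auto
  qed
qed

context tensor_irrep
begin

text \<open>A homomorphism is determined by its value at \<open>y\<close>, and that value by
  \<open>card J\<close> functionals. With more homomorphisms some nontrivial combination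
  \<open>G\<close> would vanish at \<open>y\<close>, hence everywhere.\<close>

lemma card_hom_le:
  assumes Y: "irrep k \<tau> nu y \<eta>" and J: "finite J"
    and key: "\<And>u. u \<in> supp (n * m) \<Longrightarrow> (\<And>b. eop tens b u = 0) \<Longrightarrow> (\<And>b. hop tens b u = fs (of_nat (nu b)) u)
      \<Longrightarrow> (\<And>j. j \<in> J \<Longrightarrow> tp (act fV (t j) \<phi>) \<psi> u = 0) \<Longrightarrow> u = 0"
    and B: "finite B" "B \<subseteq> hom_g k \<tau> (n * m) tens" "lin_indep_mats (n * m) k B"
  shows "card B \<le> card J"
proof (rule ccontr)
  assume "\<not> card B \<le> card J"
  then obtain c where c: "\<exists>T\<in>B. c T \<noteq> 0" "\<And>j. j \<in> J \<Longrightarrow> (\<Sum>T\<in>B. c T * tp (act fV (t j) \<phi>) \<psi> (mop T y)) = 0"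
    using nontrivial_relation[OF B(1) J, of "\<lambda>T j. tp (act fV (t j) \<phi>) \<psi> (mop T y)"] by force
  interpret Y: irrep k \<tau> nu y \<eta> by (rule Y)
  define G where "G x = (\<Sum>T\<in>B. fs (c T) (mop T x))" for x
  have linG: "flin G"
    by (rule flinI) (simp_all add: G_def fp.linear_add[OF lin_mop] fp.linear_scale[OF lin_mop] fs.scale_right_distrib
        sum.distrib fs.scale_sum_right mult.commute)
  note im = Y.v_hom_image[OF subsetD[OF B(2)] tens_rep]
  have "G y = 0"
  proof (rule key)
    show "G y \<in> supp (n * m)"
      unfolding G_def by (intro fs.subspace_sum[OF subspace_supp] fs.subspace_scale[OF subspace_supp] im(1))
    show "eop tens b (G y) = 0" for b
      by (simp add: G_def fp.linear_sum[OF lin_mop] fp.linear_scale[OF lin_mop] im(2))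
    show "hop tens b (G y) = fs (of_nat (nu b)) (G y)" for b
      by (simp add: G_def fp.linear_sum[OF lin_mop] fp.linear_scale[OF lin_mop] im(3) fs.scale_sum_right mult.commute)
    show "tp (act fV (t j) \<phi>) \<psi> (G y) = 0" if "j \<in> J" for j
      using c(2)[OF that] by (simp add: G_def tpair_sum tpair_lins)
  qed
  have "G (act (fop \<tau>) p y) = 0" for p
  proof -
    have "G (act (fop \<tau>) p y) = act (fop tens) p (G y)"
      by (simp add: G_def im(4) fp.linear_sum[OF lin_act[OF lin_mop]] fp.linear_scale[OF lin_act[OF lin_mop]])
    then show ?thesis by (simp add: \<open>G y = 0\<close> fp.linear_0[OF lin_act[OF lin_mop]])
  qed
  then have G0: "G x = 0" if "x \<in> supp k" for x
    using fp.linear_eq_0_on_span[OF linG, of "range (\<lambda>w. act (fop \<tau>) w y)" x] that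
    unfolding Y.word_span_v[symmetric] word_span_def by blast
  have "\<forall>i<n * m. \<forall>j<k. (\<Sum>T\<in>B. c T * T $$ (i, j)) = 0"
  proof (intro allI impI)
    fix i j assume ij: "i < n * m" "j < k"
    have "mop T (unit_fun j) i = T $$ (i, j)" if "T \<in> B" for T
    proof -
      have "T \<in> carrier_mat (n * m) k" using that B(2) by (auto simp: hom_g_def)
      then show ?thesis using ij by (simp add: mop_def unit_fun_def if_distrib[of "\<lambda>z. _ * z"] cong: if_cong)
    qed
    then have "(\<Sum>T\<in>B. c T * T $$ (i, j)) = G (unit_fun j) i" by (simp add: G_def pointwise)
    then show "(\<Sum>T\<in>B. c T * T $$ (i, j)) = 0" using G0[OF unit_fun_supp[OF ij(2)]] by (simp add: zero_fun_apply)
  qed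
  then show False using B(3) c(1) unfolding lin_indep_mats_def by blast
qed

lemma finite_mult_index_set: "finite (mult_index_set la mu a r l)"
  by (rule finite_subset[of _ "{..l}"]) (auto simp: mult_index_set_def)

text \<open>One homomorphism per admissible monomial; independence is read off from the triangular
  values of the test words.\<close>

lemma independent_homs_exist:
  assumes Y: "irrep k \<tau> nu y \<eta>" and d: "weight_drop la mu nu d" "d a = r + l" "d (\<not> a) = l"
  shows "\<exists>B. finite B \<and> B \<subseteq> hom_g k \<tau> (n * m) tens \<and> lin_indep_mats (n * m) k B \<and> card B = card (mult_index_set la mu a r l)"
proof -
  interpret Y: irrep k \<tau> nu y \<eta> by (rule Y)
  let ?J = "mult_index_set la mu a r l" and ?x = "\<lambda>j. mono_expo a r j (l - j)"
  have "\<exists>T\<in>hom_g k \<tau> (n * m) tens. \<forall>p. tp (act fV p \<phi>) \<psi> (mop T y) = act lowop p delta0 (?x j)" if jJ: "j \<in> ?J" for j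
  proof -
    obtain u where u: "u \<in> supp (n * m)" "sl3_hw (eop tens) (fop tens) (hop tens) u nu"
      "\<forall>p. tp (act fV p \<phi>) \<psi> u = act lowop p delta0 (?x j)"
      using highest_weight_vector_of_monomial[OF jJ d] by blast
    obtain T where "T \<in> hom_g k \<tau> (n * m) tens" "mop T y = u"
      by (rule Y.hom_of_highest_weight_vector[OF tens_rep u(1,2)])
    then show ?thesis using u(3) by blast
  qed
  then obtain T where T: "\<And>j. j \<in> ?J \<Longrightarrow> T j \<in> hom_g k \<tau> (n * m) tens"
    "\<And>j p. j \<in> ?J \<Longrightarrow> tp (act fV p \<phi>) \<psi> (mop (T j) y) = act lowop p delta0 (?x j)"
    by metis
  have Tc: "T j \<in> carrier_mat (n * m) k" if "j \<in> ?J" for j using T(1)[OF that] by (simp add: hom_g_def)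
  have indep: "c j = 0" if c: "\<forall>i<n * m. \<forall>q<k. (\<Sum>j\<in>?J. c j * T j $$ (i, q)) = 0" and j: "j \<in> ?J" for c j
  proof (rule ccontr)
    assume "c j \<noteq> 0"
    define bad where "bad = {j \<in> ?J. c j \<noteq> 0}"
    have bad: "finite bad" "bad \<noteq> {}" using finite_mult_index_set j \<open>c j \<noteq> 0\<close> by (auto simp: bad_def)
    define b where "b = Max bad"
    have "b \<in> bad" unfolding b_def by (rule Max_in[OF bad])
    then have b: "b \<in> ?J" "c b \<noteq> 0" by (simp_all add: bad_def)
    have bmax: "c i = 0" if "i \<in> ?J" "b < i" for i
    proof (rule ccontr)
      assume "c i \<noteq> 0"
      then have "i \<le> b" unfolding b_def using that(1) by (intro Max_ge bad(1)) (simp add: bad_def)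
      then show False using that(2) by simp
    qed
    have "(\<Sum>j\<in>?J. fs (c j) (mop (T j) y)) = 0"
    proof
      fix i
      show "(\<Sum>j\<in>?J. fs (c j) (mop (T j) y)) i = 0 i"
      proof (cases "i < n * m")
        case True
        have "(\<Sum>j\<in>?J. c j * mop (T j) y i) = (\<Sum>j\<in>?J. \<Sum>q<k. c j * T j $$ (i, q) * y q)"
        proof (rule sum.cong[OF refl])
          fix j assume "j \<in> ?J"
          with Tc have "T j \<in> carrier_mat (n * m) k" by blast
          then show "c j * mop (T j) y i = (\<Sum>q<k. c j * T j $$ (i, q) * y q)"
            using True by (simp add: mop_def sum_distrib_left mult.assoc)
        qed
        also have "\<dots> = (\<Sum>q<k. \<Sum>j\<in>?J. c j * T j $$ (i, q) * y q)" by (rule sum.swap)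
        also have "\<dots> = (\<Sum>q<k. (\<Sum>j\<in>?J. c j * T j $$ (i, q)) * y q)" by (simp add: sum_distrib_right)
        also have "\<dots> = 0" using c True by simp
        finally show ?thesis by (simp add: pointwise)
      next
        case False
        then have "mop (T j) y i = 0" if "j \<in> ?J" for j using Tc[OF that] by (simp add: mop_support)
        then show ?thesis by (simp add: pointwise)
      qed
    qed
    then have rel: "(\<Sum>j\<in>?J. c j * act lowop p delta0 (?x j)) = 0" for p
      using tpair_sum[of n m "act fV p \<phi>" \<psi> "\<lambda>j. fs (c j) (mop (T j) y)" ?J] by (simp add: tpair_lins T(2))
    \<comment> \<open>Testing with the largest index \<open>b\<close> of a nonzero coefficient:
      smaller indices vanish by triangularity, larger ones by the choice of
      \<open>b\<close>.\<close>
    let ?p = "test_word a (r + l) l b"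
    have "(\<Sum>j\<in>?J. c j * act lowop ?p delta0 (?x j)) = (\<Sum>j\<in>?J. if j = b then c b * act lowop ?p delta0 (?x b) else 0)"
    proof (rule sum.cong[OF refl])
      fix i assume i: "i \<in> ?J"
      then have "i \<le> l" by (simp add: mult_index_set_def)
      then show "c i * act lowop ?p delta0 (?x i) = (if i = b then c b * act lowop ?p delta0 (?x b) else 0)"
        using test_word_triangular(1)[of i l b a r] bmax[OF i] by (cases i b rule: linorder_cases) auto
    qed
    also have "\<dots> = c b * act lowop ?p delta0 (?x b)" using b(1) finite_mult_index_set by simp
    finally have "act lowop ?p delta0 (?x b) = 0" using rel b(2) by simp
    moreover have "b \<le> l" using b(1) by (simp add: mult_index_set_def)
    ultimately show False using test_word_triangular(2) by blast
  qed
  have inj: "inj_on T ?J"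
  proof (rule inj_onI, rule ccontr)
    fix s t assume st: "s \<in> ?J" "t \<in> ?J" "T s = T t" "s \<noteq> t"
    have "\<forall>i<n * m. \<forall>q<k. (\<Sum>j\<in>?J. (if j = s then 1 else if j = t then - 1 else 0) * T j $$ (i, q)) = 0"
      using sum_difference_of_two[OF finite_mult_index_set st(1,2,4)] st(3) by simp
    from indep[OF this st(1)] show False by simp
  qed
  show ?thesis
  proof (intro exI conjI)
    show "finite (T ` ?J)" using finite_mult_index_set by simp
    show "T ` ?J \<subseteq> hom_g k \<tau> (n * m) tens" using T(1) by blast
    show "card (T ` ?J) = card ?J" by (rule card_image[OF inj])
    show "lin_indep_mats (n * m) k (T ` ?J)"
      unfolding lin_indep_mats_def
    proof (intro allI impI ballI)
      fix c M assume c: "\<forall>i<n * m. \<forall>q<k. (\<Sum>M\<in>T ` ?J. c M * M $$ (i, q)) = 0" and M: "M \<in> T ` ?J"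
      then have "\<forall>i<n * m. \<forall>q<k. (\<Sum>j\<in>?J. c (T j) * T j $$ (i, q)) = 0"
        by (simp add: sum.reindex[OF inj])
      from indep[OF this] M show "c M = 0" by auto
    qed
  qed
qed

theorem dim_hom_tensor:
  assumes Y: "irrep k \<tau> nu y \<eta>" and d: "weight_drop la mu nu d" "d a = r + l" "d (\<not> a) = l"
  shows "dim_hom k \<tau> (n * m) tens = card (mult_index_set la mu a r l)"
proof -
  have le: "card B \<le> card (mult_index_set la mu a r l)"
    if "finite B" "B \<subseteq> hom_g k \<tau> (n * m) tens" "lin_indep_mats (n * m) k B" for B
    by (rule card_hom_le[OF Y finite_mult_index_set _ that, where t = "test_word a (r + l) l"])
      (rule highest_weight_vector_determined[OF _ _ _ d], auto)
  obtain B where "finite B" "B \<subseteq> hom_g k \<tau> (n * m) tens" "lin_indep_mats (n * m) k B"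
    "card B = card (mult_index_set la mu a r l)"
    using independent_homs_exist[OF Y d] by blast
  moreover have "dim_mats (n * m) k (hom_g k \<tau> (n * m) tens) \<le> card (mult_index_set la mu a r l)"
    by (rule dim_mats_bounds(1)) (rule le)
  moreover have "card B \<le> dim_mats (n * m) k (hom_g k \<tau> (n * m) tens)"
    if "finite B" "B \<subseteq> hom_g k \<tau> (n * m) tens" "lin_indep_mats (n * m) k B" for B
    by (rule dim_mats_bounds(2)[OF _ that]) (rule le)
  ultimately show ?thesis unfolding dim_hom_def by (metis le_antisym)
qed

theorem dim_hom_tensor_eq_0:
  assumes Y: "irrep k \<tau> nu y \<eta>" and "\<And>d. \<not> weight_drop la mu nu d"
  shows "dim_hom k \<tau> (n * m) tens = 0"
proof -
  have "card B \<le> card ({} :: nat set)"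
    if "finite B" "B \<subseteq> hom_g k \<tau> (n * m) tens" "lin_indep_mats (n * m) k B" for B
    by (rule card_hom_le[OF Y _ _ that]) (use assms(2) in \<open>auto intro: highest_weight_vector_eq_zero\<close>)
  then have "dim_mats (n * m) k (hom_g k \<tau> (n * m) tens) \<le> card ({} :: nat set)"
    by (rule dim_mats_bounds(1))
  then show ?thesis by (simp add: dim_hom_def)
qed

end

text \<open>Both index sets are intervals whose upper end is a minimum of three terms and whose
  lower end is a maximum of three, so the length is a minimum of nine differences, compared one at a
  time.\<close>

lemma card_mult_index_set_mono:
  assumes sum: "\<And>b. la b + mu b = la' b + mu' b"
    and min: "\<And>b. min (la b) (mu b) \<le> min (la' b) (mu' b)"
    and min_sum: "min (la True + la False) (mu True + mu False) \<le> min (la' True + la' False) (mu' True + mu' False)"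
  shows "card (mult_index_set la mu a r l) \<le> card (mult_index_set la' mu' a r l)"
proof -
  have eq: "mult_index_set la mu a r l = (if r \<le> la a then 
      {max (l - la (\<not> a)) (r + l - mu a)..min l (min (la a - r) (mu (\<not> a)))} else {})" for la mu
    by (auto simp: mult_index_set_def mono_expo_box)
  define A B C D where "A = la a" "B = mu a" "C = la (\<not> a)" "D = mu (\<not> a)"
  define A' B' C' D' where "A' = la' a" "B' = mu' a" "C' = la' (\<not> a)" "D' = mu' (\<not> a)"
  note defs = A_B_C_D_def A'_B'_C'_D'_def
  have s: "A + B = A' + B'" "C + D = C' + D'" "min A B \<le> min A' B'" "min C D \<le> min C' D'"
    "min (A + C) (B + D) \<le> min (A' + C') (B' + D')"
    using sum min min_sum unfolding defs by (cases a; simp add: add.commute)+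
  define lo hi where "lo = max (l - C) (r + l - B)" "hi = min l (min (A - r) D)"
  define lo' hi' where "lo' = max (l - C') (r + l - B')" "hi' = min l (min (A' - r) D')"
  have J: "mult_index_set la mu a r l = (if r \<le> A then {lo..hi} else {})"
    "mult_index_set la' mu' a r l = (if r \<le> A' then {lo'..hi'} else {})"
    unfolding eq defs lo_hi_def lo'_hi'_def by simp_all
  show ?thesis
  proof (cases "r \<le> A \<and> lo \<le> hi")
    case True
    \<comment> \<open>A nonempty interval forces \<open>r + l - B \<le> lo \<le> hi \<le> l\<close>,
      hence \<open>r \<le> min A B\<close>, and this bound passes to \<open>A'\<close> and
      \<open>B'\<close>.\<close>
    then have "r + l \<le> B + l" unfolding lo_hi_def by auto
    then have r: "r \<le> A'" "r \<le> B'" using True s by auto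
    have le: "hi \<le> l" "hi + r \<le> A" "hi \<le> D" "l \<le> lo + C" "r + l \<le> lo + B"
      using conjunct1[OF True] unfolding lo_hi_def by linarith+
    have m: "A \<le> A' \<or> B \<le> A'" "A \<le> B' \<or> B \<le> B'" "C \<le> C' \<or> D \<le> C'" "C \<le> D' \<or> D \<le> D'"
      "A + C \<le> A' + C' \<or> B + D \<le> A' + C'" "A + C \<le> B' + D' \<or> B + D \<le> B' + D'"
      using s by linarith+
    \<comment> \<open>The nine choices of an upper and a lower end, written additively because of
      truncated subtraction. The pairs \<open>A', C'\<close> and \<open>D', B'\<close> need the
      coroot of the highest root; \<open>A', B'\<close> and \<open>D', C'\<close> need only the
      fixed sums.\<close>
    have "hi \<le> l + lo" "hi + r \<le> A' + lo" "hi \<le> D' + lo"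
      using m(1,4) le by (elim disjE; linarith)+
    moreover have "hi + l \<le> l + lo + C'" "hi + r + l \<le> A' + lo + C'" "hi + l \<le> D' + lo + C'"
      using m(3,5) le s(2) by (elim disjE; linarith)+
    moreover have "hi + r \<le> lo + B'" "hi + r + l + r \<le> A' + lo + B'" "hi + r + l \<le> D' + lo + B'"
      using m(2,6) le s(1) by (elim disjE; linarith)+
    moreover have "hi' = l \<or> hi' + r = A' \<or> hi' = D'" "lo' = 0 \<or> lo' + C' = l \<or> lo' + B' = r + l"
      using r unfolding lo'_hi'_def by linarith+
    ultimately have "hi + lo' \<le> hi' + lo" by (elim disjE; linarith)
    then show ?thesis using True r by (simp add: J)
  qed (auto simp: J)
qed

lemma wpreceq_min:
  assumes "wpreceq (la, mu) (la', mu')"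
  shows "min (coord la b) (coord mu b) \<le> min (coord la' b) (coord mu' b)"
    and "min (coord la True + coord la False) (coord mu True + coord mu False)
      \<le> min (coord la' True + coord la' False) (coord mu' True + coord mu' False)"
proof -
  have wt: "Re (wt la (Hm b)) = real (coord la b)" "Re (wt la (diag3 1 0 (-1))) = real (coord la True + coord la False)" for la b
    by (auto simp: wt_def Hm_def diag3_def coord_def)
  have "Hm b \<in> pos_coroots" "diag3 1 0 (-1) \<in> pos_coroots" by (auto simp: pos_coroots_def Hm_def)
  then have "min (Re (wt la (Hm b))) (Re (wt mu (Hm b))) \<le> min (Re (wt la' (Hm b))) (Re (wt mu' (Hm b)))"
    "min (Re (wt la (diag3 1 0 (-1)))) (Re (wt mu (diag3 1 0 (-1))))
      \<le> min (Re (wt la' (diag3 1 0 (-1)))) (Re (wt mu' (diag3 1 0 (-1))))"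
    using assms unfolding wpreceq_def fst_conv snd_conv by blast+
  then show "min (coord la b) (coord mu b) \<le> min (coord la' b) (coord mu' b)"
    "min (coord la True + coord la False) (coord mu True + coord mu False)
      \<le> min (coord la' True + coord la' False) (coord mu' True + coord mu' False)"
    unfolding wt by linarith+
qed

theorem theorem1:
  fixes la1 la2 \<mu>1 \<mu>2 \<nu> :: dweight
    and n1 n2 m1 m2 k :: nat
    and \<rho>1 \<rho>2 \<sigma>1 \<sigma>2 \<tau> :: "complex mat \<Rightarrow> complex mat"
  assumes "wadd la1 la2 = wadd \<mu>1 \<mu>2"
    and "wpreceq (la1, la2) (\<mu>1, \<mu>2)"
    and "is_V n1 \<rho>1 la1" and "is_V n2 \<rho>2 la2"
    and "is_V m1 \<sigma>1 \<mu>1" and "is_V m2 \<sigma>2 \<mu>2"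
    and "is_V k \<tau> \<nu>"
  shows "dim_hom k \<tau> (n1 * n2) (tensor_rep n1 \<rho>1 n2 \<rho>2)
         \<le> dim_hom k \<tau> (m1 * m2) (tensor_rep m1 \<sigma>1 m2 \<sigma>2)"
proof -
  obtain v1 \<phi>1 where V1: "irrep n1 \<rho>1 (coord la1) v1 \<phi>1" using irrep_exists[OF assms(3)] by blast
  obtain v2 \<phi>2 where V2: "irrep n2 \<rho>2 (coord la2) v2 \<phi>2" using irrep_exists[OF assms(4)] by blast
  obtain w1 \<psi>1 where W1: "irrep m1 \<sigma>1 (coord \<mu>1) w1 \<psi>1" using irrep_exists[OF assms(5)] by blast
  obtain w2 \<psi>2 where W2: "irrep m2 \<sigma>2 (coord \<mu>2) w2 \<psi>2" using irrep_exists[OF assms(6)] by blast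
  obtain y \<eta> where Y: "irrep k \<tau> (coord \<nu>) y \<eta>" using irrep_exists[OF assms(7)] by blast
  interpret V: tensor_irrep n1 \<rho>1 "coord la1" v1 \<phi>1 n2 \<rho>2 "coord la2" v2 \<phi>2
    by (intro tensor_irrep.intro V1 V2)
  interpret W: tensor_irrep m1 \<sigma>1 "coord \<mu>1" w1 \<psi>1 m2 \<sigma>2 "coord \<mu>2" w2 \<psi>2
    by (intro tensor_irrep.intro W1 W2)
  have sum: "coord la1 b + coord la2 b = coord \<mu>1 b + coord \<mu>2 b" for b
    using assms(1) by (simp add: wadd_def coord_def)
  show ?thesis
  proof (cases "\<exists>d. weight_drop (coord la1) (coord la2) (coord \<nu>) d")
    case True
    then obtain d where d: "weight_drop (coord la1) (coord la2) (coord \<nu>) d" by blast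
    have "of_nat (coord la1 b) + of_nat (coord la2 b) = (of_nat (coord \<mu>1 b) + of_nat (coord \<mu>2 b) :: complex)" for b
      using sum[of b] by (metis of_nat_add)
    then have d': "weight_drop (coord \<mu>1) (coord \<mu>2) (coord \<nu>) d"
      using d by (simp add: weight_drop_def weight_sub_def algebra_simps)
    \<comment> \<open>\<open>a\<close> is the simple root with the larger coefficient. The same
      \<open>d\<close>, \<open>a\<close>, \<open>r\<close> serve both tensor products, since the
      sums of the weights agree.\<close>
    have "d (\<not> a) \<le> d a" if "a = (d False \<le> d True)" for a
      using that by (cases "d False \<le> d True") simp_all
    then obtain a where "d (\<not> a) \<le> d a" by blast
    then obtain r where r: "d a = r + d (\<not> a)" by (metis le_add_diff_inverse2)
    show ?thesis
      unfolding V.dim_hom_tensor[OF Y d r refl] W.dim_hom_tensor[OF Y d' r refl]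
      by (rule card_mult_index_set_mono) (use sum wpreceq_min[OF assms(2)] in auto)
  next
    case False
    then show ?thesis using V.dim_hom_tensor_eq_0[OF Y] by simp
  qed
qed

end
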